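(* Let $(C,T)=(C,T_1,T_2,\ldots)$ be a sequence of non-negative random variables, $N=\sum_{i\ge1}\mathbf{1}_{\{T_i>0\}}$ and $m(\theta)=\mathbb{E}\sum_{i=1}^NT_i^{\theta}\in[0,\infty]$ for $\theta\ge0$. Assume that $\mathbb{P}(T_i\in\{0,1\}\text{ for all }i\ge1)<1$ and $\mathbb{E}N>1$. Consider the condition $$( * )\qquad \inf_{\theta\in[0,1]}m(\theta)\le1.$$ (a) If $\mathfrak{F}_{\Sigma}(0,T)\setminus\{\delta_0\}\neq\emptyset$, then $( * )$ holds. If $N<\infty$ almost surely, then $\mathfrak{F}_{\Sigma}(0,T)\setminus\{\delta_0\}\neq\emptyset$ is equivalent to $( * )$. (b) Suppose that $\mathbb{P}(C>0)>0$. If $\mathfrak{F}_{\Sigma}(C,T)\neq\emptyset$, then $( * )$ holds; thus $( * )$ is also necessary for $W^*<\infty$ almost surely.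
   Context: Convention (made without loss of generality throughout): the $T_i$ are arranged such that $N=\sum_{i\ge1}\mathbf{1}_{\{T_i>0\}}=\sup\{i\ge1:T_i>0\}$ (with $\sup\emptyset=0$); in $m(\theta)$ only indices with $T_i>0$ contribute, so $m(0)=\mathbb{E}N$. Fixed points: $\mathfrak{F}_{\Sigma}(C,T)$ is the set of probability distributions $P$ on $[0,\infty)$ such that, if $X,X_1,X_2,\ldots$ are i.i.d. with distribution $P$ and $(X_i)_{i\ge1}$ is independent of $(C,T)$, then $X\stackrel{d}{=}C+\sum_{i\ge1}T_iX_i$. $\mathfrak{F}_{\Sigma}(0,T)$ is the same set with $C$ replaced by $0$. $\delta_0$ is the Dirac measure at $0$. Weighted branching model: $\mathbb{V}=\bigcup_{n\ge0}\mathbb{N}^n$ with $\mathbb{N}=\{1,2,\ldots\}$ and $\mathbb{N}^0=\{\varnothing\}$; $vi$ denotes $v$ with the entry $i$ appended. Let $(C(v),T(v))_{v\in\mathbb{V}}$, with $T(v)=(T_1(v),T_2(v),\ldots)$, be a family of i.i.d. copies of $(C,T)$ with $(C(\varnothing),T(\varnothing))=(C,T)$. Put $L(\varnothing)=1$, $L(vi)=L(v)T_i(v)$ for $v\in\mathbb{V}$, $i\in\mathbb{N}$, and $W^*=\sum_{v\in\mathbb{V}}L(v)C(v)\in[0,\infty]$. *)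

theory Defs
  imports "HOL-Probability.Probability"
begin

text \<open>Sequences \<open>T\<^sub>1, T\<^sub>2, \<dots>\<close> are indexed by \<^typ>\<open>nat\<close> from \<open>0\<close>, so that \<^term>\<open>T i\<close> stands
  for \<open>T\<^bsub>i+1\<^esub>\<close>; accordingly the vertices of the infinite tree are the lists in
  \<^typ>\<open>nat list\<close>, with root \<^term>\<open>[]\<close>.\<close>

definition offspring_number :: "(nat \<Rightarrow> 'a \<Rightarrow> real) \<Rightarrow> 'a \<Rightarrow> ennreal" where
  "offspring_number T \<omega> = (\<Sum>i. of_bool (T i \<omega> > 0))"

definition weight_moment :: "'a measure \<Rightarrow> (nat \<Rightarrow> 'a \<Rightarrow> real) \<Rightarrow> real \<Rightarrow> ennreal" where
  "weight_moment M T \<theta> =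
    (\<integral>\<^sup>+\<omega>. (\<Sum>i. if T i \<omega> > 0 then ennreal (T i \<omega> powr \<theta>) else 0) \<partial>M)"

text \<open>The law on \<open>[0,\<infinity>]\<close> of \<open>C + (\<Sum>i. T i * X i)\<close>, where the \<open>X i\<close> are i.i.d. with law \<open>P\<close>
  and independent of \<open>(C, T)\<close>. The \<open>X i\<close> are realised as the coordinates of a product space;
  by \<open>smoothing_law_realisation\<close> below every other realisation gives the same law.\<close>

definition smoothing_law ::
    "'a measure \<Rightarrow> ('a \<Rightarrow> real) \<Rightarrow> (nat \<Rightarrow> 'a \<Rightarrow> real) \<Rightarrow> real measure \<Rightarrow> ennreal measure" where
  "smoothing_law M C T P =
    distr (M \<Otimes>\<^sub>M (\<Pi>\<^sub>M i\<in>(UNIV :: nat set). P)) borel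
      (\<lambda>(\<omega>, x). ennreal (C \<omega>) + (\<Sum>i. ennreal (T i \<omega> * x i)))"

text \<open>The random series may a priori be infinite, so the two laws are compared on \<open>[0,\<infinity>]\<close>.\<close>

definition fixed_points ::
    "'a measure \<Rightarrow> ('a \<Rightarrow> real) \<Rightarrow> (nat \<Rightarrow> 'a \<Rightarrow> real) \<Rightarrow> real measure set" where
  "fixed_points M C T =
    {P. prob_space P \<and> sets P = sets borel \<and> (AE x in P. 0 \<le> x) \<and>
        distr P borel ennreal = smoothing_law M C T P}"

abbreviation seq_space :: "(real \<times> (nat \<Rightarrow> real)) measure" where
  "seq_space \<equiv> borel \<Otimes>\<^sub>M (\<Pi>\<^sub>M i\<in>(UNIV :: nat set). borel)"

definition weighted_branching ::
    "'a measure \<Rightarrow> ('a \<Rightarrow> real) \<Rightarrow> (nat \<Rightarrow> 'a \<Rightarrow> real) \<Rightarrow>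
      (nat list \<Rightarrow> 'a \<Rightarrow> real) \<Rightarrow> (nat list \<Rightarrow> nat \<Rightarrow> 'a \<Rightarrow> real) \<Rightarrow> bool" where
  "weighted_branching M C T CC TT \<longleftrightarrow>
    CC [] = C \<and> TT [] = T \<and>
    prob_space.indep_vars M (\<lambda>_. seq_space) (\<lambda>v \<omega>. (CC v \<omega>, \<lambda>i. TT v i \<omega>)) UNIV \<and>
    (\<forall>v. distr M seq_space (\<lambda>\<omega>. (CC v \<omega>, \<lambda>i. TT v i \<omega>)) =
         distr M seq_space (\<lambda>\<omega>. (C \<omega>, \<lambda>i. T i \<omega>)))"

text \<open>The closed form of \<open>L(\<emptyset>) = 1\<close>, \<open>L(vi) = L(v) T\<^sub>i(v)\<close>.\<close>

definition path_weight :: "(nat list \<Rightarrow> nat \<Rightarrow> 'a \<Rightarrow> real) \<Rightarrow> nat list \<Rightarrow> 'a \<Rightarrow> real" where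
  "path_weight TT v \<omega> = (\<Prod>k<length v. TT (take k v) (v ! k) \<omega>)"

lemma path_weight_Nil: "path_weight TT [] \<omega> = 1"
  by (simp add: path_weight_def)

lemma path_weight_snoc: "path_weight TT (v @ [i]) \<omega> = path_weight TT v \<omega> * TT v i \<omega>"
  by (simp add: path_weight_def nth_append)

definition total_weight ::
    "(nat list \<Rightarrow> 'a \<Rightarrow> real) \<Rightarrow> (nat list \<Rightarrow> nat \<Rightarrow> 'a \<Rightarrow> real) \<Rightarrow> 'a \<Rightarrow> ennreal" where
  "total_weight CC TT \<omega> = (\<integral>\<^sup>+v. ennreal (path_weight TT v \<omega> * CC v \<omega>) \<partial>count_space UNIV)"

lemma smoothing_law_realisation:
  fixes M :: "'a measure" and \<Omega> :: "'b measure"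
  assumes M: "prob_space M" and \<Omega>: "prob_space \<Omega>" and P: "prob_space P" "sets P = sets borel"
    and [measurable]: "C \<in> borel_measurable M" "\<And>i. T i \<in> borel_measurable M"
    and law: "distr \<Omega> seq_space (\<lambda>\<omega>. (C' \<omega>, \<lambda>i. T' i \<omega>)) =
              distr M seq_space (\<lambda>\<omega>. (C \<omega>, \<lambda>i. T i \<omega>))"
    and X: "prob_space.indep_vars \<Omega> (\<lambda>_. borel) X UNIV" "\<And>i. distr \<Omega> borel (X i) = P"
    and T': "C' \<in> borel_measurable \<Omega>" "\<And>i. T' i \<in> borel_measurable \<Omega>"
    and CT_X: "distr \<Omega> (seq_space \<Otimes>\<^sub>M (\<Pi>\<^sub>M i\<in>UNIV. borel)) (\<lambda>\<omega>. ((C' \<omega>, \<lambda>i. T' i \<omega>), \<lambda>i. X i \<omega>)) =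
              distr \<Omega> seq_space (\<lambda>\<omega>. (C' \<omega>, \<lambda>i. T' i \<omega>)) \<Otimes>\<^sub>M distr \<Omega> (\<Pi>\<^sub>M i\<in>UNIV. borel) (\<lambda>\<omega> i. X i \<omega>)"
  shows "distr \<Omega> borel (\<lambda>\<omega>. ennreal (C' \<omega>) + (\<Sum>i. ennreal (T' i \<omega> * X i \<omega>))) =
         smoothing_law M C T P"
proof -
  interpret \<Omega>: prob_space \<Omega> by fact
  interpret M: prob_space M by fact
  interpret P: prob_space P by fact
  let ?S = seq_space and ?B = "\<Pi>\<^sub>M i\<in>(UNIV :: nat set). (borel :: real measure)"
  let ?P = "\<Pi>\<^sub>M i\<in>(UNIV :: nat set). P"
  interpret PP: product_prob_space "\<lambda>_::nat. P" UNIV ..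
  have PP: "prob_space ?P" by (rule prob_space_PiM) (rule P(1))
  have setsPP: "sets ?P = sets ?B" by (intro sets_PiM_cong) (auto simp: P)
  define F :: "(real \<times> (nat \<Rightarrow> real)) \<times> (nat \<Rightarrow> real) \<Rightarrow> ennreal"
    where "F = (\<lambda>y. ennreal (fst (fst y)) + (\<Sum>i. ennreal (snd (fst y) i * snd y i)))"
  have [measurable]: "(\<lambda>y. snd (fst y) i) \<in> borel_measurable (?S \<Otimes>\<^sub>M ?B)"
    "(\<lambda>y. snd y i) \<in> borel_measurable (?S \<Otimes>\<^sub>M ?B)" for i
    by (rule measurable_compose[OF _ measurable_component_singleton[of i UNIV]]; simp)+
  have F [measurable]: "F \<in> borel_measurable (?S \<Otimes>\<^sub>M ?B)"
    unfolding F_def by measurable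
  have rvX [measurable]: "X i \<in> borel_measurable \<Omega>" for i
    using X(1) by (auto simp: \<Omega>.indep_vars_def)
  note T' [measurable]
  have rv: "(\<lambda>\<omega>. (C' \<omega>, \<lambda>i. T' i \<omega>)) \<in> measurable \<Omega> ?S" "(\<lambda>\<omega> i. X i \<omega>) \<in> measurable \<Omega> ?B"
    by (intro measurable_Pair T' measurable_PiM_single'; simp)+
  have lawX: "distr \<Omega> ?B (\<lambda>\<omega> i. X i \<omega>) = ?P"
    using X(1) \<Omega>.indep_vars_iff_distr_eq_PiM[of UNIV X "\<lambda>_. borel"] rvX by (simp add: X(2) restrict_UNIV)
  have CT: "(\<lambda>\<omega>. (C \<omega>, \<lambda>i. T i \<omega>)) \<in> measurable M ?S"
    by (intro measurable_Pair measurable_PiM_single'; simp)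
  have idP: "distr ?P ?B (\<lambda>x. x) = ?P"
    by (rule measure_eqI) (use setsPP in \<open>auto simp: emeasure_distr
        sets_eq_imp_space_eq[OF setsPP] cong: measurable_cong_sets\<close>)
  have sf: "sigma_finite_measure (distr ?P ?B (\<lambda>x. x))"
    unfolding idP using PP by (simp add: prob_space_imp_sigma_finite)
  have "distr \<Omega> (?S \<Otimes>\<^sub>M ?B) (\<lambda>\<omega>. ((C' \<omega>, \<lambda>i. T' i \<omega>), \<lambda>i. X i \<omega>)) =
        distr \<Omega> ?S (\<lambda>\<omega>. (C' \<omega>, \<lambda>i. T' i \<omega>)) \<Otimes>\<^sub>M distr \<Omega> ?B (\<lambda>\<omega> i. X i \<omega>)"
    by (rule CT_X)
  also have "\<dots> = distr M ?S (\<lambda>\<omega>. (C \<omega>, \<lambda>i. T i \<omega>)) \<Otimes>\<^sub>M distr ?P ?B (\<lambda>x. x)"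
    by (simp add: law lawX idP)
  also have "\<dots> = distr (M \<Otimes>\<^sub>M ?P) (?S \<Otimes>\<^sub>M ?B) (\<lambda>(\<omega>, x). ((C \<omega>, \<lambda>i. T i \<omega>), x))"
    by (rule pair_measure_distr[OF CT _ sf]) (simp add: measurable_cong_sets[OF setsPP refl])
  finally have eq: "distr \<Omega> (?S \<Otimes>\<^sub>M ?B) (\<lambda>\<omega>. ((C' \<omega>, \<lambda>i. T' i \<omega>), \<lambda>i. X i \<omega>)) = \<dots>" .
  have m1: "(\<lambda>\<omega>. ((C' \<omega>, \<lambda>i. T' i \<omega>), \<lambda>i. X i \<omega>)) \<in> measurable \<Omega> (?S \<Otimes>\<^sub>M ?B)"
    using rv by (rule measurable_Pair)
  have m2: "(\<lambda>(\<omega>, x). ((C \<omega>, \<lambda>i. T i \<omega>), x)) \<in> measurable (M \<Otimes>\<^sub>M ?P) (?S \<Otimes>\<^sub>M ?B)"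
  proof -
    have "(\<lambda>(\<omega>, x). ((C \<omega>, \<lambda>i. T i \<omega>), x)) \<in> measurable (M \<Otimes>\<^sub>M ?B) (?S \<Otimes>\<^sub>M ?B)"
      using CT by measurable
    then show ?thesis
      by (subst measurable_cong_sets[OF sets_pair_measure_cong[OF refl setsPP] refl])
  qed
  have "smoothing_law M C T P =
      distr (distr (M \<Otimes>\<^sub>M ?P) (?S \<Otimes>\<^sub>M ?B) (\<lambda>(\<omega>, x). ((C \<omega>, \<lambda>i. T i \<omega>), x))) borel F"
    unfolding distr_distr[OF F m2] smoothing_law_def
    by (intro arg_cong[where f = "distr (M \<Otimes>\<^sub>M ?P) borel"]) (auto simp: F_def fun_eq_iff)
  also have "\<dots> = distr \<Omega> borel (\<lambda>\<omega>. ennreal (C' \<omega>) + (\<Sum>i. ennreal (T' i \<omega> * X i \<omega>)))"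
    unfolding eq[symmetric] distr_distr[OF F m1] by (simp add: F_def o_def)
  finally show ?thesis ..
qed

end

theory Submission
  imports Defs
begin

text \<open>Write \<open>\<phi>\<close> for a Laplace transform, \<open>\<psi> = 1 - \<phi>\<close> and \<open>m(\<theta>)\<close> for the moment function.

  Necessity: in all three situations there is a law \<open>P \<noteq> \<delta>\<^sub>0\<close> on \<open>[0,\<infinity>)\<close> with
  \<open>\<phi>(t) \<le> E (\<Prod>i<n. \<phi>(t T\<^sub>i))\<close> for every \<open>n\<close>. With weights truncated to \<open>[1/n, n]\<close> this yields
  \<open>\<psi>(t) \<ge> (1 - \<delta>) E (\<Sum>i<n. \<psi>(t T\<^sub>i))\<close> for small \<open>t\<close>. The function \<open>x \<mapsto> ln \<psi>(e\<^sup>x)\<close> has slopes in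
  \<open>[0,1]\<close>; at a minimum of it plus a flat parabola it is almost minorised by an affine function of
  some slope \<open>s \<in> [0,1]\<close>, and the inequality at this point says that the truncated moment at \<open>s\<close> is
  at most about \<open>1\<close>. Compactness of \<open>[0,1]\<close> and Fatou's lemma remove the truncation.

  Sufficiency: cutting off large weights and all but finitely many of them and multiplying by
  \<open>1 - 1/(n+2)\<close> gives weights with \<open>m(0) > 1\<close> and \<open>m(\<kappa>) < 1\<close>, hence with \<open>m(\<alpha>) = 1\<close> and \<open>m(\<beta>) < 1\<close>
  for some \<open>\<alpha> < \<beta> \<le> 2\<alpha>\<close>. Iterating the smoothing transform on a law with \<open>\<psi>(t) = A t\<^sup>\<alpha> + O(t)\<close>
  contracts at rate \<open>m(\<beta>)\<close> in the distance \<open>sup \<bar>\<phi>(t) - \<phi>'(t)\<bar> / t\<^sup>\<beta>\<close> and converges to a nontrivial fixed point.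
  Rescale these fixed points to \<open>\<phi>(1) = c\<close>, where \<open>c < 1\<close> is so large that the generating function
  \<open>f\<close> of a truncated offspring number of mean \<open>> 1\<close> satisfies \<open>f(s) < s\<close> on \<open>[c,1)\<close>. A subsequential
  limit \<open>\<Phi>\<close> solves the equation for \<open>T\<close> because only finitely many weights are positive, and
  \<open>c \<le> \<Phi>(0+) \<le> f(\<Phi>(0+))\<close> forces \<open>\<Phi>(0+) = 1\<close>, so no mass is lost.\<close>

section \<open>Laplace transforms of laws on the half-line\<close>

definition laplace :: "real measure \<Rightarrow> real \<Rightarrow> real" where
  "laplace P t = (\<integral>x. exp (- (t * x)) \<partial>P)"

locale nonneg_law = real_distribution P for P +
  assumes nonneg: "AE x in P. 0 \<le> x"
begin

lemma prob_UNIV [simp]: "prob UNIV = 1"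
  using prob_space by simp

lemma AE_exp_le_1: "0 \<le> t \<Longrightarrow> AE x in P. norm (exp (- (t * x))) \<le> 1"
  using nonneg by eventually_elim simp

lemma integrable_exp: "0 \<le> t \<Longrightarrow> integrable P (\<lambda>x. exp (- (t * x)))"
  by (rule integrable_const_bound[of _ 1]) (use AE_exp_le_1 in auto)

lemma borel_measurable_laplace [measurable]: "laplace P \<in> borel_measurable borel"
  unfolding laplace_def by measurable

lemma laplace_0 [simp]: "laplace P 0 = 1"
  by (simp add: laplace_def prob_space)

lemma laplace_nonneg: "0 \<le> laplace P t"
  by (simp add: laplace_def)

lemma laplace_le_1: "0 \<le> t \<Longrightarrow> laplace P t \<le> 1"
  using integral_mono_AE[OF integrable_exp, of t "\<lambda>_. 1"] AE_exp_le_1[of t]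
  by (auto simp: laplace_def prob_space)

lemma laplace_antimono: "0 \<le> s \<Longrightarrow> s \<le> t \<Longrightarrow> laplace P t \<le> laplace P s"
  unfolding laplace_def using nonneg
  by (intro integral_mono_AE integrable_exp) (auto elim!: eventually_mono intro: mult_right_mono)

text \<open>Convexity of exp, integrated: \<open>1 - laplace P\<close> is concave and vanishes at 0.
  This bounds the slopes of \<open>ln \<psi> (exp x)\<close> by 1 and later controls the effect of
  rescaling weights by a factor close to 1.\<close>

lemma laplace_scale:
  assumes "0 \<le> s" "s \<le> 1" "0 \<le> t"
  shows "s * (1 - laplace P t) \<le> 1 - laplace P (s * t)"
proof -
  have conv: "exp (- (s * t * x)) \<le> (1 - s) + s * exp (- (t * x))" for x
    using convex_onD[OF exp_convex, of s 0 "- (t * x)"] assms by (simp add: mult.assoc)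
  have "laplace P (s * t) \<le> (\<integral>x. (1 - s) + s * exp (- (t * x)) \<partial>P)"
    unfolding laplace_def using assms conv
    by (intro integral_mono integrable_exp Bochner_Integration.integrable_add integrable_mult_right) auto
  also have "\<dots> = (1 - s) + s * laplace P t"
    unfolding laplace_def using assms
    by (subst Bochner_Integration.integral_add) (auto simp: integrable_exp prob_space)
  finally show ?thesis by (simp add: algebra_simps)
qed

lemma tendsto_laplace:
  assumes "x \<longlonglongrightarrow> a" "\<And>n. 0 \<le> x n"
  shows "(\<lambda>n. laplace P (x n)) \<longlonglongrightarrow> laplace P a"
  unfolding laplace_def
proof (rule integral_dominated_convergence[where w = "\<lambda>_. 1"])
  show "AE y in P. norm (exp (- (x n * y))) \<le> 1" for n
    using AE_exp_le_1 assms by auto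
  show "AE y in P. (\<lambda>n. exp (- (x n * y))) \<longlonglongrightarrow> exp (- (a * y))"
    using assms by (auto intro!: tendsto_intros)
qed auto

lemma continuous_laplace: "continuous_on {0..} (laplace P)"
  by (auto simp: continuous_on_sequentially o_def intro!: tendsto_laplace)

lemma laplace_tendsto_1:
  assumes "x \<longlonglongrightarrow> 0" "\<And>n. 0 \<le> x n"
  shows "(\<lambda>n. laplace P (x n)) \<longlonglongrightarrow> 1"
  using tendsto_laplace[OF assms] by simp

text \<open>The nonnegative function \<open>1 - exp (- (t * x))\<close> then has integral 0, so x =
  0 almost surely.\<close>

lemma laplace_eq_1D:
  assumes "0 < t" "laplace P t = 1"
  shows "P = return borel 0"
proof -
  have "(\<integral>x. 1 - exp (- (t * x)) \<partial>P) = 0"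
    using assms integrable_exp[of t]
    by (subst Bochner_Integration.integral_diff) (auto simp: laplace_def prob_space)
  moreover have "AE x in P. 0 \<le> 1 - exp (- (t * x))"
    using nonneg by eventually_elim (use assms in simp)
  ultimately have "AE x in P. 1 - exp (- (t * x)) = 0"
    using integral_nonneg_eq_0_iff_AE[of P "\<lambda>x. 1 - exp (- (t * x))"] assms integrable_exp[of t]
    by auto
  then have ae: "AE x in P. x = 0"
    by eventually_elim (use assms in simp)
  show ?thesis
  proof (rule measure_eqI)
    fix A assume A: "A \<in> sets P"
    have "emeasure P A = emeasure P (if 0 \<in> A then space P else {})"
      using A ae by (intro emeasure_eq_AE) auto
    then show "emeasure P A = emeasure (return borel 0) A"
      using A by (simp add: emeasure_space_1 del: space_eq_univ)
  qed simp
qed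

lemma laplace_less_1:
  assumes "P \<noteq> return borel 0" "0 < t"
  shows "laplace P t < 1"
  using laplace_eq_1D[of t] laplace_le_1[of t] assms by fastforce

end

section \<open>A law with a prescribed power of t in its Laplace transform at the origin\<close>

lemma tail_powr:
  fixes p c :: real
  assumes "1 < p" "0 < c"
  shows "set_integrable lborel {c..} (\<lambda>w. w powr (- p))"
    and "(LINT w:{c..}|lborel. w powr (- p)) = c powr (1 - p) / (p - 1)"
proof -
  have "(\<integral>\<^sup>+w. ennreal (w powr (- p)) * indicator {c..} w \<partial>lborel) = ennreal (0 - (- (c powr (1 - p)) / (p - 1)))"
  proof (rule nn_integral_FTC_atLeast)
    fix w assume "c \<le> w"
    then have "((\<lambda>w. w powr (1 - p)) has_real_derivative (1 - p) * w powr (1 - p - 1)) (at w)"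
      using assms by (intro has_real_derivative_powr) auto
    from DERIV_cdivide[OF DERIV_minus[OF this], of "p - 1"]
    show "((\<lambda>w. - (w powr (1 - p)) / (p - 1)) has_real_derivative w powr (- p)) (at w)"
      by (rule DERIV_cong) (use assms in \<open>simp add: field_simps\<close>)
  next
    have "((\<lambda>w. w powr (1 - p)) \<longlongrightarrow> 0) at_top"
      using assms by (intro tendsto_neg_powr filterlim_ident) auto
    from tendsto_mult_left_zero[OF this, of "- 1 / (p - 1)"]
    show "((\<lambda>w. - (w powr (1 - p)) / (p - 1)) \<longlongrightarrow> 0) at_top"
      by (simp add: field_simps)
  qed auto
  moreover have eq: "ennreal (indicator {c..} w *\<^sub>R x) = ennreal x * indicator {c..} w" for w x :: real
    by (simp split: split_indicator)
  ultimately have "(\<integral>\<^sup>+w. ennreal (indicator {c..} w *\<^sub>R w powr (- p)) \<partial>lborel) = ennreal (c powr (1 - p) / (p - 1))"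
    by (simp only: eq) simp
  then have "has_bochner_integral lborel (\<lambda>w. indicator {c..} w *\<^sub>R w powr (- p)) (c powr (1 - p) / (p - 1))"
    using assms by (intro has_bochner_integral_nn_integral) auto
  then show "set_integrable lborel {c..} (\<lambda>w. w powr (- p))"
    "(LINT w:{c..}|lborel. w powr (- p)) = c powr (1 - p) / (p - 1)"
    by (auto simp: set_integrable_def set_lebesgue_integral_def has_bochner_integral_iff)
qed

text \<open>The law of \<open>U powr (- 1 / \<alpha>)\<close> with \<open>U\<close> uniform on \<open>(0,1)\<close> is in the domain of attraction of an
  \<open>\<alpha>\<close>-stable law.\<close>

lemma exists_law_with_power_tail:
  assumes \<alpha>: "0 < \<alpha>" "\<alpha> < 1"
  obtains P A K where "nonneg_law P" "0 < A" "0 \<le> K"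
    "\<And>t. 0 \<le> t \<Longrightarrow> t \<le> 1 \<Longrightarrow> \<bar>1 - laplace P t - A * t powr \<alpha>\<bar> \<le> K * t"
proof -
  \<comment> \<open>The substitution u = t^\<alpha> w turns \<open>1 - laplace P t\<close> into
    t^\<alpha> times the integral of \<open>g\<close> over (0, t^(-\<alpha>)). Extending the
    integral to the half-line gives A t^\<alpha>; the discarded tail from c = t^(-\<alpha>) on is at
    most c^(1-p)/(p-1) = t^(1-\<alpha>)/(p-1), hence the error O(t).\<close>
  define p where "p = 1 / \<alpha>"
  have p: "1 < p" using \<alpha> by (simp add: p_def)
  define g where "g w = 1 - exp (- (w powr (- p)))" for w :: real
  have [measurable]: "g \<in> borel_measurable borel" unfolding g_def by measurable
  have g: "0 \<le> g w" "g w \<le> 1" "g w \<le> w powr (- p)" for w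
    using exp_ge_add_one_self[of "- (w powr (- p))"] by (auto simp: g_def)
  have int0: "set_integrable lborel {0<..<c} g" for c :: real
    unfolding set_integrable_def
  proof (rule Bochner_Integration.integrable_bound[of _ "indicator {0<..<c} :: real \<Rightarrow> real"])
    show "integrable lborel (indicator {0<..<c} :: real \<Rightarrow> real)"
      by (intro integrable_real_indicator emeasure_bounded_finite) auto
    show "AE w in lborel. norm (indicator {0<..<c} w *\<^sub>R g w) \<le> norm (indicator {0<..<c} w :: real)"
      using g by (auto split: split_indicator)
  qed measurable
  have intc: "set_integrable lborel {c..} g" if "0 < c" for c
    unfolding set_integrable_def
    by (rule Bochner_Integration.integrable_bound[OF tail_powr(1)[OF p that, unfolded set_integrable_def]])
       (use g in \<open>auto simp: indicator_def\<close>)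
  define A where "A = (LINT w:{0<..}|lborel. g w)"
  have split: "A = (LINT w:{0<..<c}|lborel. g w) + (LINT w:{c..}|lborel. g w)" if "0 < c" for c
  proof -
    have eq: "{0<..} = {0<..<c} \<union> {c..}" using that by auto
    show ?thesis
      unfolding A_def eq by (rule set_integral_Un[OF _ int0 intc[OF that]]) auto
  qed
  have tail: "0 \<le> (LINT w:{c..}|lborel. g w)" "(LINT w:{c..}|lborel. g w) \<le> c powr (1 - p) / (p - 1)" if "0 < c" for c
  proof -
    show "0 \<le> (LINT w:{c..}|lborel. g w)"
      unfolding set_lebesgue_integral_def by (intro Bochner_Integration.integral_nonneg) (use g in auto)
    have "(LINT w:{c..}|lborel. g w) \<le> (LINT w:{c..}|lborel. w powr (- p))"
      by (rule set_integral_mono[OF intc[OF that] tail_powr(1)[OF p that]]) (rule g)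
    then show "(LINT w:{c..}|lborel. g w) \<le> c powr (1 - p) / (p - 1)"
      by (simp add: tail_powr(2)[OF p that])
  qed
  have A: "0 < A"
  proof -
    have "(LINT w:{0<..<1::real}|lborel. 1 - exp (- 1 :: real)) \<le> (LINT w:{0<..<1}|lborel. g w)"
    proof (rule set_integral_mono)
      show "set_integrable lborel {0<..<1::real} (\<lambda>w. 1 - exp (- 1 :: real))"
        unfolding set_integrable_def by simp
      fix w :: real assume "w \<in> {0<..<1}"
      then have "1 \<le> w powr (- p)" using p by (auto simp: powr_minus intro!: one_le_inverse powr_le1)
      then show "1 - exp (- 1) \<le> g w" by (simp add: g_def)
    qed (rule int0)
    moreover have "(LINT w:{0<..<1::real}|lborel. 1 - exp (- 1 :: real)) = 1 - exp (- 1)"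
      by (simp add: set_lebesgue_integral_def)
    moreover have "exp (- 1 :: real) < 1" by simp
    ultimately show ?thesis
      using split[OF zero_less_one] tail(1)[OF zero_less_one] by linarith
  qed
  define U where "U = density lborel (\<lambda>u. ennreal (indicator {0<..<1::real} u))"
  interpret U: prob_space U
    by (rule prob_spaceI) (simp add: U_def emeasure_density ennreal_indicator)
  have setsU [measurable_cong]: "sets U = sets borel" by (simp add: U_def)
  define P where "P = distr U borel (\<lambda>u. u powr (- p))"
  have "AE x in P. 0 \<le> x" unfolding P_def by (subst AE_distr_iff) auto
  then have P: "nonneg_law P"
    unfolding nonneg_law_def nonneg_law_axioms_def P_def by (auto intro: U.real_distribution_distr)
  interpret P: nonneg_law P by fact
  have main: "1 - laplace P t = t powr \<alpha> * (LINT w:{0<..<t powr (- \<alpha>)}|lborel. g w)" if t: "0 < t" for t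
  proof -
    define f where "f u = indicator {0<..<1} u * (1 - exp (- (t * u powr (- p))))" for u :: real
    have int: "integrable U (\<lambda>u. exp (- (t * u powr (- p))))"
    proof (rule U.integrable_const_bound[of _ 1])
      show "(\<lambda>u. exp (- (t * u powr (- p)))) \<in> borel_measurable U"
        unfolding measurable_cong_sets[OF setsU refl] by measurable
    qed (use t in simp)
    have "1 - laplace P t = (\<integral>u. 1 - exp (- (t * u powr (- p))) \<partial>U)"
      unfolding laplace_def P_def
      using int by (subst integral_distr) (auto simp: U.prob_space)
    also have "\<dots> = (\<integral>u. f u \<partial>lborel)"
      unfolding U_def f_def by (subst integral_density) auto
    also have "\<dots> = t powr \<alpha> * (\<integral>w. f (0 + t powr \<alpha> * w) \<partial>lborel)"
      using t by (subst lborel_integral_real_affine[of "t powr \<alpha>" _ 0]) auto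
    also have "(\<integral>w. f (0 + t powr \<alpha> * w) \<partial>lborel) = (\<integral>w. indicator {0<..<t powr (- \<alpha>)} w *\<^sub>R g w \<partial>lborel)"
    proof (rule Bochner_Integration.integral_cong[OF refl])
      fix w :: real
      have "(t powr \<alpha> * w < 1) = (w < t powr (- \<alpha>))"
        using t by (simp add: powr_minus field_simps)
      moreover have "t * (t powr \<alpha> * w) powr (- p) = w powr (- p)" if "0 < w"
      proof -
        have "(t powr \<alpha> * w) powr (- p) = t powr (- 1) * w powr (- p)"
          using \<alpha> t that by (simp add: powr_mult powr_powr p_def)
        then show ?thesis using t by (simp add: powr_minus)
      qed
      ultimately show "f (0 + t powr \<alpha> * w) = indicator {0<..<t powr (- \<alpha>)} w *\<^sub>R g w"
        using t by (auto simp: f_def g_def indicator_def zero_less_mult_iff)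
    qed
    finally show ?thesis by (simp add: set_lebesgue_integral_def)
  qed
  show ?thesis
  proof (rule that[OF P A, of "1 / (p - 1)"])
    fix t :: real assume t: "0 \<le> t" "t \<le> 1"
    show "\<bar>1 - laplace P t - A * t powr \<alpha>\<bar> \<le> 1 / (p - 1) * t"
    proof (cases "t = 0")
      case False
      then have t0: "0 < t" using t by simp
      define c where "c = t powr (- \<alpha>)"
      have c: "0 < c" using t0 by (simp add: c_def)
      have "1 - laplace P t - A * t powr \<alpha> = - (t powr \<alpha> * (LINT w:{c..}|lborel. g w))"
        using main[OF t0] split[OF c] by (simp add: c_def algebra_simps)
      then have "\<bar>1 - laplace P t - A * t powr \<alpha>\<bar> = t powr \<alpha> * (LINT w:{c..}|lborel. g w)"
        using tail(1)[OF c] by (simp add: abs_mult)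
      also have "\<dots> \<le> t powr \<alpha> * (c powr (1 - p) / (p - 1))"
        using tail(2)[OF c] by (intro mult_left_mono) auto
      also have "t powr \<alpha> * c powr (1 - p) = t"
      proof -
        have "c powr (1 - p) = t powr (1 - \<alpha>)"
          using \<alpha> by (simp add: c_def powr_powr p_def algebra_simps)
        then show ?thesis using t0 by (simp add: powr_add[symmetric])
      qed
      then have "t powr \<alpha> * (c powr (1 - p) / (p - 1)) = 1 / (p - 1) * t" by simp
      finally show ?thesis .
    qed simp
  qed (use p in simp)
qed

section \<open>Uniqueness and compactness for Laplace transforms, via laws on [0,1]\<close>

text \<open>Equal moments give equal integrals of polynomials, by Weierstrass of continuous
  functions, and by continuous step functions equal distribution functions.\<close>

lemma real_distribution_eqI_moments:
  fixes \<mu> \<nu> :: "real measure"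
  assumes "real_distribution \<mu>" "real_distribution \<nu>"
    and "AE x in \<mu>. x \<in> {0..1}" "AE x in \<nu>. x \<in> {0..1}"
    and moments: "\<And>k::nat. (\<integral>x. x ^ k \<partial>\<mu>) = (\<integral>x. x ^ k \<partial>\<nu>)"
  shows "\<mu> = \<nu>"
proof -
  interpret \<mu>: real_distribution \<mu> by fact
  interpret \<nu>: real_distribution \<nu> by fact
  have int: "integrable \<rho> g" 
    if "real_distribution \<rho>" "AE x in \<rho>. x \<in> {0..1}" "continuous_on UNIV g" for \<rho> and g :: "real \<Rightarrow> real"
  proof -
    interpret \<rho>: real_distribution \<rho> by fact
    have "compact (g ` {0..1})"
      using that by (intro compact_continuous_image) (auto intro: continuous_on_subset)
    then obtain B where B: "\<And>x. x \<in> {0..1} \<Longrightarrow> norm (g x) \<le> B"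
      by (force dest!: compact_imp_bounded simp: bounded_iff)
    have [measurable]: "g \<in> borel_measurable borel"
      using that(3) by (rule borel_measurable_continuous_onI)
    have "AE x in \<rho>. norm (g x) \<le> B"
      using that(2) by eventually_elim (rule B)
    then show ?thesis
      by (rule \<rho>.integrable_const_bound) simp
  qed
  have poly: "(\<integral>x. g x \<partial>\<mu>) = (\<integral>x. g x \<partial>\<nu>)" if g: "real_polynomial_function g" for g :: "real \<Rightarrow> real"
  proof -
    obtain a n where "g = (\<lambda>x. \<Sum>i\<le>n. a i * x ^ i)"
      using g by (auto simp: real_polynomial_function_iff_sum)
    then show ?thesis
      using assms by (simp add: moments int continuous_intros)
  qed
  have eq: "(\<integral>x. f x \<partial>\<mu>) = (\<integral>x. f x \<partial>\<nu>)" if f: "continuous_on UNIV f" for f :: "real \<Rightarrow> real"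
  proof -
    have "\<bar>(\<integral>x. f x \<partial>\<mu>) - (\<integral>x. f x \<partial>\<nu>)\<bar> \<le> e" if e: "0 < e" for e
    proof -
      have "continuous_on {0..1} f" using f by (rule continuous_on_subset) simp
      then obtain g where g: "real_polynomial_function g" and fg: "\<And>x. x \<in> {0..1} \<Longrightarrow> \<bar>f x - g x\<bar> < e / 2"
        using Stone_Weierstrass_real_polynomial_function[of "{0..1}" f "e / 2"] e by auto
      have gc: "continuous_on UNIV g"
        using g by (simp add: continuous_on_polymonial_function real_polynomial_function_eq)
      have close: "\<bar>(\<integral>x. f x \<partial>\<rho>) - (\<integral>x. g x \<partial>\<rho>)\<bar> \<le> e / 2"
        if "real_distribution \<rho>" "AE x in \<rho>. x \<in> {0..1}" for \<rho>
      proof -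
        interpret \<rho>: real_distribution \<rho> by fact
        have "\<bar>(\<integral>x. f x \<partial>\<rho>) - (\<integral>x. g x \<partial>\<rho>)\<bar> = \<bar>\<integral>x. f x - g x \<partial>\<rho>\<bar>"
          using int[OF that f] int[OF that gc] by simp
        also have "\<dots> \<le> (\<integral>x. \<bar>f x - g x\<bar> \<partial>\<rho>)" by (rule integral_abs_bound)
        also have "\<dots> \<le> (\<integral>x. e / 2 \<partial>\<rho>)"
        proof (rule integral_mono_AE)
          show "AE x in \<rho>. \<bar>f x - g x\<bar> \<le> e / 2"
            using that(2) by eventually_elim (use fg in \<open>auto intro: less_imp_le\<close>)
        qed (use int[OF that f] int[OF that gc] in auto)
        also have "\<dots> = e / 2" using \<rho>.prob_space by simp
        finally show ?thesis .
      qed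
      show ?thesis
        using close[OF assms(1,3)] close[OF assms(2,4)] poly[OF g] by linarith
    qed
    then have "\<bar>(\<integral>x. f x \<partial>\<mu>) - (\<integral>x. f x \<partial>\<nu>)\<bar> \<le> 0" by (rule field_le_epsilon[of _ 0, simplified])
    then show ?thesis by simp
  qed
  \<comment> \<open>\<open>cts_step x y\<close> lies between the indicators of the half-lines ending
    at x and at y; right continuity lets y decrease to x. Stated for arbitrary pairs so that both
    inequalities follow by symmetry.\<close>
  have le: "cdf \<mu>' x \<le> cdf \<nu>' x" if "real_distribution \<mu>'" "real_distribution \<nu>'"
    and same: "\<And>f :: real \<Rightarrow> real. continuous_on UNIV f \<Longrightarrow> (\<integral>x. f x \<partial>\<mu>') = (\<integral>x. f x \<partial>\<nu>')" for \<mu>' \<nu>' :: "real measure" and x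
  proof -
    interpret \<mu>': real_distribution \<mu>' by fact
    interpret \<nu>': real_distribution \<nu>' by fact
    have "cdf \<mu>' x \<le> cdf \<nu>' y" if "x < y" for y
      using \<mu>'.cdf_cts_step(1)[OF that] \<nu>'.cdf_cts_step(2)[OF that] 
        same[of "cts_step x y"]
        uniformly_continuous_imp_continuous[OF cts_step_uniformly_continuous[OF that]] by simp
    then have "\<forall>\<^sub>F y in at_right x. cdf \<mu>' x \<le> cdf \<nu>' y"
      by (auto simp: eventually_at_filter)
    moreover have "(cdf \<nu>' \<longlongrightarrow> cdf \<nu>' x) (at_right x)"
      using \<nu>'.cdf_is_right_cont by (simp add: continuous_within)
    ultimately show ?thesis
      by (intro tendsto_lowerbound[of _ _ "at_right x"]) auto
  qed
  show ?thesis
    using le[OF assms(1,2) eq] le[OF assms(2,1) eq[symmetric]] assms(1,2)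
    by (intro cdf_unique ext antisym) auto
qed

text \<open>The map x to exp(-x) moves the half-line into [0,1] and turns the Laplace transform at t
  into a moment of order t. The \<open>max 0 y\<close> makes the integrand independent of
  conventions for \<open>powr\<close> at negative bases.\<close>

lemma (in nonneg_law) exp_law:
  shows "real_distribution (distr P borel (\<lambda>x. exp (- x)))"
    and "AE y in distr P borel (\<lambda>x. exp (- x)). y \<in> {0..1}"
    and "0 < t \<Longrightarrow> (\<integral>y. max 0 y powr t \<partial>distr P borel (\<lambda>x. exp (- x))) = laplace P t"
proof -
  show "real_distribution (distr P borel (\<lambda>x. exp (- x)))"
    by (intro real_distribution_distr) simp
  show "AE y in distr P borel (\<lambda>x. exp (- x)). y \<in> {0..1}"
    using nonneg by (subst AE_distr_iff) (auto elim!: eventually_mono)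
  show "0 < t \<Longrightarrow> (\<integral>y. max 0 y powr t \<partial>distr P borel (\<lambda>x. exp (- x))) = laplace P t"
    by (subst integral_distr) (auto simp: laplace_def powr_def max_def mult.commute)
qed

text \<open>The transform at the integers consists of the moments of exp(-X), which determine its
  law on [0,1]; \<open>- ln\<close> recovers X.\<close>

lemma nonneg_law_eqI:
  assumes "nonneg_law P" "nonneg_law Q" "\<And>t. 0 < t \<Longrightarrow> laplace P t = laplace Q t"
  shows "P = Q"
proof -
  let ?e = "\<lambda>P::real measure. distr P borel (\<lambda>x. exp (- x))"
  interpret P: nonneg_law P by fact
  interpret Q: nonneg_law Q by fact
  have mom: "(\<integral>y. y ^ k \<partial>?e R) = laplace R k" if "nonneg_law R" for k :: nat and R
  proof -
    interpret R: nonneg_law R by fact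
    show ?thesis by (subst integral_distr) (auto simp: laplace_def exp_of_nat_mult[symmetric])
  qed
  have "?e P = ?e Q"
  proof (intro real_distribution_eqI_moments P.exp_law Q.exp_law)
    fix k :: nat
    have "laplace P k = laplace Q k"
      using assms(3)[of k] by (cases "k = 0") auto
    then show "(\<integral>y. y ^ k \<partial>?e P) = (\<integral>y. y ^ k \<partial>?e Q)"
      by (simp add: mom assms)
  qed
  then have "distr (?e P) borel (\<lambda>y. - ln y) = distr (?e Q) borel (\<lambda>y. - ln y)" by simp
  moreover have "distr (?e R) borel (\<lambda>y. - ln y) = R" if "nonneg_law R" for R
  proof -
    interpret R: nonneg_law R by fact
    show ?thesis by (subst distr_distr) (auto simp: o_def intro: distr_id2)
  qed
  ultimately show ?thesis using assms by simp
qed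

text \<open>The laws of \<open>exp (- X\<^sub>n)\<close> live on \<open>[0,1]\<close>, hence are tight; mass of \<open>X\<^sub>n\<close> escaping to
  infinity shows up as an atom of the limit at \<open>0\<close>.\<close>

lemma laplace_convergent_subseq:
  assumes P: "\<And>n. nonneg_law (P n)"
  obtains r \<nu> where "strict_mono (r :: nat \<Rightarrow> nat)" "real_distribution \<nu>" "AE y in \<nu>. y \<in> {0..1}"
    "\<And>t. 0 < t \<Longrightarrow> (\<lambda>n. laplace (P (r n)) t) \<longlonglongrightarrow> (\<integral>y. max 0 y powr t \<partial>\<nu>)"
proof -
  define \<mu> where "\<mu> n = distr (P n) borel (\<lambda>x. exp (- x))" for n
  have rd: "real_distribution (\<mu> n)" and AE: "AE y in \<mu> n. y \<in> {0..1}"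
    and lap: "0 < t \<Longrightarrow> (\<integral>y. max 0 y powr t \<partial>\<mu> n) = laplace (P n) t" for n t
    unfolding \<mu>_def by (fact nonneg_law.exp_law[OF P])+
  \<comment> \<open>Tightness is phrased with half-open intervals; the left end -1 keeps the point 0
    inside.\<close>
  have "measure (\<mu> n) {-1<..1} = 1" for n
  proof -
    interpret real_distribution "\<mu> n" by (rule rd)
    have "AE y in \<mu> n. y \<in> {-1<..1}" using AE[of n] by eventually_elim auto
    then show ?thesis by (subst prob_eq_1) auto
  qed
  then have tight: "tight \<mu>"
    unfolding tight_def using rd by (intro conjI allI impI exI[of _ "-1"] exI[of _ 1]) auto
  obtain r \<nu> where r: "strict_mono r" and \<nu>: "real_distribution \<nu>" and wc: "weak_conv_m (\<mu> \<circ> id \<circ> r) \<nu>"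
    using tight_imp_convergent_subsubsequence[OF tight strict_mono_id] by blast
  interpret \<nu>: real_distribution \<nu> by fact
  have conv: "(\<lambda>n. \<integral>y. f y \<partial>\<mu> (r n)) \<longlonglongrightarrow> (\<integral>y. f y \<partial>\<nu>)"
    if "continuous_on UNIV f" "\<And>x. \<bar>f x\<bar> \<le> 1" for f :: "real \<Rightarrow> real"
  proof -
    have "(\<lambda>n. \<integral>y. f y \<partial>(\<mu> \<circ> id \<circ> r) n) \<longlonglongrightarrow> (\<integral>y. f y \<partial>\<nu>)"
      by (rule weak_conv_imp_integral_bdd_continuous_conv[OF _ \<nu> wc, where B = 1])
         (use rd that in \<open>auto simp: continuous_on_eq_continuous_at\<close>)
    then show ?thesis by simp
  qed
  have supp: "AE y in \<nu>. y \<in> {0..1}"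
  proof -
    \<comment> \<open>Bounded, continuous, nonnegative and zero exactly on [0,1]: weak convergence
      therefore carries the support condition over to \<nu>.\<close>
    define f :: "real \<Rightarrow> real" where "f y = min 1 (max 0 (- y) + max 0 (y - 1))" for y
    have f: "continuous_on UNIV f" "\<bar>f y\<bar> \<le> 1" "0 \<le> f y" for y
      by (auto simp: f_def intro!: continuous_intros)
    have [measurable]: "f \<in> borel_measurable borel" using f by (intro borel_measurable_continuous_onI)
    have "(\<integral>y. f y \<partial>\<mu> n) = 0" for n
    proof (rule integral_eq_zero_AE)
      show "AE y in \<mu> n. f y = 0" using AE[of n] by eventually_elim (simp add: f_def)
    qed
    then have "(\<integral>y. f y \<partial>\<nu>) = 0"
      using conv[OF f(1,2)] by (simp add: LIMSEQ_const_iff)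
    moreover have "integrable \<nu> f"
      by (rule \<nu>.integrable_const_bound[of _ 1]) (use f in auto)
    ultimately have "AE y in \<nu>. f y = 0"
      using integral_nonneg_eq_0_iff_AE[of \<nu> f] f by simp
    then show ?thesis
      by eventually_elim (auto simp: f_def min_def max_def split: if_splits)
  qed
  show ?thesis
  proof (rule that[OF r \<nu> supp])
    fix t :: real assume t: "0 < t"
    \<comment> \<open>On [0,1] this is \<open>max 0 y powr t\<close>; the extra \<open>min 1\<close>
      makes it bounded on the whole line, as weak convergence requires.\<close>
    define f :: "real \<Rightarrow> real" where "f y = min 1 (max 0 y) powr t" for y
    have "continuous_on UNIV f" "\<And>y. \<bar>f y\<bar> \<le> 1"
      using t powr_mono2[of t _ 1] by (auto simp: f_def intro!: continuous_intros continuous_on_powr')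
    from conv[OF this] have lim: "(\<lambda>n. \<integral>y. f y \<partial>\<mu> (r n)) \<longlonglongrightarrow> (\<integral>y. f y \<partial>\<nu>)" .
    have eq: "(\<integral>y. f y \<partial>\<rho>) = (\<integral>y. max 0 y powr t \<partial>\<rho>)"
      if "AE y in \<rho>. y \<in> {0..1}" "sets \<rho> = sets borel" for \<rho>
    proof (rule integral_cong_AE)
      show "AE y in \<rho>. f y = max 0 y powr t" using that(1) by eventually_elim (auto simp: f_def)
    qed (use that(2) in \<open>auto simp: f_def cong: measurable_cong_sets\<close>)
    have "(\<integral>y. f y \<partial>\<mu> (r n)) = laplace (P (r n)) t" for n
      using eq[OF AE] lap[OF t] real_distribution.events_eq_borel[OF rd] by simp
    then show "(\<lambda>n. laplace (P (r n)) t) \<longlonglongrightarrow> (\<integral>y. max 0 y powr t \<partial>\<nu>)"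
      using lim eq[OF supp] by simp
  qed
qed

text \<open>Pointwise, y^x tends to the indicator of y > 0 as x decreases to 0. So the value at 0+
  of a limit of transforms is the mass that did not escape to infinity.\<close>

lemma power_mean_tendsto:
  assumes "real_distribution \<nu>" "AE y in \<nu>. y \<in> {0..1}"
    and x: "x \<longlonglongrightarrow> 0" "\<And>j. 0 < x j"
  shows "(\<lambda>j. \<integral>y. max 0 y powr x j \<partial>\<nu>) \<longlonglongrightarrow> measure \<nu> {0<..}"
proof -
  interpret \<nu>: real_distribution \<nu> by fact
  have "(\<lambda>j. \<integral>y. max 0 y powr x j \<partial>\<nu>) \<longlonglongrightarrow> (\<integral>y. indicator {0<..} y \<partial>\<nu>)"
  proof (rule integral_dominated_convergence[where w = "\<lambda>_. 1"])
    show "AE y in \<nu>. (\<lambda>j. max 0 y powr x j) \<longlonglongrightarrow> indicator {0<..} y"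
    proof (rule AE_I2)
      fix y :: real
      have "(\<lambda>j. y powr x j) \<longlonglongrightarrow> y powr 0" if "0 < y"
        using that by (intro tendsto_powr tendsto_const x) auto
      then show "(\<lambda>j. max 0 y powr x j) \<longlonglongrightarrow> indicator {0<..} y"
        by (cases "0 < y") (auto simp: max_def)
    qed
    show "AE y in \<nu>. norm (max 0 y powr x j) \<le> 1" for j
      using assms(2) by eventually_elim (use x(2)[of j] in \<open>auto intro: powr_le1\<close>)
  qed auto
  then show ?thesis by simp
qed

text \<open>Without an atom at 0, \<open>- ln y\<close> is almost surely finite and nonnegative, and
  its law has the given power means as Laplace transform.\<close>

lemma laplace_of_power_mean:
  assumes "real_distribution \<nu>" "AE y in \<nu>. y \<in> {0..1}" "measure \<nu> {0<..} = 1"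
  obtains P where "nonneg_law P" "\<And>t. 0 < t \<Longrightarrow> laplace P t = (\<integral>y. max 0 y powr t \<partial>\<nu>)"
proof -
  interpret \<nu>: real_distribution \<nu> by fact
  have pos: "AE y in \<nu>. 0 < y"
    using assms(3) by (subst (asm) \<nu>.prob_eq_1) auto
  define P where "P = distr \<nu> borel (\<lambda>y. - ln y)"
  have "AE x in P. 0 \<le> x"
    unfolding P_def using assms(2) pos by (subst AE_distr_iff) (auto elim!: eventually_elim2)
  then have "nonneg_law P"
    unfolding nonneg_law_def nonneg_law_axioms_def P_def by (auto intro: \<nu>.real_distribution_distr)
  moreover have "laplace P t = (\<integral>y. max 0 y powr t \<partial>\<nu>)" if "0 < t" for t
  proof -
    have "laplace P t = (\<integral>y. exp (- (t * - ln y)) \<partial>\<nu>)"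
      unfolding laplace_def P_def by (subst integral_distr) auto
    also have "\<dots> = (\<integral>y. max 0 y powr t \<partial>\<nu>)"
      by (rule integral_cong_AE) (use pos in \<open>auto elim!: eventually_mono simp: powr_def max_def\<close>)
    finally show ?thesis .
  qed
  ultimately show ?thesis by (rule that)
qed

section \<open>Subsolutions\<close>

text \<open>A second-order upper bound. Each induction step discards
  \<open>x j * S + (x j)\<^sup>2 + x j * S\<^sup>2\<close>, which is nonnegative.\<close>

lemma prod_one_minus_le:
  fixes x :: "'i \<Rightarrow> real"
  assumes "finite I" "\<And>i. i \<in> I \<Longrightarrow> 0 \<le> x i" "\<And>i. i \<in> I \<Longrightarrow> x i \<le> 1"
  shows "(\<Prod>i\<in>I. 1 - x i) \<le> 1 - sum x I + (sum x I)\<^sup>2"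
  using assms
proof (induction I rule: finite_induct)
  case (insert j I)
  define S where "S = sum x I"
  have S: "0 \<le> S" using insert by (auto simp: S_def intro: sum_nonneg)
  have xj: "0 \<le> x j" "x j \<le> 1" using insert by auto
  have "(\<Prod>i\<in>insert j I. 1 - x i) \<le> (1 - x j) * (1 - S + S\<^sup>2)"
    using insert xj by (auto simp: S_def intro!: mult_left_mono)
  also have "\<dots> = 1 - (x j + S) + (x j + S)\<^sup>2 - (x j * S + (x j)\<^sup>2 + x j * S\<^sup>2)"
    by (simp add: algebra_simps power2_eq_square)
  also have "\<dots> \<le> 1 - (x j + S) + (x j + S)\<^sup>2"
  proof -
    have "0 \<le> x j * S + (x j)\<^sup>2 + x j * S\<^sup>2" using S xj by simp
    then show ?thesis by linarith
  qed
  finally show ?case using insert by (simp add: S_def)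
qed simp

text \<open>Minimising \<open>f x + \<epsilon> (x - z)\<^sup>2\<close> produces a point near which \<open>f\<close> is almost minorised by an
  affine function; its slope inherits the bounds on the slopes of \<open>f\<close>.\<close>

lemma slope_minorant:
  fixes f :: "real \<Rightarrow> real"
  assumes mono: "\<And>x y. x \<le> y \<Longrightarrow> f x \<le> f y"
    and lip: "\<And>x y. x \<le> y \<Longrightarrow> f y \<le> f x + (y - x)"
    and e: "0 < \<epsilon>"
  obtains x s where "\<bar>x - z\<bar> \<le> 1 / \<epsilon>" "0 \<le> s" "s \<le> 1"
    "\<And>y. f x + s * y - \<epsilon> * y\<^sup>2 \<le> f (x + y)"
proof -
  define q where "q x = f x + \<epsilon> * (x - z)\<^sup>2" for x
  have "\<bar>f x - f y\<bar> \<le> \<bar>x - y\<bar>" for x y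
    using mono[of x y] mono[of y x] lip[of x y] lip[of y x] by linarith
  then have "1-lipschitz_on UNIV f"
    by (auto simp: lipschitz_on_def dist_real_def)
  then have "continuous_on UNIV f" by (rule lipschitz_on_continuous_on)
  then have "continuous_on {z - 1 / \<epsilon>..z + 1 / \<epsilon>} q"
    unfolding q_def by (intro continuous_intros) (auto intro: continuous_on_subset)
  then obtain x where x: "x \<in> {z - 1 / \<epsilon>..z + 1 / \<epsilon>}"
      and min: "\<And>y. y \<in> {z - 1 / \<epsilon>..z + 1 / \<epsilon>} \<Longrightarrow> q x \<le> q y"
    using continuous_attains_inf[of "{z - 1 / \<epsilon>..z + 1 / \<epsilon>}" q] e by auto
  \<comment> \<open>Outside the interval the distance d to z exceeds 1/\<epsilon>, so the parabola
    gains \<epsilon> d^2 >= d, while \<open>f\<close> drops by at most d; hence \<open>q y\<close>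
    is at least \<open>q z\<close>, and the minimum over the interval is global.\<close>
  have glob: "q x \<le> q y" for y
  proof (cases "y \<in> {z - 1 / \<epsilon>..z + 1 / \<epsilon>}")
    case False
    define d where "d = \<bar>y - z\<bar>"
    have d: "1 / \<epsilon> < d" using False by (auto simp: d_def)
    have "f z - d \<le> f y" using mono[of z y] lip[of y z] by (cases "z \<le> y") (auto simp: d_def)
    moreover have "d \<le> \<epsilon> * d\<^sup>2"
    proof -
      have "0 < d" using d e by (meson divide_pos_pos less_trans zero_less_one)
      moreover have "1 \<le> \<epsilon> * d" using d e by (simp add: field_simps)
      ultimately have "1 * d \<le> \<epsilon> * d * d" by (intro mult_right_mono) auto
      then show ?thesis by (simp add: power2_eq_square mult.assoc)
    qed
    ultimately have "q z \<le> q y" by (simp add: q_def d_def)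
    with min[of z] e show ?thesis by simp
  qed (use min in auto)
  \<comment> \<open>The negative of the derivative of the parabola at the minimiser.\<close>
  define s where "s = - 2 * \<epsilon> * (x - z)"
  have main: "f x + s * y - \<epsilon> * y\<^sup>2 \<le> f (x + y)" for y
    using glob[of "x + y"] by (simp add: q_def s_def power2_eq_square algebra_simps)
  \<comment> \<open>The minorant at y > 0 against \<open>lip\<close> bounds s by 1 + \<epsilon> y,
    and at -y against \<open>mono\<close> it gives s >= - \<epsilon> y; letting y tend to 0 puts s
    into [0,1].\<close>
  have "s \<le> 1 + \<epsilon> * y" if "0 < y" for y
  proof -
    have "s * y \<le> (1 + \<epsilon> * y) * y"
      using main[of y] lip[of x "x + y"] that by (simp add: power2_eq_square algebra_simps)
    then show ?thesis using that by simp
  qed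
  then have "s \<le> 1 + r" if "0 < r" for r
    using that e by (metis divide_pos_pos nonzero_mult_div_cancel_left order_less_irrefl times_divide_eq_right)
  then have "s \<le> 1" by (rule field_le_epsilon)
  moreover have "0 \<le> s + \<epsilon> * y" if "0 < y" for y
  proof -
    have "0 * y \<le> (s + \<epsilon> * y) * y"
      using main[of "- y"] mono[of "x - y" x] that by (simp add: power2_eq_square algebra_simps)
    then show ?thesis using that mult_le_cancel_right_pos by blast
  qed
  then have "0 \<le> s + r" if "0 < r" for r
    using that e by (metis divide_pos_pos nonzero_mult_div_cancel_left order_less_irrefl times_divide_eq_right)
  then have "0 \<le> s" by (rule field_le_epsilon)
  ultimately show ?thesis
    using x main by (intro that[of x s]) (auto simp: abs_le_iff)
qed

section \<open>Semicontinuity of the moment function\<close>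

text \<open>Fatou's lemma applied twice, to the sum over i and to the integral over \<omega>. The
  general \<open>g\<close> covers varying exponents as well as varying truncations.\<close>

lemma weight_moment_le_liminf:
  fixes g :: "nat \<Rightarrow> nat \<Rightarrow> 'a \<Rightarrow> ennreal"
  assumes [measurable]: "\<And>k i. g k i \<in> borel_measurable M"
    and conv: "\<And>i \<omega>. \<omega> \<in> space M \<Longrightarrow> 0 < T i \<omega> \<Longrightarrow> (\<lambda>k. g k i \<omega>) \<longlonglongrightarrow> ennreal (T i \<omega> powr \<theta>)"
  shows "weight_moment M T \<theta> \<le> liminf (\<lambda>k. \<integral>\<^sup>+\<omega>. (\<Sum>i. g k i \<omega>) \<partial>M)"
proof -
  have pt: "(\<Sum>i. if T i \<omega> > 0 then ennreal (T i \<omega> powr \<theta>) else 0) \<le> liminf (\<lambda>k. \<Sum>i. g k i \<omega>)"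
    if w: "\<omega> \<in> space M" for \<omega>
  proof -
    have "(if T i \<omega> > 0 then ennreal (T i \<omega> powr \<theta>) else 0) \<le> liminf (\<lambda>k. g k i \<omega>)" for i
      using lim_imp_Liminf[OF _ conv[OF w, of i]] by auto
    then have "(\<Sum>i. if T i \<omega> > 0 then ennreal (T i \<omega> powr \<theta>) else 0) \<le> (\<Sum>i. liminf (\<lambda>k. g k i \<omega>))"
      by (intro suminf_le) auto
    also have "\<dots> \<le> liminf (\<lambda>k. \<Sum>i. g k i \<omega>)"
      unfolding nn_integral_count_space_nat[symmetric] by (intro nn_integral_liminf) auto
    finally show ?thesis .
  qed
  have "weight_moment M T \<theta> \<le> (\<integral>\<^sup>+\<omega>. liminf (\<lambda>k. \<Sum>i. g k i \<omega>) \<partial>M)"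
    unfolding weight_moment_def by (intro nn_integral_mono pt)
  also have "\<dots> \<le> liminf (\<lambda>k. \<integral>\<^sup>+\<omega>. (\<Sum>i. g k i \<omega>) \<partial>M)"
    by (intro nn_integral_liminf) measurable
  finally show ?thesis .
qed

lemma liminf_le_1:
  fixes b :: "nat \<Rightarrow> ennreal"
  assumes b: "\<And>k. b k \<le> ennreal (1 + 1 / real (Suc (r k)))" and r: "strict_mono r"
  shows "liminf b \<le> 1"
proof -
  have "liminf b \<le> liminf (\<lambda>k. ennreal (1 + 1 / real (Suc (r k))))"
    by (intro Liminf_mono always_eventually allI b)
  also have "\<dots> = 1"
  proof (rule lim_imp_Liminf)
    have "(\<lambda>n. ennreal (1 + 1 / real (Suc n))) \<longlonglongrightarrow> ennreal (1 + 0)"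
      by (intro tendsto_intros LIMSEQ_Suc[OF lim_1_over_n])
    from LIMSEQ_subseq_LIMSEQ[OF this r] show "(\<lambda>k. ennreal (1 + 1 / real (Suc (r k)))) \<longlonglongrightarrow> 1"
      by (simp add: o_def)
  qed simp
  finally show ?thesis .
qed

lemma weight_moment_attained:
  assumes [measurable]: "\<And>i. T i \<in> borel_measurable M" and "(INF \<theta>\<in>{0..1}. weight_moment M T \<theta>) \<le> 1"
  obtains \<theta> where "\<theta> \<in> {0..1}" "weight_moment M T \<theta> \<le> 1"
proof -
  have "\<exists>s\<in>{0..1}. weight_moment M T s \<le> ennreal (1 + 1 / real (Suc n))" for n
  proof -
    have "(INF \<theta>\<in>{0..1}. weight_moment M T \<theta>) < ennreal (1 + 1 / real (Suc n))"
      using assms(2) by (rule le_less_trans) simp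
    then show ?thesis by (auto simp: INF_less_iff intro: less_imp_le)
  qed
  then obtain s where s: "\<And>n. s n \<in> {0..1}" "\<And>n. weight_moment M T (s n) \<le> ennreal (1 + 1 / real (Suc n))"
    by metis
  obtain \<theta> r where \<theta>: "\<theta> \<in> {0..1}" and r: "strict_mono r" and lim: "(s \<circ> r) \<longlonglongrightarrow> \<theta>"
    using compact_imp_seq_compact[of "{0..1::real}"] s(1) unfolding seq_compact_def by blast
  have "weight_moment M T \<theta> \<le>
      liminf (\<lambda>k. \<integral>\<^sup>+\<omega>. (\<Sum>i. if T i \<omega> > 0 then ennreal (T i \<omega> powr (s \<circ> r) k) else 0) \<partial>M)"
  proof (rule weight_moment_le_liminf)
    fix i \<omega> assume pos: "0 < T i \<omega>"
    then have "(\<lambda>k. ennreal (T i \<omega> powr (s \<circ> r) k)) \<longlonglongrightarrow> ennreal (T i \<omega> powr \<theta>)"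
      by (intro tendsto_ennrealI tendsto_powr[OF tendsto_const lim]) simp
    then show "(\<lambda>k. if T i \<omega> > 0 then ennreal (T i \<omega> powr (s \<circ> r) k) else 0) \<longlonglongrightarrow> ennreal (T i \<omega> powr \<theta>)"
      using pos by simp
  qed measurable
  also have "\<dots> \<le> 1"
    using s(2) r by (intro liminf_le_1[of _ r]) (simp_all add: weight_moment_def cong: if_cong)
  finally show ?thesis using \<theta> by (rule that[rotated])
qed

text \<open>Truncating the product at \<open>n\<close> lets one inequality cover the homogeneous equation, the
  inhomogeneous equation and the weighted branching process.\<close>

locale smoothing_sub = M: prob_space M + nonneg_law P for M :: "'a measure" and P +
  fixes T :: "nat \<Rightarrow> 'a \<Rightarrow> real"
  assumes T_measurable [measurable]: "\<And>i. T i \<in> borel_measurable M"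
    and T_nonneg: "\<And>i \<omega>. \<omega> \<in> space M \<Longrightarrow> 0 \<le> T i \<omega>"
    and nontrivial: "P \<noteq> return borel 0"
    and laplace_le: "\<And>n t. 0 < t \<Longrightarrow>
          laplace P t \<le> (\<integral>\<omega>. (\<Prod>i<n. laplace P (t * T i \<omega>)) \<partial>M)"
begin

definition \<psi> :: "real \<Rightarrow> real" where "\<psi> t = 1 - laplace P t"

text \<open>Keeping the weights away from both 0 and infinity bounds
  \<open>\<bar>ln (T i \<omega>)\<bar>\<close> by \<open>ln (Suc n)\<close>, which later controls
  the parabola term of \<open>slope_minorant\<close>.\<close>

definition cut :: "nat \<Rightarrow> nat \<Rightarrow> 'a \<Rightarrow> real" where
  "cut n i \<omega> = of_bool (1 / real (Suc n) \<le> T i \<omega> \<and> T i \<omega> \<le> real (Suc n))"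

definition cut_moment :: "nat \<Rightarrow> real \<Rightarrow> real" where
  "cut_moment n s = (\<integral>\<omega>. (\<Sum>i<n. cut n i \<omega> * T i \<omega> powr s) \<partial>M)"

lemma cut_measurable [measurable]: "cut n i \<in> borel_measurable M"
  unfolding cut_def by measurable

lemma psi_measurable [measurable]: "\<psi> \<in> borel_measurable borel"
  unfolding \<psi>_def by measurable

lemma cut_bounds [simp]: "0 \<le> cut n i \<omega>" "cut n i \<omega> \<le> 1"
  by (auto simp: cut_def)

lemma psi_bounds: "0 \<le> t \<Longrightarrow> 0 \<le> \<psi> t" "\<psi> t \<le> 1"
  using laplace_le_1 laplace_nonneg by (auto simp: \<psi>_def)

lemma psi_pos: "0 < t \<Longrightarrow> 0 < \<psi> t"
  using laplace_less_1[OF nontrivial] by (simp add: \<psi>_def)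

lemma psi_mono: "0 \<le> s \<Longrightarrow> s \<le> t \<Longrightarrow> \<psi> s \<le> \<psi> t"
  using laplace_antimono by (simp add: \<psi>_def)

lemma integrable_cut:
  assumes "f \<in> borel_measurable borel" "0 \<le> t" "\<And>x. 0 \<le> x \<Longrightarrow> x \<le> real (Suc n) \<Longrightarrow> \<bar>f (t * x)\<bar> \<le> K" 
  shows "integrable M (\<lambda>\<omega>. \<Sum>i<n. cut n i \<omega> * f (t * T i \<omega>))"
proof (rule Bochner_Integration.integrable_sum)
  fix i
  note [measurable] = assms(1)
  have K: "0 \<le> K" using assms(3)[of 0] by simp
  show "integrable M (\<lambda>\<omega>. cut n i \<omega> * f (t * T i \<omega>))"
  proof (rule M.integrable_const_bound[of _ K])
    show "AE \<omega> in M. norm (cut n i \<omega> * f (t * T i \<omega>)) \<le> K"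
      using T_nonneg assms K by (intro AE_I2) (auto simp: cut_def)
  qed measurable
qed

text \<open>Let S be the sum under the integral. It has n terms with weights at most n+1, so S is at
  most \<delta> once t is small; then S^2 <= \<delta> S, and \<open>prod_one_minus_le\<close> bounds
  the product of transforms by 1 - (1-\<delta>) S. Integration and \<open>laplace_le\<close> give
  the claim.\<close>

lemma psi_ge_sum:
  assumes "0 < \<delta>"
  obtains t\<^sub>0 where "0 < t\<^sub>0" "\<And>t. 0 < t \<Longrightarrow> t \<le> t\<^sub>0 \<Longrightarrow>
    (1 - \<delta>) * (\<integral>\<omega>. (\<Sum>i<n. cut n i \<omega> * \<psi> (t * T i \<omega>)) \<partial>M) \<le> \<psi> t"
proof -
  have "(\<lambda>k. real n * \<psi> (1 / real (Suc k) * Suc n)) \<longlonglongrightarrow> real n * (1 - 1)"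
    unfolding \<psi>_def
    by (intro tendsto_intros laplace_tendsto_1 tendsto_mult_left_zero LIMSEQ_Suc[OF lim_1_over_n]) simp
  then have "\<forall>\<^sub>F k in sequentially. real n * \<psi> (1 / real (Suc k) * Suc n) < \<delta>"
    using assms by (auto dest: order_tendstoD)
  then obtain k where k: "real n * \<psi> (1 / real (Suc k) * Suc n) < \<delta>"
    by (auto simp: eventually_sequentially)
  show ?thesis
  \<comment> \<open>The index k was chosen such that n terms, each at most \<open>\<psi>\<close> at
    (n+1)/(k+1), add up to less than \<delta>.\<close>
  proof (rule that[of "1 / Suc k"])
    fix t :: real assume t: "0 < t" "t \<le> 1 / Suc k"
    define S where "S \<omega> = (\<Sum>i<n. cut n i \<omega> * \<psi> (t * T i \<omega>))" for \<omega>
    have int: "integrable M S"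
      unfolding S_def by (rule integrable_cut[where K = 1]) (use psi_bounds t in \<open>auto simp: abs_le_iff minus_le_iff\<close>)
    have pt: "(\<Prod>i<n. laplace P (t * T i \<omega>)) \<le> 1 - (1 - \<delta>) * S \<omega>" if w: "\<omega> \<in> space M" for \<omega>
    proof -
      have x: "0 \<le> cut n i \<omega> * \<psi> (t * T i \<omega>)" "cut n i \<omega> * \<psi> (t * T i \<omega>) \<le> 1" for i
        using T_nonneg[OF w, of i] t psi_bounds[of "t * T i \<omega>"] by (auto simp: cut_def)
      have "(\<Prod>i<n. laplace P (t * T i \<omega>)) \<le> (\<Prod>i<n. 1 - cut n i \<omega> * \<psi> (t * T i \<omega>))"
        using T_nonneg[OF w] t laplace_nonneg laplace_le_1 by (intro prod_mono) (auto simp: cut_def \<psi>_def)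
      also have "\<dots> \<le> 1 - S \<omega> + (S \<omega>)\<^sup>2"
        unfolding S_def by (rule prod_one_minus_le) (use x in auto)
      also have "\<dots> \<le> 1 - S \<omega> + \<delta> * S \<omega>"
      proof -
        have "cut n i \<omega> * \<psi> (t * T i \<omega>) \<le> \<psi> (1 / real (Suc k) * Suc n)" for i
        proof (cases "T i \<omega> \<le> Suc n")
          case True
          have "t * T i \<omega> \<le> 1 / real (Suc k) * Suc n"
            using True T_nonneg[OF w] t by (intro mult_mono) auto
          then show ?thesis
            using psi_mono[of "t * T i \<omega>" "1 / real (Suc k) * Suc n"] psi_bounds t T_nonneg[OF w, of i]
            by (auto simp: cut_def)
        qed (auto simp: cut_def psi_bounds)
        then have "S \<omega> \<le> (\<Sum>i<n. \<psi> (1 / real (Suc k) * Suc n))"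
          unfolding S_def by (intro sum_mono)
        with k have "S \<omega> \<le> \<delta>" by simp
        moreover have "0 \<le> S \<omega>" unfolding S_def using x by (intro sum_nonneg)
        ultimately show ?thesis by (simp add: power2_eq_square mult_right_mono)
      qed
      finally show ?thesis by (simp add: algebra_simps)
    qed
    have "laplace P t \<le> (\<integral>\<omega>. (\<Prod>i<n. laplace P (t * T i \<omega>)) \<partial>M)"
      using t by (intro laplace_le)
    also have "\<dots> \<le> (\<integral>\<omega>. 1 - (1 - \<delta>) * S \<omega> \<partial>M)"
    proof (rule integral_mono)
      show "integrable M (\<lambda>\<omega>. \<Prod>i<n. laplace P (t * T i \<omega>))"
      proof (rule M.integrable_const_bound[of _ 1])
        show "AE \<omega> in M. norm (\<Prod>i<n. laplace P (t * T i \<omega>)) \<le> 1"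
          using T_nonneg t laplace_nonneg laplace_le_1
          by (intro AE_I2) (auto simp: abs_prod intro!: prod_le_1)
      qed measurable
    qed (use int pt in auto)
    also have "\<dots> = 1 - (1 - \<delta>) * (\<integral>\<omega>. S \<omega> \<partial>M)"
      using int by (subst Bochner_Integration.integral_diff) (auto simp: M.prob_space)
    finally show "(1 - \<delta>) * (\<integral>\<omega>. (\<Sum>i<n. cut n i \<omega> * \<psi> (t * T i \<omega>)) \<partial>M) \<le> \<psi> t"
      by (simp add: \<psi>_def S_def)
  qed simp
qed

text \<open>At the point x supplied by \<open>slope_minorant\<close> for \<open>l\<close>,
  \<open>\<psi> (exp x * T)\<close> is at least \<open>\<psi> (exp x)\<close> times T^s up to the
  factor exp(- \<epsilon> (ln T)^2). Inserting this into \<open>psi_ge_sum\<close> and dividing by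
  \<open>\<psi> (exp x) > 0\<close> leaves a bound on the truncated moment.\<close>

lemma exists_cut_moment_le_aux:
  assumes "0 < \<delta>" "\<delta> < 1" "0 < \<epsilon>"
  obtains s where "0 \<le> s" "s \<le> 1" "(1 - \<delta>) * exp (- \<epsilon> * (ln (Suc n))\<^sup>2) * cut_moment n s \<le> 1"
proof -
  obtain t\<^sub>0 where t0: "0 < t\<^sub>0" and ineq: "\<And>t. 0 < t \<Longrightarrow> t \<le> t\<^sub>0 \<Longrightarrow>
    (1 - \<delta>) * (\<integral>\<omega>. (\<Sum>i<n. cut n i \<omega> * \<psi> (t * T i \<omega>)) \<partial>M) \<le> \<psi> t"
    using psi_ge_sum[OF assms(1), of n] by blast
  define l where "l x = ln (\<psi> (exp x))" for x
  define b where "b = ln (Suc n)"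
  have expl: "exp (l x) = \<psi> (exp x)" for x by (simp add: l_def psi_pos)
  have "l x \<le> l y" if "x \<le> y" for x y
    using that psi_mono[of "exp x" "exp y"] psi_pos by (simp add: l_def)
  moreover have "l y \<le> l x + (y - x)" if "x \<le> y" for x y
  proof -
    have "exp (x - y) * \<psi> (exp y) \<le> \<psi> (exp (x - y) * exp y)"
      using laplace_scale[of "exp (x - y)" "exp y"] that by (simp add: \<psi>_def)
    then have "exp (x - y + l y) \<le> exp (l x)"
      unfolding expl exp_add by (simp flip: exp_add)
    then show ?thesis by simp
  qed
  \<comment> \<open>The centre is shifted left by 1/\<epsilon> so that the minimiser, at distance at
    most 1/\<epsilon>, still satisfies exp x <= \<open>t\<^sub>0\<close>.\<close>
  ultimately obtain x s where x: "\<bar>x - (ln t\<^sub>0 - 1 / \<epsilon>)\<bar> \<le> 1 / \<epsilon>" and s: "0 \<le> s" "s \<le> 1"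
    and minor: "\<And>y. l x + s * y - \<epsilon> * y\<^sup>2 \<le> l (x + y)"
    using slope_minorant[of l \<epsilon> "ln t\<^sub>0 - 1 / \<epsilon>"] assms(3) by metis
  have t: "0 < exp x" "exp x \<le> t\<^sub>0"
    using x t0 by (auto simp: abs_le_iff ln_ge_iff[symmetric])
  have pt: "\<psi> (exp x) * exp (- \<epsilon> * b\<^sup>2) * (cut n i \<omega> * T i \<omega> powr s) \<le> cut n i \<omega> * \<psi> (exp x * T i \<omega>)" for i \<omega>
  proof (cases "1 / Suc n \<le> T i \<omega> \<and> T i \<omega> \<le> Suc n")
    case True
    then have pos: "0 < T i \<omega>" by (smt (verit) divide_pos_pos of_nat_0_less_iff zero_less_Suc)
    have "ln (1 / Suc n) \<le> ln (T i \<omega>)" "ln (T i \<omega>) \<le> ln (Suc n)"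
      using True pos by (auto simp del: of_nat_Suc)
    then have "\<bar>ln (T i \<omega>)\<bar> \<le> b" by (auto simp: b_def ln_div simp del: of_nat_Suc)
    then have "(ln (T i \<omega>))\<^sup>2 \<le> b\<^sup>2" by (rule abs_le_square_iff[THEN iffD1, OF order_trans]) simp
    then have "l x + s * ln (T i \<omega>) - \<epsilon> * b\<^sup>2 \<le> l x + s * ln (T i \<omega>) - \<epsilon> * (ln (T i \<omega>))\<^sup>2"
      using assms(3) by simp
    also have "\<dots> \<le> l (x + ln (T i \<omega>))" by (rule minor)
    finally have "exp (l x + s * ln (T i \<omega>) - \<epsilon> * b\<^sup>2) \<le> exp (l (x + ln (T i \<omega>)))" by simp
    then have "\<psi> (exp x) * (exp (- \<epsilon> * b\<^sup>2) * T i \<omega> powr s) \<le> \<psi> (exp x * T i \<omega>)"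
      using pos by (simp add: expl exp_add exp_diff exp_minus powr_def divide_inverse mult_ac)
    then show ?thesis using True by (simp add: cut_def mult.assoc)
  qed (auto simp: cut_def)
  have "\<psi> (exp x) * ((1 - \<delta>) * exp (- \<epsilon> * b\<^sup>2) * cut_moment n s) =
      (1 - \<delta>) * (\<integral>\<omega>. (\<Sum>i<n. \<psi> (exp x) * exp (- \<epsilon> * b\<^sup>2) * (cut n i \<omega> * T i \<omega> powr s)) \<partial>M)"
    unfolding cut_moment_def sum_distrib_left[symmetric] by simp
  also have "\<dots> \<le> (1 - \<delta>) * (\<integral>\<omega>. (\<Sum>i<n. cut n i \<omega> * \<psi> (exp x * T i \<omega>)) \<partial>M)"
  proof (intro mult_left_mono integral_mono sum_mono pt)
    have "integrable M (\<lambda>\<omega>. \<Sum>i<n. cut n i \<omega> * (1 * T i \<omega>) powr s)"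
      by (rule integrable_cut[where K = "Suc n powr s" and f = "\<lambda>x. x powr s"]) 
         (use s in \<open>auto intro: powr_mono2\<close>)
    then show "integrable M (\<lambda>\<omega>. \<Sum>i<n. \<psi> (exp x) * exp (- \<epsilon> * b\<^sup>2) * (cut n i \<omega> * T i \<omega> powr s))"
      unfolding sum_distrib_left[symmetric] by simp
    show "integrable M (\<lambda>\<omega>. \<Sum>i<n. cut n i \<omega> * \<psi> (exp x * T i \<omega>))"
      by (rule integrable_cut[where K = 1]) (use psi_bounds in \<open>auto simp: abs_le_iff minus_le_iff\<close>)
  qed (use assms in auto)
  also have "\<dots> \<le> \<psi> (exp x) * 1"
    using ineq[OF t] by simp
  finally show ?thesis
    using psi_pos[of "exp x"] s by (intro that[of s]) (auto simp: b_def)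
qed

text \<open>With q^2 = 1 + 1/(n+1), the two losses are each tuned to cost a factor of at most q:
  \<delta> = 1 - 1/q, and \<epsilon> so small that exp(- \<epsilon> b) >= 1/q.\<close>

lemma exists_cut_moment_le: "\<exists>s\<in>{0..1}. cut_moment n s \<le> 1 + 1 / real (Suc n)"
proof -
  define q where "q = sqrt (1 + 1 / real (Suc n))"
  have q: "1 < q" "q * q = 1 + 1 / real (Suc n)" by (auto simp: q_def)
  define b where "b = (ln (Suc n))\<^sup>2"
  have b: "0 \<le> b" by (simp add: b_def)
  \<comment> \<open>The denominator is b + 1 because b = 0 for n = 0.\<close>
  define \<epsilon> where "\<epsilon> = ln q / (b + 1)"
  have e: "0 < \<epsilon>" using q b by (auto simp: \<epsilon>_def)
  have "\<epsilon> * b \<le> ln q"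
    using q b by (auto simp: \<epsilon>_def field_simps)
  then have "exp (- ln q) \<le> exp (- \<epsilon> * b)" by simp
  then have "1 / q \<le> exp (- \<epsilon> * b)"
    using q(1) by (simp add: exp_minus inverse_eq_divide)
  obtain s where s: "0 \<le> s" "s \<le> 1" "1 / q * exp (- \<epsilon> * b) * cut_moment n s \<le> 1"
    using exists_cut_moment_le_aux[of "1 - 1 / q" \<epsilon> n] q e unfolding b_def by auto
  have m0: "0 \<le> cut_moment n s" unfolding cut_moment_def by (intro Bochner_Integration.integral_nonneg sum_nonneg) simp
  have "1 / q * (1 / q) * cut_moment n s \<le> 1 / q * exp (- \<epsilon> * b) * cut_moment n s"
    using \<open>1 / q \<le> _\<close> m0 q(1) by (intro mult_right_mono mult_left_mono) auto
  also have "\<dots> \<le> 1" by (rule s)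
  finally have "cut_moment n s \<le> q * q" using q(1) by (simp add: field_simps)
  then show ?thesis using q(2) s by auto
qed

theorem INF_weight_moment_le_1: "(INF \<theta>\<in>{0..1}. weight_moment M T \<theta>) \<le> 1"
proof -
  obtain s where s: "\<And>n. s n \<in> {0..1}" "\<And>n. cut_moment n (s n) \<le> 1 + 1 / real (Suc n)"
    using exists_cut_moment_le by metis
  obtain \<theta> r where \<theta>: "\<theta> \<in> {0..1}" and r: "strict_mono r" and lim: "(s \<circ> r) \<longlonglongrightarrow> \<theta>"
    using compact_imp_seq_compact[of "{0..1::real}"] s(1) unfolding seq_compact_def by blast
  \<comment> \<open>The finite truncated sum is written as a series, so that Fatou's lemma applies
    with one index set for all k.\<close>
  define g where "g k i \<omega> = (if i < r k then ennreal (cut (r k) i \<omega> * T i \<omega> powr (s \<circ> r) k) else 0)" for k i \<omega>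
  have [measurable]: "g k i \<in> borel_measurable M" for k i unfolding g_def by measurable
  have "weight_moment M T \<theta> \<le> liminf (\<lambda>k. \<integral>\<^sup>+\<omega>. (\<Sum>i. g k i \<omega>) \<partial>M)"
  proof (rule weight_moment_le_liminf)
    fix i \<omega> assume pos: "0 < T i \<omega>"
    \<comment> \<open>Beyond this index neither the cut nor the bound on i affects the i-th weight
      at \<omega>.\<close>
    obtain n0 :: nat where n0: "max (real i) (max (T i \<omega>) (1 / T i \<omega>)) < n0" using reals_Archimedean2 by blast
    have "\<forall>\<^sub>F k in sequentially. g k i \<omega> = ennreal (T i \<omega> powr (s \<circ> r) k)"
      using eventually_ge_at_top[of n0]
    proof eventually_elim
      case (elim k)
      then have k: "n0 \<le> r k" using seq_suble[OF r, of k] by simp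
      have "1 / real (Suc (r k)) \<le> T i \<omega>"
      proof -
        have "1 / T i \<omega> < real (Suc (r k))" using n0 k by linarith
        then show ?thesis using pos by (simp add: field_simps)
      qed
      moreover have "T i \<omega> \<le> real (Suc (r k))" "i < r k" using n0 k by linarith+
      ultimately show ?case by (simp add: g_def cut_def)
    qed
    moreover have "(\<lambda>k. ennreal (T i \<omega> powr (s \<circ> r) k)) \<longlonglongrightarrow> ennreal (T i \<omega> powr \<theta>)"
      using pos by (intro tendsto_ennrealI tendsto_powr[OF tendsto_const lim]) simp
    ultimately show "(\<lambda>k. g k i \<omega>) \<longlonglongrightarrow> ennreal (T i \<omega> powr \<theta>)"
      using tendsto_cong by fast
  qed measurable
  also have "\<dots> \<le> 1"
  proof (rule liminf_le_1[OF _ r])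
    fix k
    define n where "n = r k"
    have "integrable M (\<lambda>\<omega>. \<Sum>i<n. cut n i \<omega> * (1 * T i \<omega>) powr s n)"
      by (rule integrable_cut[where K = "Suc n powr s n" and f = "\<lambda>x. x powr s n"])
         (use s(1)[of n] in \<open>auto intro: powr_mono2\<close>)
    then have "(\<integral>\<^sup>+\<omega>. ennreal (\<Sum>i<n. cut n i \<omega> * T i \<omega> powr s n) \<partial>M) = ennreal (cut_moment n (s n))"
      unfolding cut_moment_def by (intro nn_integral_eq_integral) (auto intro!: sum_nonneg)
    moreover have "(\<Sum>i. g k i \<omega>) = ennreal (\<Sum>i<n. cut n i \<omega> * T i \<omega> powr s n)" for \<omega>
      by (subst suminf_finite[of "{..<n}"]) (auto simp: g_def n_def sum_ennreal)
    ultimately have "(\<integral>\<^sup>+\<omega>. (\<Sum>i. g k i \<omega>) \<partial>M) = ennreal (cut_moment n (s n))" by simp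
    also have "\<dots> \<le> ennreal (1 + 1 / real (Suc n))" using s(2) by (rule ennreal_leI)
    finally show "(\<integral>\<^sup>+\<omega>. (\<Sum>i. g k i \<omega>) \<partial>M) \<le> ennreal (1 + 1 / real (Suc (r k)))" by (simp only: n_def)
  qed
  finally show ?thesis
    using \<theta> by (auto intro: INF_lower2)
qed

end

section \<open>Fixed points and weighted branching\<close>

text \<open>Extends \<open>exp (- t y)\<close> to \<open>y = \<infinity>\<close>; the plain \<^const>\<open>enn2real\<close> would send \<open>\<infinity>\<close> to \<open>0\<close>.\<close>

definition exp_neg :: "real \<Rightarrow> ennreal \<Rightarrow> real" where
  "exp_neg t y = (if y = \<infinity> then 0 else exp (- (t * enn2real y)))"

lemma exp_neg_measurable [measurable]: "exp_neg t \<in> borel_measurable borel"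
  unfolding exp_neg_def by measurable

lemma exp_neg_ennreal [simp]: "0 \<le> x \<Longrightarrow> exp_neg t (ennreal x) = exp (- (t * x))"
  by (simp add: exp_neg_def)

lemma exp_neg_bounds: "0 \<le> t \<Longrightarrow> 0 \<le> exp_neg t y" "0 \<le> t \<Longrightarrow> exp_neg t y \<le> 1"
  by (auto simp: exp_neg_def)

lemma exp_neg_antimono:
  assumes "0 \<le> t" "0 \<le> a" "ennreal a \<le> y"
  shows "exp_neg t y \<le> exp (- (t * a))"
proof (cases y)
  case (real b)
  then show ?thesis using assms by (auto intro: mult_left_mono)
qed (simp add: exp_neg_def)

lemma (in nonneg_law) prod_exp_PiM:
  fixes a :: "nat \<Rightarrow> real"
  assumes a: "\<And>i. 0 \<le> a i"
  shows "(\<integral>x. (\<Prod>i<n. exp (- (a i * x i))) \<partial>(\<Pi>\<^sub>M i\<in>(UNIV :: nat set). P)) = (\<Prod>i<n. laplace P (a i))"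
proof -
  let ?\<Pi> = "\<Pi>\<^sub>M i\<in>(UNIV :: nat set). P"
  interpret \<Pi>: prob_space ?\<Pi> by (intro prob_space_PiM) unfold_locales
  have comp: "distr ?\<Pi> P (\<lambda>x. x i) = P" for i
    by (rule distr_PiM_component) (auto, unfold_locales)
  have "\<Pi>.indep_vars (\<lambda>_. P) (\<lambda>i x. x i) UNIV"
    by (subst \<Pi>.indep_vars_iff_distr_eq_PiM) (auto simp: comp restrict_UNIV intro: distr_id2)
  then have "\<Pi>.indep_vars (\<lambda>_. P) (\<lambda>i x. x i) {..<n}"
    by (rule \<Pi>.indep_vars_subset) simp
  then have ind: "\<Pi>.indep_vars (\<lambda>_. borel) (\<lambda>i x. exp (- (a i * x i))) {..<n}"
    by (rule \<Pi>.indep_vars_compose2[where Y = "\<lambda>i y. exp (- (a i * y))"]) measurable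
  have lap: "(\<integral>x. exp (- (a i * x i)) \<partial>?\<Pi>) = laplace P (a i)" for i
    unfolding laplace_def by (subst (2) comp[of i, symmetric], subst integral_distr) auto
  have int: "integrable ?\<Pi> (\<lambda>x. exp (- (a i * x i)))" for i
  proof -
    have "integrable (distr ?\<Pi> P (\<lambda>x. x i)) (\<lambda>y. exp (- (a i * y)))"
      unfolding comp using a by (rule integrable_exp)
    then show ?thesis by (subst (asm) integrable_distr_eq) auto
  qed
  show ?thesis
    by (subst \<Pi>.indep_vars_lebesgue_integral[OF _ ind int]) (auto simp: lap)
qed

lemma nonneg_law_fixed_point: "P \<in> fixed_points M C T \<Longrightarrow> nonneg_law P"
  by (simp add: fixed_points_def nonneg_law_def nonneg_law_axioms_def real_distribution_def
      real_distribution_axioms_def)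

lemma (in nonneg_law) AE_PiM_nonneg: "AE x in (\<Pi>\<^sub>M i\<in>(UNIV :: nat set). P). \<forall>i. 0 \<le> x i"
  using nonneg by (auto simp: AE_all_countable intro!: AE_PiM_component) unfold_locales

lemma (in nonneg_law) measurable_PiM_coord [measurable]:
  "(\<lambda>x. x i) \<in> borel_measurable (\<Pi>\<^sub>M i\<in>(UNIV :: nat set). P)"
  using measurable_component_singleton[of i UNIV "\<lambda>_. P"] by (simp cong: measurable_cong_sets)

text \<open>Fubini: for fixed \<omega> the coordinates are independent with law P and the product
  factorises. Only finite products occur, so this serves lower bounds for infinite sums as well as
  exact finite equations.\<close>

lemma (in nonneg_law) prod_exp_pair:
  fixes T :: "nat \<Rightarrow> 'a \<Rightarrow> real"
  assumes "prob_space M" and [measurable]: "\<And>i. T i \<in> borel_measurable M"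
    and T: "\<forall>\<omega>\<in>space M. \<forall>i. 0 \<le> T i \<omega>"
  defines "R \<equiv> (\<Pi>\<^sub>M i\<in>(UNIV :: nat set). P)"
  shows "AE z in M \<Otimes>\<^sub>M R. \<forall>i. 0 \<le> T i (fst z) * snd z i"
    and "0 \<le> t \<Longrightarrow> integrable (M \<Otimes>\<^sub>M R) (\<lambda>z. \<Prod>i<n. exp (- (t * T i (fst z) * snd z i)))"
    and "0 \<le> t \<Longrightarrow> (\<integral>z. (\<Prod>i<n. exp (- (t * T i (fst z) * snd z i))) \<partial>(M \<Otimes>\<^sub>M R)) =
      (\<integral>\<omega>. (\<Prod>i<n. laplace P (t * T i \<omega>)) \<partial>M)"
proof -
  interpret M: prob_space M by fact
  interpret R: prob_space R unfolding R_def by (intro prob_space_PiM) unfold_locales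
  interpret MP: pair_prob_space M R ..
  have [measurable]: "(\<lambda>x. x i) \<in> borel_measurable R" for i unfolding R_def by measurable
  have "AE x in R. \<forall>i. 0 \<le> x i" unfolding R_def by (rule AE_PiM_nonneg)
  then have "AE z in M \<Otimes>\<^sub>M R. \<forall>i. 0 \<le> snd z i"
    by (intro MP.AE_pair_measure) auto
  moreover have "AE z in M \<Otimes>\<^sub>M R. fst z \<in> space M" by (rule AE_I2) (auto simp: space_pair_measure)
  ultimately show AE: "AE z in M \<Otimes>\<^sub>M R. \<forall>i. 0 \<le> T i (fst z) * snd z i"
    by eventually_elim (use T in auto)
  assume t: "0 \<le> t"
  show int: "integrable (M \<Otimes>\<^sub>M R) (\<lambda>z. \<Prod>i<n. exp (- (t * T i (fst z) * snd z i)))"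
  proof (rule MP.P.integrable_const_bound[of _ 1])
    show "AE z in M \<Otimes>\<^sub>M R. norm (\<Prod>i<n. exp (- (t * T i (fst z) * snd z i))) \<le> 1"
      using AE by eventually_elim (use t in \<open>auto simp: abs_prod mult.assoc intro!: prod_le_1\<close>)
  qed measurable
  have "(\<integral>z. (\<Prod>i<n. exp (- (t * T i (fst z) * snd z i))) \<partial>(M \<Otimes>\<^sub>M R)) =
      (\<integral>\<omega>. (\<integral>x. (\<Prod>i<n. exp (- (t * T i \<omega> * x i))) \<partial>R) \<partial>M)"
    using MP.integral_fst'[OF int] by simp
  also have "\<dots> = (\<integral>\<omega>. (\<Prod>i<n. laplace P (t * T i \<omega>)) \<partial>M)"
    unfolding R_def using T t by (intro Bochner_Integration.integral_cong refl prod_exp_PiM) simp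
  finally show "(\<integral>z. (\<Prod>i<n. exp (- (t * T i (fst z) * snd z i))) \<partial>(M \<Otimes>\<^sub>M R)) = \<dots>" .
qed

text \<open>Dropping C and all summands from n on makes the sum smaller and its transform larger.
  Since \<open>exp_neg\<close> is 0 at infinity, the comparison also holds where the series
  diverges.\<close>

lemma smoothing_sub_fixed_point:
  assumes "prob_space M" and [measurable]: "C \<in> borel_measurable M" "\<And>i. T i \<in> borel_measurable M"
    and T: "\<And>i \<omega>. \<omega> \<in> space M \<Longrightarrow> 0 \<le> T i \<omega>"
    and P: "P \<in> fixed_points M C T" "P \<noteq> return borel 0"
  shows "smoothing_sub M P T"
proof -
  interpret M: prob_space M by fact
  interpret L: nonneg_law P using P(1) by (rule nonneg_law_fixed_point)
  let ?\<Pi> = "\<Pi>\<^sub>M i\<in>(UNIV :: nat set). P"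
  interpret \<Pi>: prob_space ?\<Pi> by (intro prob_space_PiM) unfold_locales
  interpret MP: pair_prob_space M ?\<Pi> ..
  have law: "distr P borel ennreal = smoothing_law M C T P" using P(1) by (simp add: fixed_points_def)
  have le: "laplace P t \<le> (\<integral>\<omega>. (\<Prod>i<n. laplace P (t * T i \<omega>)) \<partial>M)" if t: "0 < t" for n t
  proof -
    have "\<forall>\<omega>\<in>space M. \<forall>i. 0 \<le> T i \<omega>" using T by blast
    note pair = L.prod_exp_pair[where T = T, OF \<open>prob_space M\<close> assms(3) this]
    have "laplace P t = (\<integral>x. exp_neg t (ennreal x) \<partial>P)"
      unfolding laplace_def
      by (rule integral_cong_AE) (use L.nonneg in \<open>auto elim!: eventually_mono\<close>)
    also have "\<dots> = (\<integral>y. exp_neg t y \<partial>distr P borel ennreal)"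
      by (subst integral_distr) auto
    also have "\<dots> = (\<integral>z. exp_neg t (ennreal (C (fst z)) + (\<Sum>i. ennreal (T i (fst z) * snd z i))) \<partial>(M \<Otimes>\<^sub>M ?\<Pi>))"
      unfolding law smoothing_law_def by (subst integral_distr) (auto simp: case_prod_beta')
    also have "\<dots> \<le> (\<integral>z. (\<Prod>i<n. exp (- (t * T i (fst z) * snd z i))) \<partial>(M \<Otimes>\<^sub>M ?\<Pi>))"
    proof (rule integral_mono_AE)
      show "integrable (M \<Otimes>\<^sub>M ?\<Pi>) (\<lambda>z. exp_neg t (ennreal (C (fst z)) + (\<Sum>i. ennreal (T i (fst z) * snd z i))))"
        by (rule MP.P.integrable_const_bound[of _ 1]) (use t exp_neg_bounds[of t] in auto)
      show "AE z in M \<Otimes>\<^sub>M ?\<Pi>. exp_neg t (ennreal (C (fst z)) + (\<Sum>i. ennreal (T i (fst z) * snd z i)))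
          \<le> (\<Prod>i<n. exp (- (t * T i (fst z) * snd z i)))"
        using pair(1)
      proof eventually_elim
        case (elim z)
        then have pos: "0 \<le> T i (fst z) * snd z i" for i by simp
        have "ennreal (\<Sum>i<n. T i (fst z) * snd z i) = (\<Sum>i<n. ennreal (T i (fst z) * snd z i))"
          using pos by (simp add: sum_ennreal)
        also have "\<dots> \<le> (\<Sum>i. ennreal (T i (fst z) * snd z i))" by (rule sum_le_suminf) auto
        also have "\<dots> \<le> ennreal (C (fst z)) + (\<Sum>i. ennreal (T i (fst z) * snd z i))" by simp
        finally have "exp_neg t (ennreal (C (fst z)) + (\<Sum>i. ennreal (T i (fst z) * snd z i)))
            \<le> exp (- (t * (\<Sum>i<n. T i (fst z) * snd z i)))"
          using t pos by (intro exp_neg_antimono sum_nonneg) auto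
        also have "\<dots> = (\<Prod>i<n. exp (- (t * T i (fst z) * snd z i)))"
          by (simp add: exp_sum[symmetric] sum_negf sum_distrib_left mult.assoc)
        finally show ?case .
      qed
    qed (rule pair(2)[OF less_imp_le[OF t]])
    also have "\<dots> = (\<integral>\<omega>. (\<Prod>i<n. laplace P (t * T i \<omega>)) \<partial>M)"
      by (rule pair(3)[OF less_imp_le[OF t]])
    finally show ?thesis .
  qed
  show ?thesis
    by unfold_locales (use T P le in auto)
qed

text \<open>For the Dirac measure at 0 the fixed-point equation makes the right-hand side vanish
  almost surely, and C is one of its nonnegative summands after embedding into
  [0,\<infinity>].\<close>

lemma fixed_point_nontrivial:
  assumes "prob_space M" and [measurable]: "C \<in> borel_measurable M" "\<And>i. T i \<in> borel_measurable M"
    and C: "measure M {\<omega> \<in> space M. C \<omega> > 0} > 0"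
    and P: "P \<in> fixed_points M C T"
  shows "P \<noteq> return borel 0"
proof
  assume eq: "P = return borel 0"
  interpret M: prob_space M by fact
  interpret L: nonneg_law P using P by (rule nonneg_law_fixed_point)
  let ?\<Pi> = "\<Pi>\<^sub>M i\<in>(UNIV :: nat set). P"
  interpret \<Pi>: prob_space ?\<Pi> by (intro prob_space_PiM) unfold_locales
  interpret MP: pair_prob_space M ?\<Pi> ..
  have law: "distr P borel ennreal = smoothing_law M C T P" using P by (simp add: fixed_points_def)
  have "AE x in P. ennreal x = 0"
    unfolding eq by (subst AE_return) auto
  then have "AE y in distr P borel ennreal. y = 0"
    by (subst AE_distr_iff) auto
  then have "AE z in M \<Otimes>\<^sub>M ?\<Pi>. ennreal (C (fst z)) + (\<Sum>i. ennreal (T i (fst z) * snd z i)) = 0"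
    unfolding law smoothing_law_def by (subst (asm) AE_distr_iff) (auto simp: case_prod_beta')
  then have "AE z in M \<Otimes>\<^sub>M ?\<Pi>. C (fst z) \<le> 0"
    by eventually_elim (simp add: ennreal_eq_0_iff)
  then have "AE \<omega> in M. AE x in ?\<Pi>. C \<omega> \<le> 0"
    by (auto dest: MP.AE_pair)
  then have "AE \<omega> in M. \<not> 0 < C \<omega>" by eventually_elim auto
  then have "M.prob {\<omega> \<in> space M. C \<omega> > 0} = 0"
    by (subst M.prob_eq_0) auto
  with C show False by simp
qed

section \<open>Weighted branching sums as functions of the labelled tree\<close>

text \<open>Applied to the injection \<open>(#) i\<close>, this says that the labels of the subtree
  at child i have the same joint law as those of the whole tree.\<close>

lemma (in prob_space) distr_indep_family:
  assumes X: "indep_vars (\<lambda>_. N) X UNIV" and D: "\<And>v. distr M N (X v) = D" and g: "inj g"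
  shows "distr M (\<Pi>\<^sub>M v\<in>UNIV. N) (\<lambda>\<omega> v. X (g v) \<omega>) = (\<Pi>\<^sub>M v\<in>UNIV. D)"
proof -
  \<comment> \<open>Independence is moved along \<open>g\<close> by treating the singletons as
    disjoint blocks of indices.\<close>
  have "disjoint_family (\<lambda>v. {g v})"
    using g by (auto simp: disjoint_family_on_def inj_def)
  then have "indep_vars (\<lambda>v. \<Pi>\<^sub>M u\<in>{g v}. N) (\<lambda>v \<omega>. \<lambda>u\<in>{g v}. X u \<omega>) UNIV"
    using indep_vars_restrict[OF X, of UNIV "\<lambda>v. {g v}"] by simp
  then have "indep_vars (\<lambda>_. N) (\<lambda>v \<omega>. (\<lambda>u\<in>{g v}. X u \<omega>) (g v)) UNIV"
    by (rule indep_vars_compose2[where Y = "\<lambda>v f. f (g v)"]) simp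
  then have ind: "indep_vars (\<lambda>_. N) (\<lambda>v. X (g v)) UNIV" by simp
  have "random_variable N (X v)" for v using X by (simp add: indep_vars_def)
  then show ?thesis
    using ind indep_vars_iff_distr_eq_PiM[of UNIV "\<lambda>v. X (g v)" "\<lambda>_. N"] by (simp add: D restrict_UNIV)
qed

text \<open>The total weight read on the canonical space of labelled trees, so that equality in law
  of label families passes to the sums.\<close>

definition tree_sum :: "(nat list \<Rightarrow> real \<times> (nat \<Rightarrow> real)) \<Rightarrow> ennreal" where
  "tree_sum y = total_weight (\<lambda>v y. fst (y v)) (\<lambda>v i y. snd (y v) i) y"

lemma tree_sum_measurable [measurable]:
  "tree_sum \<in> borel_measurable (\<Pi>\<^sub>M v\<in>(UNIV :: nat list set). seq_space)"
proof -
  let ?N = "\<Pi>\<^sub>M v\<in>(UNIV :: nat list set). seq_space"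
  have [measurable]: "(\<lambda>y. snd (y v) i) \<in> borel_measurable ?N" for v i
    by (rule measurable_compose[OF measurable_compose[OF measurable_component_singleton[of v] measurable_snd]
          measurable_component_singleton[of i]]) auto
  define f where "f y v = ennreal (path_weight (\<lambda>v i y. snd (y v) i) v y * fst (y v))"
    for y :: "nat list \<Rightarrow> real \<times> (nat \<Rightarrow> real)" and v
  have [measurable]: "(\<lambda>y. f y v) \<in> borel_measurable ?N" for v
    unfolding f_def path_weight_def by measurable
  have "(\<lambda>p. f (snd p) (fst p)) \<in> borel_measurable (count_space UNIV \<Otimes>\<^sub>M ?N)"
    by (rule measurable_pair_measure_countable1) auto
  then have "(\<lambda>p. f (fst p) (snd p)) \<in> borel_measurable (?N \<Otimes>\<^sub>M count_space UNIV)"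
    by (subst measurable_pair_swap_iff) (simp add: case_prod_beta')
  then have "(\<lambda>y. \<integral>\<^sup>+v. f y v \<partial>count_space UNIV) \<in> borel_measurable ?N"
    by (intro sigma_finite_measure.borel_measurable_nn_integral sigma_finite_measure_count_space_countable)
       (auto simp: case_prod_beta')
  then show ?thesis
    by (simp add: tree_sum_def[abs_def] total_weight_def f_def)
qed

lemma total_weight_eq_tree_sum: "total_weight CC TT \<omega> = tree_sum (\<lambda>v. (CC v \<omega>, \<lambda>i. TT v i \<omega>))"
  by (simp add: tree_sum_def total_weight_def path_weight_def)

lemma path_weight_Cons: "path_weight TT (i # v) \<omega> = TT [] i \<omega> * path_weight (\<lambda>u. TT (i # u)) v \<omega>"
  by (simp add: path_weight_def prod.lessThan_Suc_shift del: prod.lessThan_Suc)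

text \<open>The first letter of a vertex splits off the factor T_i of the root. The vertices below
  the children i < n form disjoint sets; the root term and the other subtrees are dropped.\<close>

lemma total_weight_ge:
  assumes nonneg: "\<And>v. 0 \<le> CC v \<omega>" "\<And>v i. 0 \<le> TT v i \<omega>"
  shows "(\<Sum>i<n. ennreal (TT [] i \<omega>) * total_weight (\<lambda>v. CC (i # v)) (\<lambda>v. TT (i # v)) \<omega>)
    \<le> total_weight CC TT \<omega>"
proof -
  define f where "f v = ennreal (path_weight TT v \<omega> * CC v \<omega>)" for v
  have pw: "0 \<le> path_weight TT v \<omega>" "0 \<le> path_weight (\<lambda>u. TT (i # u)) v \<omega>" for v i
    using nonneg by (auto simp: path_weight_def intro: prod_nonneg)
  have "ennreal (TT [] i \<omega>) * total_weight (\<lambda>v. CC (i # v)) (\<lambda>v. TT (i # v)) \<omega>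
      = (\<integral>\<^sup>+v. f v * indicator (range ((#) i)) v \<partial>count_space UNIV)" for i
  proof -
    have "ennreal (TT [] i \<omega>) * total_weight (\<lambda>v. CC (i # v)) (\<lambda>v. TT (i # v)) \<omega>
        = (\<integral>\<^sup>+v. f (i # v) \<partial>count_space UNIV)"
      unfolding total_weight_def
      by (subst nn_integral_cmult[symmetric])
         (auto simp: f_def path_weight_Cons ennreal_mult[symmetric] nonneg pw mult.assoc intro!: nn_integral_cong)
    also have "\<dots> = (\<integral>\<^sup>+v. f v \<partial>count_space (range ((#) i)))"
      by (rule nn_integral_bij_count_space) (auto simp: bij_betw_def)
    finally show ?thesis by (simp add: nn_integral_count_space_indicator)
  qed
  then have "(\<Sum>i<n. ennreal (TT [] i \<omega>) * total_weight (\<lambda>v. CC (i # v)) (\<lambda>v. TT (i # v)) \<omega>)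
      = (\<integral>\<^sup>+v. (\<Sum>i<n. f v * indicator (range ((#) i)) v) \<partial>count_space UNIV)"
    by (simp only: nn_integral_sum[OF borel_measurable_count_space])
  also have "\<dots> \<le> (\<integral>\<^sup>+v. f v \<partial>count_space UNIV)"
  proof (rule nn_integral_mono)
    fix v
    show "(\<Sum>i<n. f v * indicator (range ((#) i)) v) \<le> f v"
    proof (cases v)
      case (Cons j u)
      then have "(\<Sum>i<n. f v * indicator (range ((#) i)) v) = (\<Sum>i<n. if i = j then f v else 0)"
        by (intro sum.cong) (auto simp: indicator_def)
      then show ?thesis by simp
    qed (simp add: image_iff)
  qed
  finally show ?thesis by (simp add: total_weight_def f_def)
qed

lemma total_weight_ge_root: "ennreal (CC [] \<omega>) \<le> total_weight CC TT \<omega>"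
proof -
  have "ennreal (CC [] \<omega>) = (\<integral>\<^sup>+v. ennreal (path_weight TT v \<omega> * CC v \<omega>) * indicator {[]} v \<partial>count_space UNIV)"
    by (subst nn_integral_count_space_indicator[symmetric]) (auto simp: nn_integral_count_space_finite path_weight_def)
  also have "\<dots> \<le> total_weight CC TT \<omega>"
    unfolding total_weight_def by (intro nn_integral_mono) (auto simp: indicator_def)
  finally show ?thesis .
qed

text \<open>The total weights W_i of the subtrees at the children are i.i.d. copies of W*,
  independent of the root weights, and W* is at least the sum of T_i W_i over i < n; hence the law
  of W* satisfies the inequality of a subsolution. It is not concentrated at 0 because W* >=
  C.\<close>

lemma smoothing_sub_total_weight:
  assumes "prob_space M" and meas: "C \<in> borel_measurable M" "\<And>i. T i \<in> borel_measurable M"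
    and nonneg: "\<And>\<omega>. \<omega> \<in> space M \<Longrightarrow> 0 \<le> C \<omega>" "\<And>i \<omega>. \<omega> \<in> space M \<Longrightarrow> 0 \<le> T i \<omega>"
    and wb: "weighted_branching M C T CC TT"
    and fin: "AE \<omega> in M. total_weight CC TT \<omega> < \<infinity>"
    and C: "measure M {\<omega> \<in> space M. C \<omega> > 0} > 0"
  shows "smoothing_sub M (distr M borel (\<lambda>\<omega>. enn2real (total_weight CC TT \<omega>))) T"
proof -
  interpret M: prob_space M by fact
  note [measurable] = meas
  let ?N = "\<Pi>\<^sub>M v\<in>(UNIV :: nat list set). seq_space"
  define X where "X v \<omega> = (CC v \<omega>, \<lambda>i. TT v i \<omega>)" for v \<omega>
  define D where "D = distr M seq_space (\<lambda>\<omega>. (C \<omega>, \<lambda>i. T i \<omega>))"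
  have root: "CC [] = C" "TT [] = T" using wb by (auto simp: weighted_branching_def)
  have X: "M.indep_vars (\<lambda>_. seq_space) X UNIV"
    using wb by (simp add: weighted_branching_def X_def[abs_def])
  have DX: "distr M seq_space (X v) = D" for v
    using wb by (simp add: weighted_branching_def X_def[abs_def] D_def)
  have Xm [measurable]: "X v \<in> measurable M seq_space" for v using X by (simp add: M.indep_vars_def)
  \<comment> \<open>Signs are known everywhere only for the root pair; the other labels inherit them
    almost surely through their common law.\<close>
  have nn: "AE \<omega> in M. 0 \<le> CC v \<omega> \<and> (\<forall>i. 0 \<le> TT v i \<omega>)" for v
  proof -
    let ?Q = "\<lambda>z :: real \<times> (nat \<Rightarrow> real). 0 \<le> fst z \<and> (\<forall>i. 0 \<le> snd z i)"
    have [measurable]: "(\<lambda>z. snd z i) \<in> borel_measurable seq_space" for i :: nat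
      by (rule measurable_compose[OF measurable_snd measurable_component_singleton[of i]]) auto
    have [measurable]: "(\<lambda>\<omega>. (C \<omega>, \<lambda>i. T i \<omega>)) \<in> measurable M seq_space"
      by (intro measurable_Pair measurable_PiM_single') auto
    have set: "{z \<in> space seq_space. ?Q z} \<in> sets seq_space" by measurable
    have "AE z in D. ?Q z"
      unfolding D_def by (subst AE_distr_iff[OF _ set]) (use nonneg in auto)
    then have "AE z in distr M seq_space (X v). ?Q z" by (simp only: DX)
    then show ?thesis by (subst (asm) AE_distr_iff[OF Xm set]) (simp add: X_def)
  qed
  define W where "W i \<omega> = tree_sum (\<lambda>v. X (i # v) \<omega>)" for i \<omega>
  define W0 where "W0 \<omega> = tree_sum (\<lambda>v. X v \<omega>)" for \<omega>
  have W0: "total_weight CC TT \<omega> = W0 \<omega>" for \<omega>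
    by (simp add: total_weight_eq_tree_sum W0_def X_def)
  have fam [measurable]: "(\<lambda>\<omega> v. X (g v) \<omega>) \<in> measurable M ?N" for g
    by (intro measurable_PiM_single') (auto simp: space_pair_measure space_PiM)
  have [measurable]: "W i \<in> borel_measurable M" "W0 \<in> borel_measurable M" for i
    unfolding W_def W0_def by measurable
  have lawW: "distr M borel (W i) = distr M borel W0" for i
  proof -
    have "distr M ?N (\<lambda>\<omega> v. X (i # v) \<omega>) = distr M ?N (\<lambda>\<omega> v. X v \<omega>)"
      using M.distr_indep_family[OF X DX, of "(#) i"] M.distr_indep_family[OF X DX, of "\<lambda>v. v"] by simp
    then have "distr (distr M ?N (\<lambda>\<omega> v. X (i # v) \<omega>)) borel tree_sum = distr (distr M ?N (\<lambda>\<omega> v. X v \<omega>)) borel tree_sum"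
      by simp
    then show ?thesis
      by (simp add: distr_distr fam[of "\<lambda>v. v"] o_def W_def[abs_def] W0_def[abs_def])
  qed
  have finW: "AE \<omega> in M. W i \<omega> < \<infinity>" for i
  proof -
    have "AE y in distr M borel W0. y < \<infinity>" using fin W0 by (subst AE_distr_iff) auto
    then have "AE y in distr M borel (W i). y < \<infinity>" by (simp only: lawW)
    then show ?thesis by (subst (asm) AE_distr_iff) auto
  qed
  define w where "w i \<omega> = enn2real (W i \<omega>)" for i \<omega>
  define P where "P = distr M borel (\<lambda>\<omega>. enn2real (W0 \<omega>))"
  have [measurable]: "w i \<in> borel_measurable M" for i unfolding w_def by measurable
  have Pw: "distr M borel (w i) = P" for i
  proof -
    have "distr (distr M borel (W i)) borel enn2real = distr (distr M borel W0) borel enn2real"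
      by (simp add: lawW)
    then show ?thesis by (simp add: distr_distr o_def P_def w_def[abs_def])
  qed
  have "AE x in P. 0 \<le> x" unfolding P_def by (subst AE_distr_iff) auto
  then interpret P: nonneg_law P
    unfolding nonneg_law_def nonneg_law_axioms_def P_def by (auto intro: M.real_distribution_distr)
  \<comment> \<open>The subtrees at different children use disjoint sets of vertices.\<close>
  have indw: "M.indep_vars (\<lambda>_. borel) w UNIV"
  proof -
    have "disjoint_family (\<lambda>i::nat. range ((#) i))" by (auto simp: disjoint_family_on_def)
    then have "M.indep_vars (\<lambda>i. \<Pi>\<^sub>M v\<in>range ((#) i). seq_space) (\<lambda>i \<omega>. \<lambda>v\<in>range ((#) i). X v \<omega>) (UNIV :: nat set)"
      using M.indep_vars_restrict[OF X, of UNIV "\<lambda>i. range ((#) i)"] by simp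
    then have "M.indep_vars (\<lambda>_. borel)
        (\<lambda>i \<omega>. enn2real (tree_sum (\<lambda>v. (\<lambda>v\<in>range ((#) i). X v \<omega>) (i # v)))) (UNIV :: nat set)"
    proof (rule M.indep_vars_compose2[where Y = "\<lambda>i f. enn2real (tree_sum (\<lambda>v. f (i # v)))"])
      fix i :: nat
      have [measurable]: "(\<lambda>f v. f (i # v)) \<in> measurable (\<Pi>\<^sub>M v\<in>range ((#) i). seq_space) ?N"
        by (intro measurable_PiM_single') (auto simp: space_PiM space_pair_measure)
      show "(\<lambda>f. enn2real (tree_sum (\<lambda>v. f (i # v)))) \<in> borel_measurable (\<Pi>\<^sub>M v\<in>range ((#) i). seq_space)"
        by measurable
    qed
    then show ?thesis by (simp add: w_def[abs_def] W_def)
  qed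
  let ?B = "\<Pi>\<^sub>M i\<in>(UNIV :: nat set). (borel :: real measure)"
  define S where "S \<omega> = (\<lambda>i. T i \<omega>)" for \<omega>
  define V where "V \<omega> = (\<lambda>i. w i \<omega>)" for \<omega>
  have [measurable]: "S \<in> measurable M ?B" "V \<in> measurable M ?B"
    unfolding S_def V_def by (intro measurable_PiM_single'; simp)+
  \<comment> \<open>The root weights depend on the block \<open>{[]}\<close> only, all
    \<open>w i\<close> on its complement.\<close>
  have indSV: "M.indep_var ?B S ?B V"
  proof -
    have "M.indep_var (\<Pi>\<^sub>M v\<in>{[]}. seq_space) (\<lambda>\<omega>. \<lambda>v\<in>{[]}. X v \<omega>)
        (\<Pi>\<^sub>M v\<in>-{[]}. seq_space) (\<lambda>\<omega>. \<lambda>v\<in>-{[]}. X v \<omega>)"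
      by (rule M.indep_var_restrict[OF X]) auto
    then have "M.indep_var ?B ((\<lambda>f. snd (f [])) \<circ> (\<lambda>\<omega>. \<lambda>v\<in>{[]}. X v \<omega>))
        ?B ((\<lambda>f i. enn2real (tree_sum (\<lambda>v. f (i # v)))) \<circ> (\<lambda>\<omega>. \<lambda>v\<in>-{[]}. X v \<omega>))"
    proof (rule M.indep_var_compose)
      show "(\<lambda>f. snd (f [])) \<in> measurable (\<Pi>\<^sub>M v\<in>{[]::nat list}. seq_space) ?B"
        by (rule measurable_compose[OF measurable_component_singleton[of _ _ "\<lambda>_. seq_space"] measurable_snd]) auto
      have [measurable]: "(\<lambda>f v. f (i # v)) \<in> measurable (\<Pi>\<^sub>M v\<in>-{[]}. seq_space) ?N" for i
        by (intro measurable_PiM_single') (auto simp: space_PiM space_pair_measure)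
      show "(\<lambda>f i. enn2real (tree_sum (\<lambda>v. f (i # v)))) \<in> measurable (\<Pi>\<^sub>M v\<in>-{[]}. seq_space) ?B"
        by (intro measurable_PiM_single') auto
    qed
    then show ?thesis
      by (simp add: o_def S_def[abs_def] V_def[abs_def] w_def W_def X_def root)
  qed
  have le: "laplace P t \<le> (\<integral>\<omega>. (\<Prod>i<n. laplace P (t * T i \<omega>)) \<partial>M)" if t: "0 < t" for n t
  proof -
    \<comment> \<open>The absolute values keep \<open>h\<close> between 0 and 1 on the whole product
      space; on the values taken almost surely they change nothing.\<close>
    define h where "h z = (\<Prod>i<n. exp (- (t * \<bar>fst z i\<bar> * \<bar>snd z i\<bar>)))" for z :: "(nat \<Rightarrow> real) \<times> (nat \<Rightarrow> real)"
    have [measurable]: "(\<lambda>y. snd y i) \<in> borel_measurable (?B \<Otimes>\<^sub>M ?B)" "(\<lambda>y. fst y i) \<in> borel_measurable (?B \<Otimes>\<^sub>M ?B)" for i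
      by (rule measurable_compose[OF _ measurable_component_singleton[of i UNIV]]; simp)+
    have [measurable]: "h \<in> borel_measurable (?B \<Otimes>\<^sub>M ?B)" unfolding h_def by measurable
    have hb: "0 \<le> h z" "h z \<le> 1" for z using t by (auto simp: h_def intro!: prod_le_1 prod_nonneg)
    interpret D1: prob_space "distr M ?B S" by (rule M.prob_space_distr) simp
    interpret D2: prob_space "distr M ?B V" by (rule M.prob_space_distr) simp
    interpret D12: pair_prob_space "distr M ?B S" "distr M ?B V" ..
    have "laplace P t = (\<integral>\<omega>. exp (- (t * enn2real (W0 \<omega>))) \<partial>M)"
      unfolding laplace_def P_def by (subst integral_distr) auto
    also have "\<dots> \<le> (\<integral>\<omega>. h (S \<omega>, V \<omega>) \<partial>M)"
    proof (rule integral_mono_AE)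
      show "integrable M (\<lambda>\<omega>. exp (- (t * enn2real (W0 \<omega>))))"
        by (rule M.integrable_const_bound[of _ 1]) (use t in auto)
      show "integrable M (\<lambda>\<omega>. h (S \<omega>, V \<omega>))"
        by (rule M.integrable_const_bound[of _ 1]) (use hb in auto)
      have "AE \<omega> in M. \<forall>i. W i \<omega> < \<infinity>" using finW by (simp add: AE_all_countable)
      moreover have "AE \<omega> in M. \<forall>v. 0 \<le> CC v \<omega> \<and> (\<forall>i. 0 \<le> TT v i \<omega>)"
        using nn by (simp add: AE_all_countable)
      ultimately show "AE \<omega> in M. exp (- (t * enn2real (W0 \<omega>))) \<le> h (S \<omega>, V \<omega>)"
        using fin
      proof eventually_elim
        case (elim \<omega>)
        have T0: "0 \<le> T i \<omega>" for i using elim(2) root by metis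
        have "ennreal (\<Sum>i<n. T i \<omega> * w i \<omega>) = (\<Sum>i<n. ennreal (T i \<omega>) * W i \<omega>)"
          using elim(1) T0 by (subst sum_ennreal[symmetric]) (auto simp: w_def ennreal_mult intro!: sum.cong)
        also have "\<dots> = (\<Sum>i<n. ennreal (TT [] i \<omega>) * total_weight (\<lambda>v. CC (i # v)) (\<lambda>v. TT (i # v)) \<omega>)"
          by (simp add: root W_def X_def total_weight_eq_tree_sum)
        also have "\<dots> \<le> W0 \<omega>" unfolding W0[symmetric] by (rule total_weight_ge) (use elim(2) in auto)
        finally have "enn2real (ennreal (\<Sum>i<n. T i \<omega> * w i \<omega>)) \<le> enn2real (W0 \<omega>)"
          using elim(3) W0 by (intro enn2real_mono) auto
        then have "(\<Sum>i<n. T i \<omega> * w i \<omega>) \<le> enn2real (W0 \<omega>)"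
          using T0 by (subst (asm) enn2real_ennreal) (auto simp: w_def intro!: sum_nonneg)
        then have "exp (- (t * enn2real (W0 \<omega>))) \<le> exp (- (t * (\<Sum>i<n. T i \<omega> * w i \<omega>)))"
          using t by simp
        also have "\<dots> = h (S \<omega>, V \<omega>)"
          using T0 by (simp add: h_def S_def V_def w_def exp_sum[symmetric] sum_negf sum_distrib_left mult.assoc)
        finally show ?case .
      qed
    qed
    also have "\<dots> = (\<integral>z. h z \<partial>distr M (?B \<Otimes>\<^sub>M ?B) (\<lambda>\<omega>. (S \<omega>, V \<omega>)))"
      by (subst integral_distr) auto
    also have "\<dots> = (\<integral>z. h z \<partial>(distr M ?B S \<Otimes>\<^sub>M distr M ?B V))"
      using indSV by (simp add: M.indep_var_distribution_eq)
    also have "\<dots> = (\<integral>x. (\<integral>y. h (x, y) \<partial>distr M ?B V) \<partial>distr M ?B S)"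
      by (rule D12.integral_fst'[symmetric], rule D12.P.integrable_const_bound[of _ 1]) (use hb in auto)
    also have "\<dots> = (\<integral>\<omega>. (\<integral>y. h (S \<omega>, y) \<partial>distr M ?B V) \<partial>M)"
      by (subst integral_distr) auto
    also have "\<dots> = (\<integral>\<omega>. (\<Prod>i<n. laplace P (t * T i \<omega>)) \<partial>M)"
    proof (rule Bochner_Integration.integral_cong[OF refl])
      fix \<omega> assume w: "\<omega> \<in> space M"
      have "(\<integral>y. h (S \<omega>, y) \<partial>distr M ?B V) = (\<integral>\<omega>'. (\<Prod>i<n. exp (- (t * T i \<omega> * w i \<omega>'))) \<partial>M)"
        using nonneg(2)[OF w] by (subst integral_distr) (auto simp: h_def S_def V_def w_def)
      also have "\<dots> = (\<Prod>i<n. \<integral>\<omega>'. exp (- (t * T i \<omega> * w i \<omega>')) \<partial>M)"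
      proof (rule M.indep_vars_lebesgue_integral)
        show "M.indep_vars (\<lambda>_. borel) (\<lambda>i \<omega>'. exp (- (t * T i \<omega> * w i \<omega>'))) {..<n}"
          by (rule M.indep_vars_compose2[OF M.indep_vars_subset[OF indw], where Y = "\<lambda>i x. exp (- (t * T i \<omega> * x))"]) auto
        show "integrable M (\<lambda>\<omega>'. exp (- (t * T i \<omega> * w i \<omega>')))" for i
          by (rule M.integrable_const_bound[of _ 1]) (use t nonneg(2)[OF w] in \<open>auto simp: w_def\<close>)
      qed simp
      also have "\<dots> = (\<Prod>i<n. laplace P (t * T i \<omega>))"
      proof (intro prod.cong refl)
        fix i
        show "(\<integral>\<omega>'. exp (- (t * T i \<omega> * w i \<omega>')) \<partial>M) = laplace P (t * T i \<omega>)"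
          unfolding laplace_def by (subst Pw[of i, symmetric], subst integral_distr) auto
      qed
      finally show "(\<integral>y. h (S \<omega>, y) \<partial>distr M ?B V) = (\<Prod>i<n. laplace P (t * T i \<omega>))" .
    qed
    finally show ?thesis .
  qed
  have "P \<noteq> return borel 0"
  proof
    assume eq: "P = return borel 0"
    have "AE x in P. x = 0" unfolding eq by (subst AE_return) auto
    then have "AE \<omega> in M. enn2real (W0 \<omega>) = 0"
      unfolding P_def by (subst (asm) AE_distr_iff) auto
    then have "AE \<omega> in M. \<not> 0 < C \<omega>"
      using fin
    proof eventually_elim
      case (elim \<omega>)
      then have "W0 \<omega> = 0" using W0[of \<omega>] by (auto simp: enn2real_eq_0_iff)
      then show ?case using total_weight_ge_root[of CC \<omega> TT] by (simp add: W0 root ennreal_eq_0_iff)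
    qed
    then have "M.prob {\<omega> \<in> space M. C \<omega> > 0} = 0" by (subst M.prob_eq_0) auto
    with C show False by simp
  qed
  then have "smoothing_sub M P T"
    by unfold_locales (use nonneg le in auto)
  then show ?thesis by (simp add: P_def W0)
qed

section \<open>Bounded weights\<close>

lemma abs_prod_diff_le:
  fixes a b :: "'i \<Rightarrow> real"
  assumes "\<And>i. i \<in> I \<Longrightarrow> a i \<in> {0..1}" "\<And>i. i \<in> I \<Longrightarrow> b i \<in> {0..1}"
  shows "\<bar>prod a I - prod b I\<bar> \<le> (\<Sum>i\<in>I. \<bar>a i - b i\<bar>)"
proof -
  have "norm (prod a I - prod b I) \<le> (\<Sum>i\<in>I. norm (a i - b i))"
    by (rule norm_prod_diff) (use assms in force)+
  then show ?thesis by simp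
qed

text \<open>Only the first n weights enter \<open>moment\<close> and \<open>smooth\<close>, so all
  moments on [0,1] are finite; B >= 1 gives B^\<theta> <= B there.\<close>

locale bounded_weights = M: prob_space M for M :: "'a measure" +
  fixes T :: "nat \<Rightarrow> 'a \<Rightarrow> real" and n :: nat and B :: real
  assumes T_measurable [measurable]: "\<And>i. T i \<in> borel_measurable M"
    and T_nonneg: "\<And>i \<omega>. \<omega> \<in> space M \<Longrightarrow> 0 \<le> T i \<omega>"
    and T_le: "\<And>i \<omega>. \<omega> \<in> space M \<Longrightarrow> T i \<omega> \<le> B"
    and B: "1 \<le> B"
begin

text \<open>Since \<open>0 powr \<theta> = 0\<close> also for \<theta> = 0, vanishing weights never
  contribute and \<open>moment 0\<close> is the mean number of positive weights.\<close>

definition moment :: "real \<Rightarrow> real" where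
  "moment \<theta> = (\<integral>\<omega>. (\<Sum>i<n. T i \<omega> powr \<theta>) \<partial>M)"

definition smooth :: "real measure \<Rightarrow> real measure" where
  "smooth P = distr (M \<Otimes>\<^sub>M (\<Pi>\<^sub>M i\<in>(UNIV :: nat set). P)) borel (\<lambda>z. \<Sum>i<n. T i (fst z) * snd z i)"

lemma nonneg_law_smooth:
  assumes "nonneg_law P"
  shows "nonneg_law (smooth P)"
    and "0 \<le> t \<Longrightarrow> laplace (smooth P) t = (\<integral>\<omega>. (\<Prod>i<n. laplace P (t * T i \<omega>)) \<partial>M)"
proof -
  interpret L: nonneg_law P by fact
  let ?\<Pi> = "\<Pi>\<^sub>M i\<in>(UNIV :: nat set). P"
  interpret \<Pi>: prob_space ?\<Pi> by (intro prob_space_PiM) unfold_locales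
  interpret MP: pair_prob_space M ?\<Pi> ..
  have "\<forall>\<omega>\<in>space M. \<forall>i. 0 \<le> T i \<omega>" using T_nonneg by blast
  note pair = L.prod_exp_pair[where T = T, OF M.prob_space_axioms T_measurable this]
  have "AE x in smooth P. 0 \<le> x"
    unfolding smooth_def by (subst AE_distr_iff) (use pair(1) in \<open>auto elim!: eventually_mono intro: sum_nonneg\<close>)
  then show "nonneg_law (smooth P)"
    unfolding nonneg_law_def nonneg_law_axioms_def smooth_def by (auto intro!: MP.P.real_distribution_distr)
  assume t: "0 \<le> t"
  have "laplace (smooth P) t = (\<integral>z. (\<Prod>i<n. exp (- (t * T i (fst z) * snd z i))) \<partial>(M \<Otimes>\<^sub>M ?\<Pi>))"
    unfolding laplace_def smooth_def
    by (subst integral_distr) (auto simp: exp_sum[symmetric] sum_negf sum_distrib_left mult.assoc)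
  also have "\<dots> = (\<integral>\<omega>. (\<Prod>i<n. laplace P (t * T i \<omega>)) \<partial>M)"
    using t by (rule pair(3))
  finally show "laplace (smooth P) t = (\<integral>\<omega>. (\<Prod>i<n. laplace P (t * T i \<omega>)) \<partial>M)" .
qed

lemma powr_le_B: "\<omega> \<in> space M \<Longrightarrow> 0 \<le> \<theta> \<Longrightarrow> \<theta> \<le> 1 \<Longrightarrow> T i \<omega> powr \<theta> \<le> B"
proof -
  assume w: "\<omega> \<in> space M" and \<theta>: "0 \<le> \<theta>" "\<theta> \<le> 1"
  have "T i \<omega> powr \<theta> \<le> B powr \<theta>" using T_nonneg[OF w] T_le[OF w] \<theta> by (intro powr_mono2) auto
  also have "\<dots> \<le> B powr 1" using B \<theta> by (intro powr_mono) auto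
  finally show ?thesis using B by simp
qed

lemma sum_powr_le: "\<omega> \<in> space M \<Longrightarrow> 0 \<le> \<theta> \<Longrightarrow> \<theta> \<le> 1 \<Longrightarrow> (\<Sum>i<n. T i \<omega> powr \<theta>) \<le> n * B"
  using sum_mono[of "{..<n}" "\<lambda>i. T i \<omega> powr \<theta>" "\<lambda>_. B"] powr_le_B by simp

lemma integrable_sum_powr:
  assumes "0 \<le> \<theta>" "\<theta> \<le> 1"
  shows "integrable M (\<lambda>\<omega>. \<Sum>i<n. T i \<omega> powr \<theta>)"
  by (rule M.integrable_const_bound[of _ "n * B"])
     (use sum_powr_le assms in \<open>auto simp: sum_nonneg\<close>)

lemma moment_nonneg: "0 \<le> moment \<theta>"
  unfolding moment_def by (intro Bochner_Integration.integral_nonneg sum_nonneg) auto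

lemma continuous_moment: "continuous_on {0..1} moment"
  unfolding continuous_on_sequentially
proof (intro allI ballI impI)
  fix x :: "nat \<Rightarrow> real" and a assume a: "a \<in> {0..1}" and x: "(\<forall>k. x k \<in> {0..1}) \<and> x \<longlonglongrightarrow> a"
  show "(moment \<circ> x) \<longlonglongrightarrow> moment a"
    unfolding moment_def o_def
  proof (rule integral_dominated_convergence[where w = "\<lambda>_. n * B"])
    show "AE \<omega> in M. (\<lambda>k. \<Sum>i<n. T i \<omega> powr x k) \<longlonglongrightarrow> (\<Sum>i<n. T i \<omega> powr a)"
    proof (intro AE_I2 tendsto_sum)
      fix \<omega> i
      \<comment> \<open>A zero weight gives the constant sequence 0, even when the exponents tend to
        0.\<close>
      show "(\<lambda>k. T i \<omega> powr x k) \<longlonglongrightarrow> T i \<omega> powr a"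
        using x by (cases "T i \<omega> = 0") (auto intro!: tendsto_powr)
    qed
    show "AE \<omega> in M. norm (\<Sum>i<n. T i \<omega> powr x k) \<le> n * B" for k
      using sum_powr_le x by (auto simp: sum_nonneg)
  qed auto
qed

text \<open>Convexity of exp makes \<theta> to x^\<theta> convex for each x > 0. This yields moments
  strictly below 1 between a point where the moment is 1 and one where it is less.\<close>

lemma moment_convex:
  assumes "0 \<le> a" "a \<le> 1" "0 \<le> b" "b \<le> 1" "0 \<le> u" "u \<le> 1"
  shows "moment ((1 - u) * a + u * b) \<le> (1 - u) * moment a + u * moment b"
proof -
  have pt: "x powr ((1 - u) * a + u * b) \<le> (1 - u) * x powr a + u * x powr b" if "0 \<le> x" for x :: real
  proof (cases "x = 0")
    case False
    then have "exp ((1 - u) * (a * ln x) + u * (b * ln x)) \<le> (1 - u) * exp (a * ln x) + u * exp (b * ln x)"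
      using convex_onD[OF exp_convex, of u "a * ln x" "b * ln x"] assms by simp
    then show ?thesis using False that by (simp add: powr_def algebra_simps)
  qed simp
  have I: "0 \<le> (1 - u) * a + u * b" "(1 - u) * a + u * b \<le> 1"
    using assms convex_bound_le[of a 1 b "1 - u" u] by auto
  have "moment ((1 - u) * a + u * b) \<le> (\<integral>\<omega>. (1 - u) * (\<Sum>i<n. T i \<omega> powr a) + u * (\<Sum>i<n. T i \<omega> powr b) \<partial>M)"
    unfolding moment_def
  proof (rule integral_mono)
    fix \<omega> assume w: "\<omega> \<in> space M"
    have "(\<Sum>i<n. T i \<omega> powr ((1 - u) * a + u * b)) \<le> (\<Sum>i<n. (1 - u) * T i \<omega> powr a + u * T i \<omega> powr b)"
      using T_nonneg[OF w] by (intro sum_mono pt)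
    then show "(\<Sum>i<n. T i \<omega> powr ((1 - u) * a + u * b)) \<le> (1 - u) * (\<Sum>i<n. T i \<omega> powr a) + u * (\<Sum>i<n. T i \<omega> powr b)"
      by (simp add: sum.distrib sum_distrib_left)
  qed (use I assms in \<open>auto intro!: integrable_sum_powr Bochner_Integration.integrable_add integrable_mult_right\<close>)
  also have "\<dots> = (1 - u) * moment a + u * moment b"
    unfolding moment_def using assms
    by (subst Bochner_Integration.integral_add) (auto intro!: integrable_sum_powr)
  finally show ?thesis .
qed

lemma integrable_prod_laplace:
  assumes "nonneg_law P" "0 \<le> t"
  shows "integrable M (\<lambda>\<omega>. \<Prod>i<n. laplace P (t * T i \<omega>))"
proof -
  interpret L: nonneg_law P by fact
  show ?thesis
  proof (rule M.integrable_const_bound[of _ 1])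
    show "AE \<omega> in M. norm (\<Prod>i<n. laplace P (t * T i \<omega>)) \<le> 1"
      using assms T_nonneg L.laplace_nonneg L.laplace_le_1
      by (intro AE_I2) (auto simp: abs_prod intro!: prod_le_1)
  qed measurable
qed

text \<open>A difference of products of factors in [0,1] is at most the sum of the differences, and
  (t T_i)^\<beta> = t^\<beta> T_i^\<beta> produces the factor \<open>moment \<beta>\<close>.\<close>

lemma smooth_contraction:
  assumes "nonneg_law P" "nonneg_law Q" "0 \<le> \<beta>" "\<beta> \<le> 1" "0 \<le> t"
    and diff: "\<And>t. 0 \<le> t \<Longrightarrow> \<bar>laplace P t - laplace Q t\<bar> \<le> K * t powr \<beta>"
  shows "\<bar>laplace (smooth P) t - laplace (smooth Q) t\<bar> \<le> K * moment \<beta> * t powr \<beta>"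
proof -
  interpret P: nonneg_law P by fact
  interpret Q: nonneg_law Q by fact
  note int = integrable_prod_laplace[OF assms(1,5)] integrable_prod_laplace[OF assms(2,5)]
  have "\<bar>laplace (smooth P) t - laplace (smooth Q) t\<bar> =
      \<bar>\<integral>\<omega>. (\<Prod>i<n. laplace P (t * T i \<omega>)) - (\<Prod>i<n. laplace Q (t * T i \<omega>)) \<partial>M\<bar>"
    using assms int by (simp add: nonneg_law_smooth)
  also have "\<dots> \<le> (\<integral>\<omega>. \<bar>(\<Prod>i<n. laplace P (t * T i \<omega>)) - (\<Prod>i<n. laplace Q (t * T i \<omega>))\<bar> \<partial>M)"
    by (rule integral_abs_bound)
  also have "\<dots> \<le> (\<integral>\<omega>. K * t powr \<beta> * (\<Sum>i<n. T i \<omega> powr \<beta>) \<partial>M)"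
  proof (rule integral_mono)
    fix \<omega> assume w: "\<omega> \<in> space M"
    have "\<bar>(\<Prod>i<n. laplace P (t * T i \<omega>)) - (\<Prod>i<n. laplace Q (t * T i \<omega>))\<bar>
        \<le> (\<Sum>i<n. \<bar>laplace P (t * T i \<omega>) - laplace Q (t * T i \<omega>)\<bar>)"
      using T_nonneg[OF w] assms(5) P.laplace_nonneg P.laplace_le_1 Q.laplace_nonneg Q.laplace_le_1
      by (intro abs_prod_diff_le) auto
    also have "\<dots> \<le> (\<Sum>i<n. K * (t * T i \<omega>) powr \<beta>)"
      using T_nonneg[OF w] assms(5) by (intro sum_mono diff) auto
    also have "\<dots> = K * t powr \<beta> * (\<Sum>i<n. T i \<omega> powr \<beta>)"
      using T_nonneg[OF w] assms(5) by (simp add: powr_mult sum_distrib_left mult.assoc)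
    finally show "\<bar>(\<Prod>i<n. laplace P (t * T i \<omega>)) - (\<Prod>i<n. laplace Q (t * T i \<omega>))\<bar> \<le> \<dots>" .
  qed (use int integrable_sum_powr assms in auto)
  also have "\<dots> = K * moment \<beta> * t powr \<beta>" by (simp add: moment_def)
  finally show ?thesis .
qed

text \<open>The function \<open>t \<mapsto> A t\<^sup>\<alpha>\<close> solves the linearised equation when \<open>moment \<alpha> = 1\<close>.\<close>

lemma smooth_power_tail:
  assumes P: "nonneg_law P" and \<alpha>: "0 < \<alpha>" "\<alpha> < \<beta>" "\<beta> \<le> 1" "\<beta> \<le> 2 * \<alpha>" and mom: "moment \<alpha> = 1" "moment \<beta> \<le> 1"
    and K: "0 \<le> K" "0 \<le> A"
    and tail: "\<And>t. 0 \<le> t \<Longrightarrow> \<bar>1 - laplace P t - A * t powr \<alpha>\<bar> \<le> K * t powr \<beta>"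
  obtains K' where "0 \<le> K'" "\<And>t. 0 \<le> t \<Longrightarrow> \<bar>laplace (smooth P) t - laplace P t\<bar> \<le> K' * t powr \<beta>"
proof -
  interpret P: nonneg_law P by fact
  define h where "h t = 1 - laplace P t" for t
  have h: "0 \<le> h t" "h t \<le> 1" if "0 \<le> t" for t
    using P.laplace_nonneg P.laplace_le_1 that by (auto simp: h_def)
  \<comment> \<open>A global bound: for t <= 1 from \<open>tail\<close>, as t^\<beta> <= t^\<alpha>
    there, and for t > 1 from h <= 1 <= t^\<alpha>.\<close>
  have h_le: "h t \<le> (A + K + 1) * t powr \<alpha>" if t: "0 \<le> t" for t
  proof (cases "t \<le> 1")
    case True
    have "t powr \<beta> \<le> t powr \<alpha>" using t True \<alpha> by (intro powr_mono') auto
    then have "K * t powr \<beta> \<le> K * t powr \<alpha>" using K by (intro mult_left_mono)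
    then have "h t \<le> A * t powr \<alpha> + K * t powr \<alpha>" using tail[OF t] by (simp add: h_def abs_le_iff)
    then show ?thesis using powr_ge_zero[of t \<alpha>] unfolding distrib_right by linarith
  next
    case False
    then have "1 \<le> t powr \<alpha>" using \<alpha> by (simp add: ge_one_powr_ge_zero)
    moreover have "1 * t powr \<alpha> \<le> (A + K + 1) * t powr \<alpha>" using K by (intro mult_right_mono) auto
    ultimately show ?thesis using h(2)[OF t] by simp
  qed
  define K3 where "K3 = ((A + K + 1) * (n * B))\<^sup>2"
  have K3: "0 \<le> K3" by (simp add: K3_def)
  show ?thesis
  \<comment> \<open>\<open>K3\<close> bounds the quadratic error of linearising the product, K
    enters once for P itself and once under the sum over the weights, and 1 covers t > 1.\<close>
  proof (rule that[of "K3 + 2 * K + 1"])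
    fix t :: real assume t: "0 \<le> t"
    show "\<bar>laplace (smooth P) t - laplace P t\<bar> \<le> (K3 + 2 * K + 1) * t powr \<beta>"
    proof (cases "t \<le> 1")
      case False
      have "1 \<le> t powr \<beta>" using False \<alpha> by (simp add: ge_one_powr_ge_zero)
      moreover have "1 * t powr \<beta> \<le> (K3 + 2 * K + 1) * t powr \<beta>" using K K3 by (intro mult_right_mono) auto
      moreover have "\<bar>laplace (smooth P) t - laplace P t\<bar> \<le> 1"
      proof -
        interpret S: nonneg_law "smooth P" using P by (rule nonneg_law_smooth)
        show ?thesis
          using P.laplace_nonneg[of t] P.laplace_le_1[OF t] S.laplace_nonneg[of t] S.laplace_le_1[OF t]
          by linarith
      qed
      ultimately show ?thesis by linarith
    next
      case True
      define S where "S \<omega> = (\<Sum>i<n. h (t * T i \<omega>))" for \<omega>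
      have [measurable]: "h \<in> borel_measurable borel" unfolding h_def by measurable
      have [measurable]: "S \<in> borel_measurable M" unfolding S_def by measurable
      have S: "0 \<le> S \<omega>" "S \<omega> \<le> n" if w: "\<omega> \<in> space M" for \<omega>
        using h T_nonneg[OF w] t sum_mono[of "{..<n}" "\<lambda>i. h (t * T i \<omega>)" "\<lambda>_. 1"]
        by (auto simp: S_def intro!: sum_nonneg)
      have intS: "integrable M S"
        by (rule M.integrable_const_bound[of _ n]) (use S in auto)
      have intP: "integrable M (\<lambda>\<omega>. \<Prod>i<n. laplace P (t * T i \<omega>))"
        using P t by (rule integrable_prod_laplace)
      \<comment> \<open>The product differs from 1 - S by at most S^2 = O(t^(2\<alpha>)), which for
        t <= 1 is O(t^\<beta>) because \<beta> <= 2\<alpha>.\<close>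
      have one: "\<bar>laplace (smooth P) t - (1 - (\<integral>\<omega>. S \<omega> \<partial>M))\<bar> \<le> K3 * t powr \<beta>"
      proof -
        have "laplace (smooth P) t - (1 - (\<integral>\<omega>. S \<omega> \<partial>M)) =
            (\<integral>\<omega>. (\<Prod>i<n. laplace P (t * T i \<omega>)) - (1 - S \<omega>) \<partial>M)"
          using intS intP P t by (simp add: nonneg_law_smooth M.prob_space)
        also have "\<bar>\<dots>\<bar> \<le> (\<integral>\<omega>. \<bar>(\<Prod>i<n. laplace P (t * T i \<omega>)) - (1 - S \<omega>)\<bar> \<partial>M)"
          by (rule integral_abs_bound)
        also have "\<dots> \<le> (\<integral>\<omega>. K3 * t powr \<beta> \<partial>M)"
        proof (rule integral_mono)
          fix \<omega> assume w: "\<omega> \<in> space M"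
          have x: "0 \<le> h (t * T i \<omega>)" "h (t * T i \<omega>) \<le> 1" for i
            using h T_nonneg[OF w] t by auto
          have eq: "(\<Prod>i<n. laplace P (t * T i \<omega>)) = (\<Prod>i<n. 1 - h (t * T i \<omega>))" by (simp add: h_def)
          have "(\<Prod>i<n. 1 - h (t * T i \<omega>)) \<le> 1 - S \<omega> + (S \<omega>)\<^sup>2"
            unfolding S_def by (rule prod_one_minus_le) (use x in auto)
          moreover have "\<bar>(\<Prod>i<n. 1 :: real) - (\<Prod>i<n. 1 - h (t * T i \<omega>))\<bar> \<le> (\<Sum>i<n. \<bar>1 - (1 - h (t * T i \<omega>))\<bar>)"
            using x by (intro abs_prod_diff_le) auto
          then have "1 - S \<omega> \<le> (\<Prod>i<n. 1 - h (t * T i \<omega>))" using x by (simp add: S_def)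
          ultimately have "\<bar>(\<Prod>i<n. laplace P (t * T i \<omega>)) - (1 - S \<omega>)\<bar> \<le> (S \<omega>)\<^sup>2"
            unfolding eq by linarith
          also have "\<dots> \<le> ((A + K + 1) * (n * B) * t powr \<alpha>)\<^sup>2"
          proof (rule power_mono)
            have "S \<omega> \<le> (\<Sum>i<n. (A + K + 1) * (t * T i \<omega>) powr \<alpha>)"
              unfolding S_def using T_nonneg[OF w] t by (intro sum_mono h_le) auto
            also have "\<dots> = (A + K + 1) * (\<Sum>i<n. T i \<omega> powr \<alpha>) * t powr \<alpha>"
              using T_nonneg[OF w] t by (simp add: powr_mult sum_distrib_left sum_distrib_right mult_ac)
            also have "\<dots> \<le> (A + K + 1) * (n * B) * t powr \<alpha>"
              using sum_powr_le[OF w, of \<alpha>] \<alpha> K by (intro mult_right_mono mult_left_mono) auto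
            finally show "S \<omega> \<le> \<dots>" .
          qed (use S[OF w] in simp)
          also have "\<dots> = K3 * t powr (2 * \<alpha>)"
            by (simp add: K3_def power_mult_distrib powr_add[symmetric] power2_eq_square[of "t powr \<alpha>"])
          also have "\<dots> \<le> K3 * t powr \<beta>"
            using K3 True t \<alpha> by (intro mult_left_mono powr_mono') auto
          finally show "\<bar>(\<Prod>i<n. laplace P (t * T i \<omega>)) - (1 - S \<omega>)\<bar> \<le> K3 * t powr \<beta>" .
        qed (use intP intS in auto)
        finally show ?thesis by (simp add: M.prob_space)
      qed
      \<comment> \<open>Replacing \<open>h\<close> by its leading power under the sum gives exactly
        A t^\<alpha>, as \<open>moment \<alpha> = 1\<close>; the remainder costs K t^\<beta> times
        \<open>moment \<beta>\<close>.\<close>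
      have two: "\<bar>(\<integral>\<omega>. S \<omega> \<partial>M) - A * t powr \<alpha>\<bar> \<le> K * t powr \<beta>"
      proof -
        have i\<alpha>: "integrable M (\<lambda>\<omega>. \<Sum>i<n. T i \<omega> powr \<alpha>)" "integrable M (\<lambda>\<omega>. \<Sum>i<n. T i \<omega> powr \<beta>)"
          using \<alpha> by (auto intro!: integrable_sum_powr)
        have "(\<integral>\<omega>. S \<omega> \<partial>M) - A * t powr \<alpha> = (\<integral>\<omega>. S \<omega> - A * t powr \<alpha> * (\<Sum>i<n. T i \<omega> powr \<alpha>) \<partial>M)"
          using intS i\<alpha> mom by (simp add: moment_def)
        also have "\<bar>\<dots>\<bar> \<le> (\<integral>\<omega>. \<bar>S \<omega> - A * t powr \<alpha> * (\<Sum>i<n. T i \<omega> powr \<alpha>)\<bar> \<partial>M)"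
          by (rule integral_abs_bound)
        also have "\<dots> \<le> (\<integral>\<omega>. K * t powr \<beta> * (\<Sum>i<n. T i \<omega> powr \<beta>) \<partial>M)"
        proof (rule integral_mono)
          fix \<omega> assume w: "\<omega> \<in> space M"
          have "S \<omega> - A * t powr \<alpha> * (\<Sum>i<n. T i \<omega> powr \<alpha>) = (\<Sum>i<n. h (t * T i \<omega>) - A * (t * T i \<omega>) powr \<alpha>)"
            using T_nonneg[OF w] t by (simp add: S_def sum_subtractf powr_mult sum_distrib_left mult_ac)
          also have "\<bar>\<dots>\<bar> \<le> (\<Sum>i<n. \<bar>h (t * T i \<omega>) - A * (t * T i \<omega>) powr \<alpha>\<bar>)"
            by (rule sum_abs)
          also have "\<dots> \<le> (\<Sum>i<n. K * (t * T i \<omega>) powr \<beta>)"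
            unfolding h_def using T_nonneg[OF w] t by (intro sum_mono tail) auto
          also have "\<dots> = K * t powr \<beta> * (\<Sum>i<n. T i \<omega> powr \<beta>)"
            using T_nonneg[OF w] t by (simp add: powr_mult sum_distrib_left mult.assoc)
          finally show "\<bar>S \<omega> - A * t powr \<alpha> * (\<Sum>i<n. T i \<omega> powr \<alpha>)\<bar> \<le> \<dots>" .
        qed (use intS i\<alpha> in auto)
        also have "\<dots> = K * t powr \<beta> * moment \<beta>" by (simp add: moment_def)
        also have "\<dots> \<le> K * t powr \<beta> * 1" using K mom by (intro mult_left_mono) auto
        finally show ?thesis by simp
      qed
      have "\<bar>laplace (smooth P) t - laplace P t\<bar> \<le> K3 * t powr \<beta> + K * t powr \<beta> + K * t powr \<beta>"
        using one two tail[OF t] by linarith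
      also have "\<dots> \<le> (K3 + 2 * K + 1) * t powr \<beta>" by (simp add: algebra_simps)
      finally show ?thesis .
    qed
  qed (use K K3 in simp)
qed

text \<open>Successive iterates differ by at most a constant times t^\<beta> q^k with q =
  \<open>moment \<beta>\<close> < 1, so the limit stays within O(t^\<beta>) of the start. Hence it
  tends to 1 at 0, which excludes loss of mass, and it keeps the leading term A t^\<alpha>, which
  excludes triviality.\<close>

lemma exists_fixed_point:
  assumes "1 < moment 0" "0 < \<kappa>" "\<kappa> \<le> 1" "moment \<kappa> < 1"
  obtains P where "nonneg_law P" "P \<noteq> return borel 0"
    "\<And>t. 0 \<le> t \<Longrightarrow> laplace P t = (\<integral>\<omega>. (\<Prod>i<n. laplace P (t * T i \<omega>)) \<partial>M)"
proof -
  obtain \<alpha> where "0 \<le> \<alpha>" "\<alpha> \<le> \<kappa>" and m\<alpha>: "moment \<alpha> = 1"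
    using IVT2'[of moment \<kappa> 1 0] assms continuous_on_subset[OF continuous_moment, of "{0..\<kappa>}"] by auto
  then have \<alpha>: "0 < \<alpha>" "\<alpha> < \<kappa>" using assms by (auto simp: less_le)
  \<comment> \<open>Capped by 2\<alpha> for \<open>smooth_power_tail\<close> and by \<kappa> so that
    convexity between \<alpha> and \<kappa> gives \<open>moment \<beta> < 1\<close>; u is the
    corresponding barycentric coordinate.\<close>
  define \<beta> where "\<beta> = min \<kappa> (2 * \<alpha>)"
  have \<beta>: "\<alpha> < \<beta>" "\<beta> \<le> \<kappa>" "\<beta> \<le> 2 * \<alpha>" "\<beta> \<le> 1" using \<alpha> assms by (auto simp: \<beta>_def)
  define u where "u = (\<beta> - \<alpha>) / (\<kappa> - \<alpha>)"
  have u: "0 < u" "u \<le> 1" using \<alpha> \<beta> by (auto simp: u_def)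
  have "u * (\<kappa> - \<alpha>) = \<beta> - \<alpha>" using \<alpha> by (simp add: u_def)
  then have "(1 - u) * \<alpha> + u * \<kappa> = \<beta>" by (simp add: algebra_simps)
  then have "moment \<beta> \<le> (1 - u) * 1 + u * moment \<kappa>"
    using moment_convex[of \<alpha> \<kappa> u] \<alpha> assms u m\<alpha> by simp
  also have "\<dots> < 1" using u assms by simp
  finally have m\<beta>: "moment \<beta> < 1" .
  define q where "q = moment \<beta>"
  have q: "0 \<le> q" "q < 1" using m\<beta> moment_nonneg by (auto simp: q_def)
  have "\<alpha> < 1" using \<beta> by simp
  then obtain P0 A K0 where P0: "nonneg_law P0" and A: "0 < A" and K0: "0 \<le> K0"
    and tail0: "\<And>t. 0 \<le> t \<Longrightarrow> t \<le> 1 \<Longrightarrow> \<bar>1 - laplace P0 t - A * t powr \<alpha>\<bar> \<le> K0 * t"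
    using exists_law_with_power_tail[OF \<alpha>(1)] by metis
  interpret P0: nonneg_law P0 by fact
  \<comment> \<open>\<open>K0\<close> serves t <= 1, and 1 + A serves t > 1, where the transform is
    merely bounded and t^\<alpha> <= t^\<beta>.\<close>
  define K where "K = K0 + 1 + A"
  have K: "0 \<le> K" using A K0 by (simp add: K_def)
  have tail: "\<bar>1 - laplace P0 t - A * t powr \<alpha>\<bar> \<le> K * t powr \<beta>" if t: "0 \<le> t" for t
  proof (cases "t \<le> 1")
    case True
    have "t powr 1 \<le> t powr \<beta>" using t True \<beta> by (intro powr_mono') auto
    then have "K0 * t \<le> K0 * t powr \<beta>" using t K0 by (intro mult_left_mono) auto
    also have "\<dots> \<le> K * t powr \<beta>" using A by (intro mult_right_mono) (auto simp: K_def)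
    finally show ?thesis using tail0[OF t True] by simp
  next
    case False
    have *: "1 \<le> t powr \<alpha>" "t powr \<alpha> \<le> t powr \<beta>"
      using False \<alpha> \<beta> by (auto simp: ge_one_powr_ge_zero intro!: powr_mono)
    have "\<bar>1 - laplace P0 t - A * t powr \<alpha>\<bar> \<le> 1 + A * t powr \<alpha>"
    proof -
      have "0 \<le> A * t powr \<alpha>" using A by simp
      then show ?thesis using P0.laplace_nonneg[of t] P0.laplace_le_1[OF t] by (simp add: abs_le_iff)
    qed
    also have "\<dots> \<le> t powr \<beta> + A * t powr \<beta>"
      using * A by (intro add_mono mult_left_mono) auto
    also have "\<dots> = (1 + A) * t powr \<beta>" by (simp add: algebra_simps)
    also have "\<dots> \<le> K * t powr \<beta>" using K0 by (intro mult_right_mono) (auto simp: K_def)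
    finally show ?thesis .
  qed
  obtain K' where K': "0 \<le> K'"
    and start: "\<And>t. 0 \<le> t \<Longrightarrow> \<bar>laplace (smooth P0) t - laplace P0 t\<bar> \<le> K' * t powr \<beta>"
    using smooth_power_tail[OF P0 \<alpha>(1) \<beta>(1,4,3) m\<alpha> less_imp_le[OF m\<beta>] K less_imp_le[OF A] tail] by metis
  define P where "P k = (smooth ^^ k) P0" for k
  have P_Suc: "P (Suc k) = smooth (P k)" for k by (simp add: P_def)
  have P: "nonneg_law (P k)" for k
    by (induction k) (auto simp: P_def P0 nonneg_law_smooth)
  have step: "\<bar>laplace (P (Suc k)) t - laplace (P k) t\<bar> \<le> K' * t powr \<beta> * q ^ k" if "0 \<le> t" for k t
    using that
  proof (induction k arbitrary: t)
    case 0
    then show ?case using start by (simp add: P_def)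
  next
    case (Suc k)
    have "\<bar>laplace (smooth (P (Suc k))) t - laplace (smooth (P k)) t\<bar> \<le> K' * q ^ k * moment \<beta> * t powr \<beta>"
      by (rule smooth_contraction) (use P Suc \<alpha> \<beta> in \<open>auto simp: mult_ac\<close>)
    then show ?case by (simp add: P_Suc q_def mult_ac)
  qed
  have summ: "summable (\<lambda>k. K' * t powr \<beta> * q ^ k)" for t
    using q by (intro summable_mult summable_geometric) auto
  have sum_q: "(\<Sum>k. K' * t powr \<beta> * q ^ k) = K' / (1 - q) * t powr \<beta>" for t
    using q by (simp add: suminf_mult summable_geometric suminf_geometric)
  define l where "l t = lim (\<lambda>k. laplace (P k) t)" for t
  have l: "(\<lambda>k. laplace (P k) t) \<longlonglongrightarrow> l t" "\<bar>laplace P0 t - l t\<bar> \<le> K' / (1 - q) * t powr \<beta>" if t: "0 \<le> t" for t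
  proof -
    define d where "d k = laplace (P (Suc k)) t - laplace (P k) t" for k
    have abs_d: "summable (\<lambda>k. \<bar>d k\<bar>)"
      by (rule summable_comparison_test[OF _ summ]) (use step t in \<open>auto simp: d_def\<close>)
    then have "summable d" by (rule summable_rabs_cancel)
    then have "(\<lambda>m. \<Sum>k<m. d k) \<longlonglongrightarrow> suminf d" by (rule summable_LIMSEQ)
    then have "(\<lambda>m. laplace (P m) t - laplace (P 0) t) \<longlonglongrightarrow> suminf d"
      unfolding d_def by (subst (asm) sum_lessThan_telescope)
    then have "(\<lambda>m. laplace (P m) t - laplace (P 0) t + laplace (P 0) t) \<longlonglongrightarrow> suminf d + laplace (P 0) t"
      by (intro tendsto_intros)
    then have lim: "(\<lambda>m. laplace (P m) t) \<longlonglongrightarrow> suminf d + laplace P0 t" by (simp add: P_def)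
    then have l_eq: "l t = suminf d + laplace P0 t" unfolding l_def by (rule limI)
    show "(\<lambda>k. laplace (P k) t) \<longlonglongrightarrow> l t" using lim l_eq by simp
    have "\<bar>suminf d\<bar> \<le> (\<Sum>k. \<bar>d k\<bar>)" using abs_d by (rule summable_rabs)
    also have "\<dots> \<le> (\<Sum>k. K' * t powr \<beta> * q ^ k)"
      by (rule suminf_le) (use step t abs_d summ in \<open>auto simp: d_def\<close>)
    also have "\<dots> = K' / (1 - q) * t powr \<beta>" by (rule sum_q)
    finally show "\<bar>laplace P0 t - l t\<bar> \<le> K' / (1 - q) * t powr \<beta>" by (simp add: l_eq)
  qed
  obtain r \<nu> where r: "strict_mono (r :: nat \<Rightarrow> nat)" and \<nu>: "real_distribution \<nu>" "AE y in \<nu>. y \<in> {0..1}"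
    and conv: "\<And>t. 0 < t \<Longrightarrow> (\<lambda>k. laplace (P (r k)) t) \<longlonglongrightarrow> (\<integral>y. max 0 y powr t \<partial>\<nu>)"
    using laplace_convergent_subseq[of P] P by metis
  have l_\<nu>: "(\<integral>y. max 0 y powr t \<partial>\<nu>) = l t" if "0 < t" for t
    using conv[OF that] LIMSEQ_subseq_LIMSEQ[OF l(1)[of t] r] that
    by (auto simp: o_def intro: LIMSEQ_unique)
  \<comment> \<open>The distance to the transform of \<open>P0\<close> is O(t^\<beta>), and that
    transform tends to 1 at 0.\<close>
  have lim1: "(\<lambda>j. l (1 / real (Suc j))) \<longlonglongrightarrow> 1"
  proof -
    let ?x = "\<lambda>j. 1 / real (Suc j)"
    have x: "?x \<longlonglongrightarrow> 0" by (rule LIMSEQ_Suc[OF lim_1_over_n])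
    have "(\<lambda>j. ?x j powr \<beta>) \<longlonglongrightarrow> 0"
      using tendsto_powr'[OF x tendsto_const[of \<beta>]] \<alpha> \<beta> by simp
    then have "(\<lambda>j. K' / (1 - q) * ?x j powr \<beta>) \<longlonglongrightarrow> 0" by (rule tendsto_mult_right_zero)
    then have "(\<lambda>j. laplace P0 (?x j) - l (?x j)) \<longlonglongrightarrow> 0"
      by (rule Lim_null_comparison[rotated]) (use l(2) in \<open>auto simp: eventually_sequentially\<close>)
    from tendsto_diff[OF P0.laplace_tendsto_1[OF x] this] show ?thesis by simp
  qed
  have "measure \<nu> {0<..} = 1"
    using power_mean_tendsto[OF \<nu> LIMSEQ_Suc[OF lim_1_over_n]] lim1
    by (auto simp: l_\<nu> intro: LIMSEQ_unique)
  then obtain Q where Q: "nonneg_law Q" and lapQ: "\<And>t. 0 < t \<Longrightarrow> laplace Q t = (\<integral>y. max 0 y powr t \<partial>\<nu>)"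
    using laplace_of_power_mean[OF \<nu>] by metis
  interpret Q: nonneg_law Q by fact
  have lim: "(\<lambda>k. laplace (P k) t) \<longlonglongrightarrow> laplace Q t" if "0 \<le> t" for t
  proof (cases "t = 0")
    case True
    then show ?thesis by (simp add: nonneg_law.laplace_0[OF P])
  qed (use that l(1)[of t] in \<open>simp add: lapQ l_\<nu>\<close>)
  show ?thesis
  proof (rule that[OF Q])
    show "Q \<noteq> return borel 0"
    proof
      assume "Q = return borel 0"
      then have "laplace Q t = 1" for t by (simp add: laplace_def integral_return)
      then have l1: "l t = 1" if "0 < t" for t using lapQ[OF that] l_\<nu>[OF that] by simp
      \<comment> \<open>If the limit were identically 1, then A t^\<alpha> would be at most c
        t^\<beta>; dividing by t^\<alpha> and letting t tend to 0 contradicts A > 0.\<close>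
      let ?x = "\<lambda>j. 1 / real (Suc j)"
      define c where "c = K + K' / (1 - q)"
      have "A \<le> c * ?x j powr (\<beta> - \<alpha>)" for j
      proof -
        define t where "t = ?x j"
        have t: "0 < t" by (simp add: t_def)
        have "A * t powr \<alpha> \<le> K * t powr \<beta> + K' / (1 - q) * t powr \<beta>"
          using tail[of t] l(2)[of t] l1[OF t] t by (simp add: abs_le_iff)
        also have "\<dots> = c * t powr (\<beta> - \<alpha>) * t powr \<alpha>"
          by (simp add: c_def distrib_right powr_add[symmetric] mult.assoc)
        finally show ?thesis using t by (simp add: t_def)
      qed
      moreover have "(\<lambda>j. c * ?x j powr (\<beta> - \<alpha>)) \<longlonglongrightarrow> 0"
        using tendsto_powr'[OF LIMSEQ_Suc[OF lim_1_over_n] tendsto_const[of "\<beta> - \<alpha>"]] \<beta>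
        by (intro tendsto_mult_right_zero) simp
      ultimately have "A \<le> 0" by (intro LIMSEQ_le_const) auto
      with A show False by simp
    qed
    fix t :: real assume t: "0 \<le> t"
    have "(\<lambda>k. laplace (P (Suc k)) t) \<longlonglongrightarrow> (\<integral>\<omega>. (\<Prod>i<n. laplace Q (t * T i \<omega>)) \<partial>M)"
      unfolding P_Suc nonneg_law_smooth(2)[OF P t]
    proof (rule integral_dominated_convergence[where w = "\<lambda>_. 1"])
      show "AE \<omega> in M. (\<lambda>k. \<Prod>i<n. laplace (P k) (t * T i \<omega>)) \<longlonglongrightarrow> (\<Prod>i<n. laplace Q (t * T i \<omega>))"
        using T_nonneg t by (intro AE_I2 tendsto_prod lim) auto
      show "AE \<omega> in M. norm (\<Prod>i<n. laplace (P k) (t * T i \<omega>)) \<le> 1" for k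
        using T_nonneg t nonneg_law.laplace_nonneg[OF P] nonneg_law.laplace_le_1[OF P]
        by (intro AE_I2) (auto simp: abs_prod intro!: prod_le_1)
      show "(\<lambda>\<omega>. \<Prod>i<n. laplace (P k) (t * T i \<omega>)) \<in> borel_measurable M" for k
        using nonneg_law.borel_measurable_laplace[OF P] by measurable
    qed auto
    then show "laplace Q t = (\<integral>\<omega>. (\<Prod>i<n. laplace Q (t * T i \<omega>)) \<partial>M)"
      using LIMSEQ_Suc[OF lim[OF t]] by (rule LIMSEQ_unique[rotated])
  qed
qed

end

section \<open>Weights with finite offspring number\<close>

lemma (in nonneg_law) laplace_tendsto_top:
  assumes "filterlim x at_top sequentially" "\<And>k. 0 \<le> x k"
  shows "(\<lambda>k. laplace P (x k)) \<longlonglongrightarrow> prob {0}"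
proof -
  have "(\<lambda>k. laplace P (x k)) \<longlonglongrightarrow> (\<integral>y. indicator {0} y \<partial>P)"
    unfolding laplace_def
  proof (rule integral_dominated_convergence[where w = "\<lambda>_. 1"])
    show "AE y in P. (\<lambda>k. exp (- (x k * y))) \<longlonglongrightarrow> indicator {0} y"
      using nonneg
    proof eventually_elim
      case (elim y)
      show ?case
      proof (cases "y = 0")
        case False
        then have "filterlim (\<lambda>k. x k * y) at_top sequentially"
          using elim assms(1) by (intro filterlim_at_top_mult_tendsto_pos[OF tendsto_const]) auto
        then have "(\<lambda>k. exp (- (x k * y))) \<longlonglongrightarrow> 0"
          by (intro filterlim_compose[OF exp_at_bot] filterlim_compose[OF filterlim_uminus_at_bot_at_top])
        then show ?thesis using False by simp
      qed simp
    qed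
    show "AE y in P. norm (exp (- (x k * y))) \<le> 1" for k using AE_exp_le_1 assms by blast
  qed auto
  then show ?thesis by simp
qed

lemma (in nonneg_law) laplace_scaled:
  assumes "0 < s"
  shows "nonneg_law (distr P borel (\<lambda>x. s * x))"
    and "laplace (distr P borel (\<lambda>x. s * x)) t = laplace P (s * t)"
proof -
  have "AE x in distr P borel (\<lambda>x. s * x). 0 \<le> x"
    using nonneg assms by (subst AE_distr_iff) (auto elim!: eventually_mono)
  then show "nonneg_law (distr P borel (\<lambda>x. s * x))"
    unfolding nonneg_law_def nonneg_law_axioms_def by (auto intro!: real_distribution_distr)
  show "laplace (distr P borel (\<lambda>x. s * x)) t = laplace P (s * t)"
    unfolding laplace_def by (subst integral_distr) (auto simp: mult_ac)
qed

lemma prod_le_prod_subset: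
  fixes a b :: "'i \<Rightarrow> real"
  assumes "finite J" "I \<subseteq> J" "\<And>i. i \<in> J \<Longrightarrow> 0 \<le> a i" "\<And>i. i \<in> J \<Longrightarrow> a i \<le> 1"
    "\<And>i. i \<in> I \<Longrightarrow> a i \<le> b i"
  shows "prod a J \<le> prod b I"
proof -
  have "prod a J = prod a (J - I) * prod a I" using assms by (intro prod.subset_diff) auto
  also have "\<dots> \<le> 1 * prod a I" using assms by (intro mult_right_mono prod_le_1 prod_nonneg) auto
  also have "\<dots> \<le> prod b I" using assms by (auto intro!: prod_mono)
  finally show ?thesis .
qed

lemma card_Int_lessThan_le: "card ({..<n} \<inter> A) \<le> n"
  using card_mono[of "{..<n}" "{..<n} \<inter> A"] by simp

text \<open>Each of the k factors lowers the power by at least (1-s) s^n. The bound is linear in k,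
  so for a random k it involves only the mean.\<close>

lemma power_le_bernoulli:
  fixes s :: real
  assumes "0 \<le> s" "s \<le> 1" "k \<le> n"
  shows "s ^ k \<le> 1 - real k * ((1 - s) * s ^ n)"
  using assms(3)
proof (induction k)
  case (Suc k)
  have "s ^ n \<le> s ^ k" using assms Suc by (intro power_decreasing) auto
  then have "(1 - s) * s ^ n \<le> (1 - s) * s ^ k" using assms by (intro mult_left_mono) auto
  moreover have "s ^ Suc k = s ^ k - (1 - s) * s ^ k" by (simp add: algebra_simps)
  moreover have "real (Suc k) * ((1 - s) * s ^ n) = real k * ((1 - s) * s ^ n) + (1 - s) * s ^ n"
    by (simp add: algebra_simps)
  ultimately show ?case using Suc by linarith
qed simp

locale branching = M: prob_space M for M :: "'a measure" +
  fixes T :: "nat \<Rightarrow> 'a \<Rightarrow> real"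
  assumes T_measurable [measurable]: "\<And>i. T i \<in> borel_measurable M"
    and T_nonneg: "\<And>i \<omega>. \<omega> \<in> space M \<Longrightarrow> 0 \<le> T i \<omega>"
    and offspring_finite: "AE \<omega> in M. offspring_number T \<omega> < \<infinity>"
begin

lemma offspring_measurable [measurable]: "offspring_number T \<in> borel_measurable M"
  unfolding offspring_number_def[abs_def] by measurable

lemma offspring_finiteD:
  assumes "offspring_number T \<omega> < \<infinity>" "\<omega> \<in> space M"
  shows "\<exists>J. \<forall>i\<ge>J. T i \<omega> = 0"
proof -
  have "offspring_number T \<omega> = (\<integral>\<^sup>+i. indicator {i. 0 < T i \<omega>} i \<partial>count_space UNIV)"
    unfolding offspring_number_def nn_integral_count_space_nat
    by (intro suminf_cong) (simp add: indicator_def)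
  also have "\<dots> = emeasure (count_space UNIV) {i. 0 < T i \<omega>}" by simp
  finally have "finite {i. 0 < T i \<omega>}"
    using assms by (cases "finite {i. 0 < T i \<omega>}") (auto simp: emeasure_count_space_infinite)
  then obtain J where "\<And>i. 0 < T i \<omega> \<Longrightarrow> i < J"
    using finite_nat_set_iff_bounded[of "{i. 0 < T i \<omega>}"] by auto
  then show ?thesis
    using T_nonneg[OF assms(2)] by (intro exI[of _ J]) (metis less_le linorder_not_less)
qed

text \<open>Almost surely only finitely many weights are positive, so the random series is a finite
  sum and its law is a law on the half-line. Its transform is the limit of the finite products, and
  transforms determine laws.\<close>

lemma fixed_pointI:
  assumes P: "nonneg_law P"
    and eq: "\<And>t. 0 < t \<Longrightarrow> (\<lambda>j. \<integral>\<omega>. (\<Prod>i<j. laplace P (t * T i \<omega>)) \<partial>M) \<longlonglongrightarrow> laplace P t"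
  shows "P \<in> fixed_points M (\<lambda>_. 0) T"
proof -
  interpret L: nonneg_law P by fact
  let ?\<Pi> = "\<Pi>\<^sub>M i\<in>(UNIV :: nat set). P"
  interpret \<Pi>: prob_space ?\<Pi> by (intro prob_space_PiM) unfold_locales
  interpret MP: pair_prob_space M ?\<Pi> ..
  have "\<forall>\<omega>\<in>space M. \<forall>i. 0 \<le> T i \<omega>" using T_nonneg by blast
  note pair = L.prod_exp_pair[where T = T, OF M.prob_space_axioms T_measurable this]
  define Z where "Z z = (\<Sum>i. ennreal (T i (fst z) * snd z i))" for z
  have [measurable]: "Z \<in> borel_measurable (M \<Otimes>\<^sub>M ?\<Pi>)" unfolding Z_def by measurable
  have "AE z in M \<Otimes>\<^sub>M ?\<Pi>. offspring_number T (fst z) < \<infinity>"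
    by (rule MP.AE_pair_measure) (use offspring_finite in auto)
  moreover have "AE z in M \<Otimes>\<^sub>M ?\<Pi>. fst z \<in> space M" by (rule AE_I2) (auto simp: space_pair_measure)
  ultimately have finT: "AE z in M \<Otimes>\<^sub>M ?\<Pi>. \<exists>J. \<forall>i\<ge>J. T i (fst z) = 0"
    by eventually_elim (rule offspring_finiteD)
  have Z_fin: "AE z in M \<Otimes>\<^sub>M ?\<Pi>. \<exists>J. (\<forall>i\<ge>J. T i (fst z) = 0) \<and> Z z = ennreal (\<Sum>i<J. T i (fst z) * snd z i)
      \<and> 0 \<le> (\<Sum>i<J. T i (fst z) * snd z i)"
    using finT pair(1)
  proof eventually_elim
    case (elim z)
    then obtain J where J: "\<forall>i\<ge>J. T i (fst z) = 0" by blast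
    have "Z z = (\<Sum>i<J. ennreal (T i (fst z) * snd z i))"
      unfolding Z_def using J by (intro suminf_finite) auto
    moreover have "0 \<le> (\<Sum>i<J. T i (fst z) * snd z i)" using elim(2) by (intro sum_nonneg) auto
    ultimately show ?case using elim(2) J by (intro exI[of _ J]) (auto simp: sum_ennreal)
  qed
  define Q where "Q = distr (M \<Otimes>\<^sub>M ?\<Pi>) borel (\<lambda>z. enn2real (Z z))"
  have "AE x in Q. 0 \<le> x" unfolding Q_def by (subst AE_distr_iff) auto
  then have Q: "nonneg_law Q"
    unfolding nonneg_law_def nonneg_law_axioms_def Q_def by (auto intro!: MP.P.real_distribution_distr)
  have "P = Q"
  proof (rule nonneg_law_eqI[OF P Q])
    fix t :: real assume t: "0 < t"
    have "(\<lambda>j. \<integral>z. (\<Prod>i<j. exp (- (t * T i (fst z) * snd z i))) \<partial>(M \<Otimes>\<^sub>M ?\<Pi>))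
        \<longlonglongrightarrow> (\<integral>z. exp (- (t * enn2real (Z z))) \<partial>(M \<Otimes>\<^sub>M ?\<Pi>))"
    proof (rule integral_dominated_convergence[where w = "\<lambda>_. 1"])
      show "AE z in M \<Otimes>\<^sub>M ?\<Pi>. norm (\<Prod>i<j. exp (- (t * T i (fst z) * snd z i))) \<le> 1" for j
        using pair(1) by eventually_elim (use t in \<open>auto simp: abs_prod mult.assoc intro!: prod_le_1\<close>)
      show "AE z in M \<Otimes>\<^sub>M ?\<Pi>. (\<lambda>j. \<Prod>i<j. exp (- (t * T i (fst z) * snd z i))) \<longlonglongrightarrow> exp (- (t * enn2real (Z z)))"
        using Z_fin
      proof eventually_elim
        case (elim z)
        then obtain J where J: "\<forall>i\<ge>J. T i (fst z) = 0" "Z z = ennreal (\<Sum>i<J. T i (fst z) * snd z i)"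
          "0 \<le> (\<Sum>i<J. T i (fst z) * snd z i)" by blast
        have "(\<Prod>i<j. exp (- (t * T i (fst z) * snd z i))) = exp (- (t * enn2real (Z z)))" if "J \<le> j" for j
        proof -
          have "(\<Prod>i<j. exp (- (t * T i (fst z) * snd z i))) = (\<Prod>i<J. exp (- (t * T i (fst z) * snd z i)))"
            using that J(1) by (intro prod.mono_neutral_right) auto
          then show ?thesis
            using J by (simp add: exp_sum[symmetric] sum_negf sum_distrib_left mult.assoc)
        qed
        then show ?case by (intro tendsto_eventually) (auto simp: eventually_sequentially)
      qed
    qed auto
    moreover have "laplace Q t = (\<integral>z. exp (- (t * enn2real (Z z))) \<partial>(M \<Otimes>\<^sub>M ?\<Pi>))"
      unfolding laplace_def Q_def by (subst integral_distr) auto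
    ultimately have "(\<lambda>j. \<integral>\<omega>. (\<Prod>i<j. laplace P (t * T i \<omega>)) \<partial>M) \<longlonglongrightarrow> laplace Q t"
      using pair(3)[of t] t by simp
    then show "laplace P t = laplace Q t" using eq[OF t] by (intro LIMSEQ_unique)
  qed
  have "distr P borel ennreal = distr (M \<Otimes>\<^sub>M ?\<Pi>) borel (\<lambda>z. ennreal (enn2real (Z z)))"
    by (subst (1) \<open>P = Q\<close>) (simp add: Q_def distr_distr o_def)
  also have "\<dots> = distr (M \<Otimes>\<^sub>M ?\<Pi>) borel Z"
  proof (rule distr_cong_AE)
    show "AE z in M \<Otimes>\<^sub>M ?\<Pi>. ennreal (enn2real (Z z)) = Z z"
      using Z_fin by eventually_elim auto
  qed auto
  also have "\<dots> = smoothing_law M (\<lambda>_. 0) T P"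
    unfolding smoothing_law_def by (intro distr_cong) (auto simp: Z_def)
  finally show ?thesis
    using L.nonneg L.prob_space_axioms by (simp add: fixed_points_def)
qed

section \<open>Truncated weights and their generating function\<close>

text \<open>The factor below 1 makes the moment at \<kappa> strictly less than 1 even if the
  original moment equals 1; n + 2 keeps it positive for n = 0.\<close>

definition trunc :: "nat \<Rightarrow> nat \<Rightarrow> 'a \<Rightarrow> real" where
  "trunc n i \<omega> = (1 - 1 / real (n + 2)) * (if T i \<omega> \<le> n then T i \<omega> else 0)"

definition alive :: "nat \<Rightarrow> nat \<Rightarrow> 'a \<Rightarrow> bool" where
  "alive n i \<omega> \<longleftrightarrow> 0 < T i \<omega> \<and> T i \<omega> \<le> n"

lemma trunc_measurable [measurable]: "trunc n i \<in> borel_measurable M"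
  unfolding trunc_def by measurable

lemma alive_measurable [measurable]: "Measurable.pred M (alive n i)"
  unfolding alive_def by measurable

lemma trunc_bounds:
  assumes "\<omega> \<in> space M"
  shows "0 \<le> trunc n i \<omega>" "trunc n i \<omega> \<le> max 1 (real n)" "0 < trunc n i \<omega> \<longleftrightarrow> alive n i \<omega>"
proof -
  show "0 \<le> trunc n i \<omega>" using T_nonneg[OF assms] by (simp add: trunc_def)
  show "0 < trunc n i \<omega> \<longleftrightarrow> alive n i \<omega>" by (simp add: trunc_def alive_def zero_less_mult_iff)
  have "(1 - 1 / real (n + 2)) * (if T i \<omega> \<le> n then T i \<omega> else 0) \<le> 1 * real n"
    using T_nonneg[OF assms] by (intro mult_mono) auto
  also have "\<dots> \<le> max 1 (real n)" by simp
  finally show "trunc n i \<omega> \<le> max 1 (real n)" by (simp only: trunc_def)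
qed

sublocale trunc: bounded_weights M "trunc n" n "max 1 (real n)" for n
  by unfold_locales (fact trunc_measurable trunc_bounds(1,2) | simp)+

lemma trunc_powr_0:
  assumes "\<omega> \<in> space M"
  shows "trunc n i \<omega> powr 0 = of_bool (alive n i \<omega>)"
  using trunc_bounds(1,3)[OF assms, of n i] by (cases "alive n i \<omega>") (simp_all add: less_le)

lemma moment_0: "trunc.moment n 0 = (\<integral>\<omega>. (\<Sum>i<n. of_bool (alive n i \<omega>)) \<partial>M)"
  unfolding trunc.moment_def by (intro Bochner_Integration.integral_cong sum.cong refl trunc_powr_0)

lemma integrable_alive: "integrable M (\<lambda>\<omega>. \<Sum>i<n. of_bool (alive n i \<omega>) :: real)"
  by (rule M.integrable_const_bound[of _ n])
     (auto simp: card_Int_lessThan_le)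

lemma weight_moment_0: "weight_moment M T 0 = (\<integral>\<^sup>+\<omega>. offspring_number T \<omega> \<partial>M)"
  unfolding weight_moment_def offspring_number_def by (intro nn_integral_cong suminf_cong) auto

text \<open>By Fatou's lemma, truncated means that never exceed 1 would bound the mean offspring
  number by 1.\<close>

lemma exists_moment_0_gt_1:
  assumes "(\<integral>\<^sup>+\<omega>. offspring_number T \<omega> \<partial>M) > 1"
  obtains n\<^sub>0 where "1 < trunc.moment n\<^sub>0 0"
proof (rule ccontr)
  assume "\<not> thesis"
  then have le: "trunc.moment n 0 \<le> 1" for n using that[of n] by (meson not_le_imp_less)
  define g where "g k i \<omega> = (if i < k then of_bool (alive k i \<omega>) else 0 :: ennreal)" for k i \<omega>
  have [measurable]: "g k i \<in> borel_measurable M" for k i unfolding g_def by measurable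
  have "weight_moment M T 0 \<le> liminf (\<lambda>k. \<integral>\<^sup>+\<omega>. (\<Sum>i. g k i \<omega>) \<partial>M)"
  proof (rule weight_moment_le_liminf)
    fix i \<omega> assume pos: "0 < T i \<omega>"
    obtain n0 :: nat where n0: "max (real i) (T i \<omega>) < n0" using reals_Archimedean2 by blast
    have "\<forall>\<^sub>F k in sequentially. g k i \<omega> = ennreal (T i \<omega> powr 0)"
      using eventually_ge_at_top[of n0]
    proof eventually_elim
      case (elim k)
      then have "i < k" "T i \<omega> \<le> real k" using n0 by linarith+
      then show ?case using pos by (simp add: g_def alive_def)
    qed
    then show "(\<lambda>k. g k i \<omega>) \<longlonglongrightarrow> ennreal (T i \<omega> powr 0)" by (rule tendsto_eventually)
  qed measurable
  also have "\<dots> \<le> liminf (\<lambda>k. 1)"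
  proof (intro Liminf_mono always_eventually allI)
    fix k
    have "(\<Sum>i. g k i \<omega>) = ennreal (\<Sum>i<k. of_bool (alive k i \<omega>))" for \<omega>
    proof -
      have "(\<Sum>i. g k i \<omega>) = (\<Sum>i<k. g k i \<omega>)" by (rule suminf_finite) (auto simp: g_def)
      also have "\<dots> = (\<Sum>i<k. ennreal (of_bool (alive k i \<omega>)))"
        by (intro sum.cong) (auto simp: g_def)
      finally show ?thesis by (simp add: sum_ennreal)
    qed
    then have "(\<integral>\<^sup>+\<omega>. (\<Sum>i. g k i \<omega>) \<partial>M) = ennreal (trunc.moment k 0)"
      unfolding moment_0 using nn_integral_eq_integral[OF integrable_alive[of k]]
      by (simp add: sum_nonneg)
    also have "\<dots> \<le> 1" using le[of k] by simp
    finally show "(\<integral>\<^sup>+\<omega>. (\<Sum>i. g k i \<omega>) \<partial>M) \<le> 1" .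
  qed
  also have "\<dots> = 1" by (rule Liminf_const) simp
  finally show False using assms by (simp add: weight_moment_0)
qed

lemma moment_0_mono:
  assumes "n \<le> k"
  shows "trunc.moment n 0 \<le> trunc.moment k 0"
  unfolding moment_0
proof (rule integral_mono[OF integrable_alive integrable_alive])
  fix \<omega>
  have "(\<Sum>i<n. of_bool (alive n i \<omega>) :: real) \<le> (\<Sum>i<n. of_bool (alive k i \<omega>))"
    using assms by (intro sum_mono) (auto simp: alive_def)
  also have "\<dots> \<le> (\<Sum>i<k. of_bool (alive k i \<omega>))" using assms by (intro sum_mono2) auto
  finally show "(\<Sum>i<n. of_bool (alive n i \<omega>) :: real) \<le> \<dots>" .
qed

text \<open>The scaling factor \<rho> < 1 comes out as \<rho>^\<kappa>, which is below 1 because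
  \<kappa> > 0, and the truncation leaves a sum with mean at most 1.\<close>

lemma moment_less_1:
  assumes "0 < \<kappa>" "weight_moment M T \<kappa> \<le> 1"
  shows "trunc.moment n \<kappa> < 1"
proof -
  define \<rho> where "\<rho> = 1 - 1 / real (n + 2)"
  have \<rho>: "0 < \<rho>" "\<rho> < 1" by (auto simp: \<rho>_def)
  define f where "f \<omega> = (\<Sum>i<n. (if T i \<omega> \<le> n then T i \<omega> else 0) powr \<kappa>)" for \<omega>
  have [measurable]: "f \<in> borel_measurable M" unfolding f_def by measurable
  have "trunc.moment n \<kappa> = \<rho> powr \<kappa> * (\<integral>\<omega>. f \<omega> \<partial>M)"
  proof -
    have "trunc.moment n \<kappa> = (\<integral>\<omega>. \<rho> powr \<kappa> * f \<omega> \<partial>M)"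
      unfolding trunc.moment_def
    proof (rule Bochner_Integration.integral_cong[OF refl])
      fix \<omega> assume "\<omega> \<in> space M"
      then show "(\<Sum>i<n. trunc n i \<omega> powr \<kappa>) = \<rho> powr \<kappa> * f \<omega>"
        using T_nonneg \<rho> unfolding trunc_def f_def sum_distrib_left \<rho>_def[symmetric]
        by (intro sum.cong refl powr_mult)
    qed
    then show ?thesis by simp
  qed
  also have "(\<integral>\<omega>. f \<omega> \<partial>M) \<le> 1"
  proof -
    have "(\<integral>\<omega>. f \<omega> \<partial>M) = enn2real (\<integral>\<^sup>+\<omega>. ennreal (f \<omega>) \<partial>M)"
      by (rule integral_eq_nn_integral) (auto simp: f_def sum_nonneg)
    moreover have "(\<integral>\<^sup>+\<omega>. ennreal (f \<omega>) \<partial>M) \<le> weight_moment M T \<kappa>"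
      unfolding weight_moment_def
    proof (rule nn_integral_mono)
      fix \<omega> assume w: "\<omega> \<in> space M"
      have "ennreal (f \<omega>) = (\<Sum>i<n. ennreal ((if T i \<omega> \<le> n then T i \<omega> else 0) powr \<kappa>))"
        by (simp add: f_def sum_ennreal)
      also have "\<dots> \<le> (\<Sum>i<n. if T i \<omega> > 0 then ennreal (T i \<omega> powr \<kappa>) else 0)"
        using T_nonneg[OF w] by (intro sum_mono) (auto simp: less_le)
      also have "\<dots> \<le> (\<Sum>i. if T i \<omega> > 0 then ennreal (T i \<omega> powr \<kappa>) else 0)"
        by (rule sum_le_suminf) auto
      finally show "ennreal (f \<omega>) \<le> \<dots>" .
    qed
    ultimately show ?thesis
      using assms(2) enn2real_mono[of "\<integral>\<^sup>+\<omega>. ennreal (f \<omega>) \<partial>M" 1] by simp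
  qed
  then have "\<rho> powr \<kappa> * (\<integral>\<omega>. f \<omega> \<partial>M) \<le> \<rho> powr \<kappa> * 1" by (intro mult_left_mono) auto
  also have "\<rho> powr \<kappa> * 1 < 1" using powr_less_mono2[of \<kappa> \<rho> 1] \<rho> assms by simp
  finally show ?thesis .
qed

text \<open>The probability generating function of the number of alive weights among the first n,
  written as a product to match products of transforms factor by factor.\<close>

definition genfun :: "nat \<Rightarrow> real \<Rightarrow> real" where
  "genfun n s = (\<integral>\<omega>. (\<Prod>i<n. if alive n i \<omega> then s else 1) \<partial>M)"

text \<open>By \<open>power_le_bernoulli\<close> the generating function is at most 1 - m (1-s) s^n
  with m the mean, and this is below s as soon as m s^n > 1; c is chosen with c^n > 1/m.\<close>

lemma genfun_less:
  assumes "1 < trunc.moment n 0"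
  obtains c where "0 < c" "c < 1" "\<And>s. c \<le> s \<Longrightarrow> s < 1 \<Longrightarrow> genfun n s < s"
proof -
  let ?m = "trunc.moment n 0"
  have "(\<lambda>k. (1 - 1 / real (Suc k)) ^ n) \<longlonglongrightarrow> (1 - 0) ^ n"
    by (intro tendsto_intros LIMSEQ_Suc[OF lim_1_over_n])
  then have "\<forall>\<^sub>F k in sequentially. 1 / ?m < (1 - 1 / real (Suc k)) ^ n"
    using assms by (intro order_tendstoD) auto
  \<comment> \<open>For k = 0 the point c would be 0, so \<open>1 \<le> k\<close> is imposed to have
    c > 0.\<close>
  then have "\<forall>\<^sub>F k in sequentially. 1 / ?m < (1 - 1 / real (Suc k)) ^ n \<and> 1 \<le> k"
    using eventually_ge_at_top by eventually_elim auto
  then obtain k where k: "1 / ?m < (1 - 1 / real (Suc k)) ^ n" "1 \<le> k"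
    by (auto simp: eventually_sequentially)
  define c where "c = 1 - 1 / real (Suc k)"
  show ?thesis
  proof (rule that[of c])
    show c: "0 < c" "c < 1" using k by (auto simp: c_def)
    fix s assume s: "c \<le> s" "s < 1"
    define a where "a = (1 - s) * s ^ n"
    have pt: "(\<Prod>i<n. if alive n i \<omega> then s else 1) \<le> 1 - (\<Sum>i<n. of_bool (alive n i \<omega>)) * a" for \<omega>
    proof -
      let ?I = "{..<n} \<inter> {i. alive n i \<omega>}"
      have "s ^ card ?I \<le> 1 - real (card ?I) * a"
        unfolding a_def using s c by (intro power_le_bernoulli card_Int_lessThan_le) auto
      moreover have "(\<Prod>i<n. if alive n i \<omega> then s else 1) = s ^ card ?I"
        by (simp add: prod.If_cases)
      moreover have "(\<Sum>i<n. of_bool (alive n i \<omega>) :: real) = card ?I"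
        by (simp add: sum_of_bool_eq)
      ultimately show ?thesis by simp
    qed
    have "genfun n s \<le> (\<integral>\<omega>. 1 - (\<Sum>i<n. of_bool (alive n i \<omega>)) * a \<partial>M)"
      unfolding genfun_def
    proof (rule integral_mono)
      show "integrable M (\<lambda>\<omega>. \<Prod>i<n. if alive n i \<omega> then s else 1)"
        by (rule M.integrable_const_bound[of _ 1])
           (use s c in \<open>auto simp: abs_prod intro!: prod_le_1 AE_I2\<close>)
    qed (use integrable_alive pt in auto)
    also have "\<dots> = 1 - ?m * a"
      using integrable_alive[of n] by (simp add: M.prob_space moment_0)
    also have "\<dots> < s"
    proof -
      have "c ^ n \<le> s ^ n" using c s by (intro power_mono) auto
      then have "1 / ?m < s ^ n" using k by (simp add: c_def)
      then have "1 < ?m * s ^ n" using assms by (simp add: field_simps)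
      then have "(1 - s) * 1 < (1 - s) * (?m * s ^ n)" using s by (intro mult_strict_left_mono) auto
      then show ?thesis by (simp add: a_def mult_ac)
    qed
    finally show "genfun n s < s" .
  qed
qed

text \<open>Used at both ends of the half-line: with arguments tending to infinity, where p is the
  atom of a law at 0, and with arguments tending to 0, where p is the limit of \<Phi> at 0+.\<close>

lemma genfun_limit:
  assumes f: "\<And>t. 0 < t \<Longrightarrow> 0 \<le> f t" "\<And>t. 0 < t \<Longrightarrow> f t \<le> 1"
    and [measurable]: "f \<in> borel_measurable borel"
    and y: "\<And>k i \<omega>. \<omega> \<in> space M \<Longrightarrow> alive n i \<omega> \<Longrightarrow> 0 < y k i \<omega>" "\<And>k i. y k i \<in> borel_measurable M"
    and lim: "\<And>i \<omega>. \<omega> \<in> space M \<Longrightarrow> alive n i \<omega> \<Longrightarrow> (\<lambda>k. f (y k i \<omega>)) \<longlonglongrightarrow> p"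
  shows "(\<lambda>k. \<integral>\<omega>. (\<Prod>i<n. if alive n i \<omega> then f (y k i \<omega>) else 1) \<partial>M) \<longlonglongrightarrow> genfun n p"
  unfolding genfun_def
proof (rule integral_dominated_convergence[where w = "\<lambda>_. 1"])
  note [measurable] = y(2)
  show "AE \<omega> in M. (\<lambda>k. \<Prod>i<n. if alive n i \<omega> then f (y k i \<omega>) else 1) \<longlonglongrightarrow>
      (\<Prod>i<n. if alive n i \<omega> then p else 1)"
    using lim by (intro AE_I2 tendsto_prod) auto
  show "AE \<omega> in M. norm (\<Prod>i<n. if alive n i \<omega> then f (y k i \<omega>) else 1) \<le> 1" for k
    using f y by (intro AE_I2) (auto simp: abs_prod intro!: prod_le_1)
  show "(\<lambda>\<omega>. \<Prod>i<n. if alive n i \<omega> then f (y k i \<omega>) else 1) \<in> borel_measurable M" for k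
    by measurable
qed auto

end

section \<open>Normalised fixed points and passage to the limit in the truncation\<close>

context branching begin

lemma prod_trunc_le:
  assumes f: "\<And>x. 0 \<le> x \<Longrightarrow> 0 \<le> f x" "\<And>x. 0 \<le> x \<Longrightarrow> f x \<le> (1::real)"
    and "k \<le> n" "0 \<le> t" "\<omega> \<in> space M"
  shows "(\<Prod>i<n. f (t * trunc n i \<omega>)) \<le> (\<Prod>i<k. if alive k i \<omega> then f (t * trunc n i \<omega>) else 1)"
  using assms trunc_bounds(1)[OF assms(5)] by (intro prod_le_prod_subset) auto

text \<open>Letting t tend to infinity in the equation, the atom p of the fixed point at 0 satisfies
  p <= \<open>genfun\<close> at p. As p < 1, the choice of c forces p < c, so the transform falls
  below c, attains c at some s > 0 by continuity, and scaling by s moves this point to 1.\<close>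

lemma normalised_fixed_point:
  assumes \<kappa>: "0 < \<kappa>" "\<kappa> \<le> 1" "weight_moment M T \<kappa> \<le> 1"
    and n: "n\<^sub>0 \<le> n" "1 < trunc.moment n\<^sub>0 0"
    and c: "0 < c" "c < 1" "\<And>s. c \<le> s \<Longrightarrow> s < 1 \<Longrightarrow> genfun n\<^sub>0 s < s"
  obtains Q where "nonneg_law Q" "laplace Q 1 = c"
    "\<And>t. 0 \<le> t \<Longrightarrow> laplace Q t = (\<integral>\<omega>. (\<Prod>i<n. laplace Q (t * trunc n i \<omega>)) \<partial>M)"
proof -
  have "1 < trunc.moment n 0" using moment_0_mono[OF n(1)] n(2) by simp
  then obtain P where P: "nonneg_law P" "P \<noteq> return borel 0"
    and eq: "\<And>t. 0 \<le> t \<Longrightarrow> laplace P t = (\<integral>\<omega>. (\<Prod>i<n. laplace P (t * trunc n i \<omega>)) \<partial>M)"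
    using trunc.exists_fixed_point[OF _ \<kappa>(1,2) moment_less_1[OF \<kappa>(1,3)], of n] by metis
  interpret P: nonneg_law P by fact
  define p where "p = P.prob {0}"
  define x where "x k = real (Suc k)" for k
  have x: "1 \<le> x k" for k by (simp add: x_def)
  have x_top: "filterlim x at_top sequentially"
    unfolding x_def[abs_def] by (rule filterlim_compose[OF filterlim_real_sequentially filterlim_Suc])
  have lim: "(\<lambda>k. laplace P (x k)) \<longlonglongrightarrow> p"
    unfolding p_def by (rule P.laplace_tendsto_top[OF x_top]) (simp add: x_def)
  have pos: "0 < trunc n i \<omega>" if "\<omega> \<in> space M" "alive n\<^sub>0 i \<omega>" for i \<omega>
    using that n trunc_bounds(3)[of \<omega> n i] by (auto simp: alive_def)
  have "(\<lambda>k. \<integral>\<omega>. (\<Prod>i<n\<^sub>0. if alive n\<^sub>0 i \<omega> then laplace P (x k * trunc n i \<omega>) else 1) \<partial>M) \<longlonglongrightarrow> genfun n\<^sub>0 p"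
  proof (rule genfun_limit[where f = "laplace P" and y = "\<lambda>k i \<omega>. x k * trunc n i \<omega>"])
    fix i \<omega> assume w: "\<omega> \<in> space M" "alive n\<^sub>0 i \<omega>"
    have "filterlim (\<lambda>k. x k * trunc n i \<omega>) at_top sequentially"
      using pos[OF w] x_top filterlim_at_top_mult_tendsto_pos[OF tendsto_const] by blast
    then show "(\<lambda>k. laplace P (x k * trunc n i \<omega>)) \<longlonglongrightarrow> p"
      unfolding p_def using pos[OF w] x by (intro P.laplace_tendsto_top) (auto simp: x_def)
    show "0 < x k * trunc n i \<omega>" for k using pos[OF w] by (simp add: x_def)
  qed (auto simp: P.laplace_nonneg P.laplace_le_1)
  moreover have "laplace P (x k) \<le> (\<integral>\<omega>. (\<Prod>i<n\<^sub>0. if alive n\<^sub>0 i \<omega> then laplace P (x k * trunc n i \<omega>) else 1) \<partial>M)" for k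
  proof -
    have xk: "0 \<le> x k" by (simp add: x_def)
    show ?thesis
      unfolding eq[OF xk]
    proof (rule integral_mono)
      show "integrable M (\<lambda>\<omega>. \<Prod>i<n. laplace P (x k * trunc n i \<omega>))"
        by (rule trunc.integrable_prod_laplace[OF P(1) xk])
      show "integrable M (\<lambda>\<omega>. \<Prod>i<n\<^sub>0. if alive n\<^sub>0 i \<omega> then laplace P (x k * trunc n i \<omega>) else 1)"
      proof (rule M.integrable_const_bound[of _ 1])
        show "AE \<omega> in M. norm (\<Prod>i<n\<^sub>0. if alive n\<^sub>0 i \<omega> then laplace P (x k * trunc n i \<omega>) else 1) \<le> 1"
          using xk trunc_bounds(1) P.laplace_nonneg P.laplace_le_1
          by (intro AE_I2) (auto simp: abs_prod intro!: prod_le_1)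
      qed measurable
    qed (rule prod_trunc_le, use P.laplace_nonneg P.laplace_le_1 n xk in auto)
  qed
  ultimately have "p \<le> genfun n\<^sub>0 p"
    using lim by (intro LIMSEQ_le) auto
  moreover have "p \<le> laplace P 1"
    using lim P.laplace_antimono[of 1] x by (intro LIMSEQ_le_const2) auto
  then have "p < 1" using P.laplace_less_1[OF P(2), of 1] by simp
  ultimately have "p < c" using c(3)[of p] by force
  then have "\<forall>\<^sub>F k in sequentially. laplace P (x k) < c" using lim by (intro order_tendstoD) auto
  then obtain k where k: "laplace P (x k) < c" by (auto simp: eventually_sequentially)
  have xk: "0 \<le> x k" by (simp add: x_def)
  obtain s where s: "0 \<le> s" "s \<le> x k" "laplace P s = c"
    using IVT2'[of "laplace P" "x k" c 0] k c xk continuous_on_subset[OF P.continuous_laplace, of "{0..x k}"]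
    by auto
  have s0: "0 < s" using s c by (cases "s = 0") auto
  note Q = P.laplace_scaled[OF s0]
  show ?thesis
  proof (rule that[OF Q(1)])
    show "laplace (distr P borel ((*) s)) 1 = c" using s by (simp add: Q(2))
    fix t :: real assume "0 \<le> t"
    then show "laplace (distr P borel ((*) s)) t = (\<integral>\<omega>. (\<Prod>i<n. laplace (distr P borel ((*) s)) (t * trunc n i \<omega>)) \<partial>M)"
      using eq[of "s * t"] s0 by (simp add: Q(2) mult.assoc)
  qed
qed

lemma trunc_eq: "T i \<omega> \<le> n \<Longrightarrow> trunc n i \<omega> = (1 - 1 / real (n + 2)) * T i \<omega>"
  by (simp add: trunc_def)

text \<open>All truncation levels are at least \<open>n\<^sub>0\<close>, so a single generating
  function and a single c serve every approximating fixed point.\<close>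

theorem exists_nontrivial_fixed_point:
  assumes mean: "(\<integral>\<^sup>+\<omega>. offspring_number T \<omega> \<partial>M) > 1"
    and inf: "(INF \<theta>\<in>{0..1}. weight_moment M T \<theta>) \<le> 1"
  obtains P where "P \<in> fixed_points M (\<lambda>_. 0) T" "P \<noteq> return borel 0"
proof -
  obtain \<kappa> where \<kappa>: "\<kappa> \<in> {0..1}" "weight_moment M T \<kappa> \<le> 1"
    using weight_moment_attained[OF T_measurable inf] by blast
  \<comment> \<open>At 0 the moment is the mean offspring number, which exceeds 1.\<close>
  then have "\<kappa> \<noteq> 0" using mean by (auto simp: weight_moment_0)
  with \<kappa> have \<kappa>01: "0 < \<kappa>" "\<kappa> \<le> 1" by auto
  obtain n\<^sub>0 where n0: "1 < trunc.moment n\<^sub>0 0" using exists_moment_0_gt_1[OF mean] by blast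
  obtain c where c: "0 < c" "c < 1" "\<And>s. c \<le> s \<Longrightarrow> s < 1 \<Longrightarrow> genfun n\<^sub>0 s < s"
    using genfun_less[OF n0] by blast
  have "\<exists>Q. nonneg_law Q \<and> laplace Q 1 = c \<and>
      (\<forall>t\<ge>0. laplace Q t = (\<integral>\<omega>. (\<Prod>i<n\<^sub>0 + k. laplace Q (t * trunc (n\<^sub>0 + k) i \<omega>)) \<partial>M))" for k
    using normalised_fixed_point[OF \<kappa>01 \<kappa>(2) le_add1 n0 c] by metis
  then obtain Q where Q: "\<And>k. nonneg_law (Q k)" and Q1: "\<And>k. laplace (Q k) 1 = c"
    and Qeq: "\<And>k t. 0 \<le> t \<Longrightarrow>
      laplace (Q k) t = (\<integral>\<omega>. (\<Prod>i<n\<^sub>0 + k. laplace (Q k) (t * trunc (n\<^sub>0 + k) i \<omega>)) \<partial>M)"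
    by metis
  obtain r \<nu> where r: "strict_mono (r :: nat \<Rightarrow> nat)" and \<nu>: "real_distribution \<nu>" "AE y in \<nu>. y \<in> {0..1}"
    and conv0: "\<And>t. 0 < t \<Longrightarrow> (\<lambda>k. laplace (Q (r k)) t) \<longlonglongrightarrow> (\<integral>y. max 0 y powr t \<partial>\<nu>)"
    using laplace_convergent_subseq[of Q] Q by metis
  interpret \<nu>: real_distribution \<nu> by fact
  define N where "N k = n\<^sub>0 + r k" for k
  define \<phi> where "\<phi> k = laplace (Q (r k))" for k
  define \<Phi> where "\<Phi> t = (\<integral>y. max 0 y powr t \<partial>\<nu>)" for t
  \<comment> \<open>The formula for \<Phi> at 0 gives the mass of \<nu> on the positive half-line,
    not yet known to be 1; vanishing weights must contribute the factor 1.\<close>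
  define \<Psi> where "\<Psi> t = (if t = 0 then 1 else \<Phi> t)" for t
  have [measurable]: "\<Phi> \<in> borel_measurable borel" unfolding \<Phi>_def by measurable
  have [measurable]: "\<Psi> \<in> borel_measurable borel" unfolding \<Psi>_def by measurable
  have [measurable]: "\<phi> k \<in> borel_measurable borel" for k
    unfolding \<phi>_def by (rule nonneg_law.borel_measurable_laplace[OF Q])
  have \<phi>: "0 \<le> \<phi> k t" "\<phi> k t \<le> 1" if "0 \<le> t" for k t
    using nonneg_law.laplace_nonneg[OF Q] nonneg_law.laplace_le_1[OF Q that] by (auto simp: \<phi>_def)
  have \<phi>0: "\<phi> k 0 = 1" for k by (simp add: \<phi>_def nonneg_law.laplace_0[OF Q])
  have conv: "(\<lambda>k. \<phi> k t) \<longlonglongrightarrow> \<Phi> t" if "0 < t" for t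
    using conv0[OF that] by (simp add: \<phi>_def \<Phi>_def)
  have \<Phi>: "0 \<le> \<Phi> t" "\<Phi> t \<le> 1" if "0 < t" for t
    by (rule LIMSEQ_le_const[OF conv[OF that]] LIMSEQ_le_const2[OF conv[OF that]],
        use \<phi> that in \<open>simp add: less_imp_le\<close>)+
  have \<Psi>: "0 \<le> \<Psi> t" "\<Psi> t \<le> 1" if "0 \<le> t" for t
    using \<Phi>[of t] that by (auto simp: \<Psi>_def)
  have N_ge: "k \<le> N k" for k using seq_suble[OF r, of k] by (simp add: N_def)
  define \<rho> where "\<rho> k = 1 - 1 / real (N k + 2)" for k
  have \<rho>: "0 \<le> \<rho> k" "\<rho> k \<le> 1" for k by (auto simp: \<rho>_def)
  have \<rho>_lim: "\<rho> \<longlonglongrightarrow> 1"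
  proof -
    have "(\<lambda>k. 1 - 1 / real (Suc k)) \<longlonglongrightarrow> 1 - 0"
      by (intro tendsto_intros LIMSEQ_Suc[OF lim_1_over_n])
    then have lower: "(\<lambda>k. 1 - 1 / real (Suc k)) \<longlonglongrightarrow> 1" by simp
    have "1 / real (N k + 2) \<le> 1 / real (Suc k)" for k
      using N_ge[of k] by (intro divide_left_mono) auto
    then have "1 - 1 / real (Suc k) \<le> \<rho> k" for k unfolding \<rho>_def by (intro diff_left_mono)
    then show ?thesis
      using \<rho>(2) by (intro tendsto_sandwich[OF _ _ lower tendsto_const] always_eventually allI)
  qed
  \<comment> \<open>The argument moves with k, but \<open>laplace_scale\<close> and monotonicity
    bound the change of the transform by 1 - \<open>\<rho> k\<close> uniformly, so pointwise
    convergence suffices.\<close>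
  have conv_\<rho>: "(\<lambda>k. \<phi> k (\<rho> k * s)) \<longlonglongrightarrow> \<Psi> s" if s: "0 \<le> s" for s
  proof (cases "s = 0")
    case False
    have diff: "\<bar>\<phi> k (\<rho> k * s) - \<phi> k s\<bar> \<le> 1 - \<rho> k" for k
    proof -
      interpret Qk: nonneg_law "Q (r k)" by (rule Q)
      have 1: "\<rho> k * (1 - \<phi> k s) \<le> 1 - \<phi> k (\<rho> k * s)"
        unfolding \<phi>_def using \<rho> s by (intro Qk.laplace_scale) auto
      have 2: "\<phi> k s \<le> \<phi> k (\<rho> k * s)"
        unfolding \<phi>_def using \<rho>[of k] s by (intro Qk.laplace_antimono) (auto simp: mult_left_le_one_le)
      have "\<bar>d - b\<bar> \<le> 1 - a"
        if "a * (1 - b) \<le> 1 - d" "b \<le> d" "0 \<le> b" "a \<le> 1" for a b d :: real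
      proof -
        have "0 \<le> (1 - a) * b" using that(3,4) by simp
        then have "a * b \<le> b" by (simp add: left_diff_distrib)
        moreover have "a - a * b \<le> 1 - d" using that(1) by (simp add: right_diff_distrib)
        ultimately show ?thesis using that(2,4) by (intro abs_leI) linarith+
      qed
      from this[OF 1 2 \<phi>(1)[OF s] \<rho>(2)] show ?thesis .
    qed
    have "(\<lambda>k. 1 - \<rho> k) \<longlonglongrightarrow> 0"
      using tendsto_diff[OF tendsto_const[of 1] \<rho>_lim] by simp
    then have "(\<lambda>k. \<phi> k (\<rho> k * s) - \<phi> k s) \<longlonglongrightarrow> 0"
      by (rule Lim_null_comparison[rotated]) (use diff in \<open>simp only: real_norm_def eventually_True\<close>)
    moreover have "(\<lambda>k. \<phi> k s) \<longlonglongrightarrow> \<Phi> s" using False s by (intro conv) simp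
    ultimately have "(\<lambda>k. \<phi> k (\<rho> k * s) - \<phi> k s + \<phi> k s) \<longlonglongrightarrow> 0 + \<Phi> s" by (rule tendsto_add)
    then show ?thesis using False by (simp add: \<Psi>_def)
  qed (simp add: \<phi>0 \<Psi>_def)
  have eq: "(\<lambda>j. \<integral>\<omega>. (\<Prod>i<j. \<Psi> (t * T i \<omega>)) \<partial>M) \<longlonglongrightarrow> \<Phi> t" if t: "0 < t" for t
  proof -
    \<comment> \<open>The infinite product, almost surely a finite one. Both the truncated equations
      and the partial products converge to its integral.\<close>
    define L where "L \<omega> = lim (\<lambda>j. \<Prod>i<j. \<Psi> (t * T i \<omega>))" for \<omega>
    have [measurable]: "L \<in> borel_measurable M" unfolding L_def by measurable
    have stop: "(\<lambda>j. \<Prod>i<j. \<Psi> (t * T i \<omega>)) \<longlonglongrightarrow> (\<Prod>i<J. \<Psi> (t * T i \<omega>))" if "\<forall>i\<ge>J. T i \<omega> = 0" for J \<omega>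
    proof -
      have "(\<Prod>i<j. \<Psi> (t * T i \<omega>)) = (\<Prod>i<J. \<Psi> (t * T i \<omega>))" if "J \<le> j" for j
        using that \<open>\<forall>i\<ge>J. T i \<omega> = 0\<close> by (intro prod.mono_neutral_right) (auto simp: \<Psi>_def)
      then show ?thesis
        by (intro tendsto_eventually eventually_mono[OF eventually_ge_at_top[of J]])
    qed
    have L: "L \<omega> = (\<Prod>i<J. \<Psi> (t * T i \<omega>))" if "\<forall>i\<ge>J. T i \<omega> = 0" for J \<omega>
      unfolding L_def using stop[OF that] by (rule limI)
    have space: "AE \<omega> in M. \<omega> \<in> space M" by simp
    have lim_L: "(\<lambda>j. \<integral>\<omega>. (\<Prod>i<j. \<Psi> (t * T i \<omega>)) \<partial>M) \<longlonglongrightarrow> (\<integral>\<omega>. L \<omega> \<partial>M)"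
    proof (rule integral_dominated_convergence[where w = "\<lambda>_. 1"])
      show "AE \<omega> in M. (\<lambda>j. \<Prod>i<j. \<Psi> (t * T i \<omega>)) \<longlonglongrightarrow> L \<omega>"
        using offspring_finite space
      proof eventually_elim
        case (elim \<omega>)
        obtain J where J: "\<forall>i\<ge>J. T i \<omega> = 0" using offspring_finiteD[OF elim] ..
        show ?case unfolding L[OF J] by (rule stop[OF J])
      qed
      show "AE \<omega> in M. norm (\<Prod>i<j. \<Psi> (t * T i \<omega>)) \<le> 1" for j
        using T_nonneg t \<Psi> by (intro AE_I2) (auto simp: abs_prod intro!: prod_le_1)
    qed auto
    have "(\<lambda>k. \<integral>\<omega>. (\<Prod>i<N k. \<phi> k (t * trunc (N k) i \<omega>)) \<partial>M) \<longlonglongrightarrow> (\<integral>\<omega>. L \<omega> \<partial>M)"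
    proof (rule integral_dominated_convergence[where w = "\<lambda>_. 1"])
      show "AE \<omega> in M. norm (\<Prod>i<N k. \<phi> k (t * trunc (N k) i \<omega>)) \<le> 1" for k
        using trunc_bounds(1) t \<phi> by (intro AE_I2) (auto simp: abs_prod intro!: prod_le_1)
      show "AE \<omega> in M. (\<lambda>k. \<Prod>i<N k. \<phi> k (t * trunc (N k) i \<omega>)) \<longlonglongrightarrow> L \<omega>"
        using offspring_finite space
      proof eventually_elim
        case (elim \<omega>)
        obtain J where J: "\<forall>i\<ge>J. T i \<omega> = 0" using offspring_finiteD[OF elim] ..
        define B where "B = (\<Sum>i<J. T i \<omega>)"
        have B: "T i \<omega> \<le> B" for i
        proof (cases "i < J")
          case True
          then show ?thesis unfolding B_def using T_nonneg[OF elim(2)] by (intro member_le_sum) auto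
        qed (use J T_nonneg[OF elim(2)] in \<open>auto simp: B_def sum_nonneg\<close>)
        \<comment> \<open>From \<open>k0\<close> on the level \<open>N k\<close> exceeds J and all
          weights at \<omega>, so the truncation only multiplies them by
          \<open>\<rho> k\<close>.\<close>
        obtain k0 :: nat where k0: "max (real J) B < k0" using reals_Archimedean2 by blast
        have "(\<lambda>k. \<Prod>i<J. \<phi> k (\<rho> k * (t * T i \<omega>))) \<longlonglongrightarrow> (\<Prod>i<J. \<Psi> (t * T i \<omega>))"
          using T_nonneg[OF elim(2)] t by (intro tendsto_prod conv_\<rho>) auto
        moreover have "\<forall>\<^sub>F k in sequentially. (\<Prod>i<J. \<phi> k (\<rho> k * (t * T i \<omega>))) = (\<Prod>i<N k. \<phi> k (t * trunc (N k) i \<omega>))"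
          using eventually_ge_at_top[of k0]
        proof eventually_elim
          case (elim k)
          have JN: "J \<le> N k" and le: "T i \<omega> \<le> N k" for i
            using elim k0 N_ge[of k] B[of i] by linarith+
          have "(\<Prod>i<N k. \<phi> k (t * trunc (N k) i \<omega>)) = (\<Prod>i<N k. \<phi> k (\<rho> k * (t * T i \<omega>)))"
            using trunc_eq[OF le] by (simp add: \<rho>_def mult_ac)
          also have "\<dots> = (\<Prod>i<J. \<phi> k (\<rho> k * (t * T i \<omega>)))"
            using JN J by (intro prod.mono_neutral_right) (auto simp: \<phi>0)
          finally show ?case ..
        qed
        ultimately show ?case unfolding L[OF J] by (rule Lim_transform_eventually)
      qed
    qed auto
    moreover have "\<phi> k t = (\<integral>\<omega>. (\<Prod>i<N k. \<phi> k (t * trunc (N k) i \<omega>)) \<partial>M)" for k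
      unfolding \<phi>_def N_def by (rule Qeq[OF less_imp_le[OF t]])
    ultimately have "(\<lambda>k. \<phi> k t) \<longlonglongrightarrow> (\<integral>\<omega>. L \<omega> \<partial>M)" by (simp only:)
    then have "(\<integral>\<omega>. L \<omega> \<partial>M) = \<Phi> t" using conv[OF t] by (rule LIMSEQ_unique)
    with lim_L show ?thesis by (simp only:)
  qed
  \<comment> \<open>The limit of \<Phi> at 0+, that is, the mass retained in the limit.\<close>
  define \<Gamma> where "\<Gamma> = measure \<nu> {0<..}"
  define x where "x j = 1 / real (Suc j)" for j
  have x: "0 < x j" "x j \<le> 1" for j by (auto simp: x_def)
  have x_lim: "x \<longlonglongrightarrow> 0" unfolding x_def[abs_def] by (rule LIMSEQ_Suc[OF lim_1_over_n])
  have \<Phi>_lim: "(\<lambda>j. \<Phi> (x j * s)) \<longlonglongrightarrow> \<Gamma>" if "0 < s" for s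
    unfolding \<Phi>_def \<Gamma>_def using x x_lim that
    by (intro power_mean_tendsto[OF \<nu>]) (auto intro: tendsto_mult_left_zero)
  \<comment> \<open>The transforms decrease and equal c at 1, so they are at least c at every
    \<open>x j\<close>.\<close>
  have "c \<le> \<Gamma>"
  proof (rule LIMSEQ_le_const)
    show "(\<lambda>j. \<Phi> (x j)) \<longlonglongrightarrow> \<Gamma>" using \<Phi>_lim[of 1] by simp
    have "c \<le> \<Phi> (x j)" for j
    proof (rule LIMSEQ_le_const[OF conv[OF x(1)]])
      have "c \<le> \<phi> k (x j)" for k
        using nonneg_law.laplace_antimono[OF Q, of "x j" 1 "r k"] x[of j] Q1[of "r k"] by (simp add: \<phi>_def)
      then show "\<exists>m. \<forall>k\<ge>m. c \<le> \<phi> k (x j)" by blast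
    qed
    then show "\<exists>m. \<forall>j\<ge>m. c \<le> \<Phi> (x j)" by blast
  qed
  \<comment> \<open>In the limit equation all factors except those of alive weights among the first
    \<open>n\<^sub>0\<close> are bounded by 1; then t tends to 0.\<close>
  moreover have "\<Gamma> \<le> genfun n\<^sub>0 \<Gamma>"
  proof (rule LIMSEQ_le)
    show "(\<lambda>j. \<Phi> (x j)) \<longlonglongrightarrow> \<Gamma>" using \<Phi>_lim[of 1] by simp
    show "(\<lambda>j. \<integral>\<omega>. (\<Prod>i<n\<^sub>0. if alive n\<^sub>0 i \<omega> then \<Phi> (x j * T i \<omega>) else 1) \<partial>M) \<longlonglongrightarrow> genfun n\<^sub>0 \<Gamma>"
      by (rule genfun_limit[where f = \<Phi> and y = "\<lambda>j i \<omega>. x j * T i \<omega>"])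
         (use x \<Phi> \<Phi>_lim in \<open>auto simp: alive_def\<close>)
    have "\<Phi> (x j) \<le> (\<integral>\<omega>. (\<Prod>i<n\<^sub>0. if alive n\<^sub>0 i \<omega> then \<Phi> (x j * T i \<omega>) else 1) \<partial>M)" for j
    proof -
      have nn: "0 \<le> x j * T i \<omega>" if "\<omega> \<in> space M" for i \<omega> using T_nonneg[OF that] x[of j] by simp
      have int: "integrable M (\<lambda>\<omega>. \<Prod>i<m. \<Psi> (x j * T i \<omega>))" for m
      proof (rule M.integrable_const_bound[of _ 1])
        show "AE \<omega> in M. norm (\<Prod>i<m. \<Psi> (x j * T i \<omega>)) \<le> 1"
          using nn \<Psi> by (intro AE_I2) (auto simp: abs_prod intro!: prod_le_1)
      qed measurable
      \<comment> \<open>The integrals of the partial products decrease, so their limit \<Phi> lies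
        below the one with \<open>n\<^sub>0\<close> factors.\<close>
      have "decseq (\<lambda>m. \<integral>\<omega>. (\<Prod>i<m. \<Psi> (x j * T i \<omega>)) \<partial>M)"
      proof (rule decseq_SucI, rule integral_mono[OF int int])
        fix m \<omega> assume w: "\<omega> \<in> space M"
        show "(\<Prod>i<Suc m. \<Psi> (x j * T i \<omega>)) \<le> (\<Prod>i<m. \<Psi> (x j * T i \<omega>))"
          using nn[OF w] \<Psi> by (intro prod_le_prod_subset) auto
      qed
      then have "\<Phi> (x j) \<le> (\<integral>\<omega>. (\<Prod>i<n\<^sub>0. \<Psi> (x j * T i \<omega>)) \<partial>M)"
        using eq[OF x(1)] by (rule decseq_ge)
      also have "\<dots> \<le> (\<integral>\<omega>. (\<Prod>i<n\<^sub>0. if alive n\<^sub>0 i \<omega> then \<Phi> (x j * T i \<omega>) else 1) \<partial>M)"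
      proof (rule integral_mono[OF int])
        show "integrable M (\<lambda>\<omega>. \<Prod>i<n\<^sub>0. if alive n\<^sub>0 i \<omega> then \<Phi> (x j * T i \<omega>) else 1)"
        proof (rule M.integrable_const_bound[of _ 1])
          show "AE \<omega> in M. norm (\<Prod>i<n\<^sub>0. if alive n\<^sub>0 i \<omega> then \<Phi> (x j * T i \<omega>) else 1) \<le> 1"
            using x \<Phi> by (intro AE_I2) (auto simp: abs_prod alive_def intro!: prod_le_1)
        qed measurable
        fix \<omega> assume w: "\<omega> \<in> space M"
        show "(\<Prod>i<n\<^sub>0. \<Psi> (x j * T i \<omega>)) \<le> (\<Prod>i<n\<^sub>0. if alive n\<^sub>0 i \<omega> then \<Phi> (x j * T i \<omega>) else 1)"
        proof (intro prod_mono conjI)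
          fix i
          show "0 \<le> \<Psi> (x j * T i \<omega>)" by (rule \<Psi>(1)[OF nn[OF w]])
          show "\<Psi> (x j * T i \<omega>) \<le> (if alive n\<^sub>0 i \<omega> then \<Phi> (x j * T i \<omega>) else 1)"
          proof (cases "alive n\<^sub>0 i \<omega>")
            case True
            then have "x j * T i \<omega> \<noteq> 0" using x(1)[of j] by (simp add: alive_def)
            then show ?thesis using True by (simp add: \<Psi>_def)
          qed (use \<Psi>(2)[OF nn[OF w]] in simp)
        qed
      qed
      finally show ?thesis .
    qed
    then show "\<exists>m. \<forall>j\<ge>m. \<Phi> (x j) \<le> (\<integral>\<omega>. (\<Prod>i<n\<^sub>0. if alive n\<^sub>0 i \<omega> then \<Phi> (x j * T i \<omega>) else 1) \<partial>M)"
      by blast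
  qed
  \<comment> \<open>For c <= \<Gamma> < 1 the choice of c would give \<open>genfun\<close> at
    \<Gamma> below \<Gamma>.\<close>
  ultimately have "\<not> \<Gamma> < 1" using c(3)[of \<Gamma>] by force
  then have "measure \<nu> {0<..} = 1" using \<nu>.prob_le_1[of "{0<..}"] by (simp add: \<Gamma>_def)
  then obtain P where P: "nonneg_law P" and lapP: "\<And>t. 0 < t \<Longrightarrow> laplace P t = \<Phi> t"
    using laplace_of_power_mean[OF \<nu>] unfolding \<Phi>_def by metis
  have lapP0: "laplace P t = \<Psi> t" if "0 \<le> t" for t
    using that lapP[of t] by (cases "t = 0") (auto simp: \<Psi>_def nonneg_law.laplace_0[OF P])
  show ?thesis
  proof (rule that)
    show "P \<in> fixed_points M (\<lambda>_. 0) T"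
    proof (rule fixed_pointI[OF P])
      fix t :: real assume t: "0 < t"
      have "(\<integral>\<omega>. (\<Prod>i<j. laplace P (t * T i \<omega>)) \<partial>M) = (\<integral>\<omega>. (\<Prod>i<j. \<Psi> (t * T i \<omega>)) \<partial>M)" for j
        using T_nonneg t by (intro Bochner_Integration.integral_cong prod.cong refl lapP0) auto
      then show "(\<lambda>j. \<integral>\<omega>. (\<Prod>i<j. laplace P (t * T i \<omega>)) \<partial>M) \<longlonglongrightarrow> laplace P t"
        using eq[OF t] lapP[OF t] by simp
    qed
    show "P \<noteq> return borel 0"
    proof
      assume "P = return borel 0"
      then have "laplace P 1 = 1" by (simp add: laplace_def integral_return)
      \<comment> \<open>The normalisation at 1 survives the limit, and c < 1 rules out the Dirac
        measure.\<close>
      moreover have "laplace P 1 = c"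
        using conv[of 1] lapP[of 1] by (simp add: \<phi>_def Q1 LIMSEQ_const_iff)
      ultimately show False using c by simp
    qed
  qed
qed

end

section \<open>Combination of necessity and sufficiency\<close>

theorem theorem6p1:
  fixes M :: "'a measure" and C :: "'a \<Rightarrow> real" and T :: "nat \<Rightarrow> 'a \<Rightarrow> real"
  assumes "prob_space M"
    and "C \<in> borel_measurable M" and "\<And>i. T i \<in> borel_measurable M"
    and "\<And>\<omega>. \<omega> \<in> space M \<Longrightarrow> 0 \<le> C \<omega>" and "\<And>i \<omega>. \<omega> \<in> space M \<Longrightarrow> 0 \<le> T i \<omega>"
    and "measure M {\<omega> \<in> space M. \<forall>i. T i \<omega> \<in> {0, 1}} < 1"
    and "(\<integral>\<^sup>+\<omega>. offspring_number T \<omega> \<partial>M) > 1"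
  shows
    "((fixed_points M (\<lambda>_. 0) T - {return borel 0} \<noteq> {} \<longrightarrow>
        (INF \<theta>\<in>{0..1}. weight_moment M T \<theta>) \<le> 1) \<and>
      ((AE \<omega> in M. offspring_number T \<omega> < \<infinity>) \<longrightarrow>
        (fixed_points M (\<lambda>_. 0) T - {return borel 0} \<noteq> {} \<longleftrightarrow>
          (INF \<theta>\<in>{0..1}. weight_moment M T \<theta>) \<le> 1))) \<and>
     (measure M {\<omega> \<in> space M. C \<omega> > 0} > 0 \<longrightarrow>
        (fixed_points M C T \<noteq> {} \<longrightarrow> (INF \<theta>\<in>{0..1}. weight_moment M T \<theta>) \<le> 1) \<and>
        (\<forall>CC TT. weighted_branching M C T CC TT \<longrightarrow>
          (AE \<omega> in M. total_weight CC TT \<omega> < \<infinity>) \<longrightarrow>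
          (INF \<theta>\<in>{0..1}. weight_moment M T \<theta>) \<le> 1))"
proof -
  note sub = smoothing_sub.INF_weight_moment_le_1
  \<comment> \<open>A general immigration term \<open>C'\<close> serves both the homogeneous case,
    with 0, and the inhomogeneous case, with C.\<close>
  have necessary: "(INF \<theta>\<in>{0..1}. weight_moment M T \<theta>) \<le> 1"
    if "P \<in> fixed_points M C' T" "P \<noteq> return borel 0" "C' \<in> borel_measurable M" for P C'
    by (rule sub, rule smoothing_sub_fixed_point[OF assms(1) that(3) assms(3,5) that(1,2)])
  have sufficient: "fixed_points M (\<lambda>_. 0) T - {return borel 0} \<noteq> {}"
    if "AE \<omega> in M. offspring_number T \<omega> < \<infinity>" "(INF \<theta>\<in>{0..1}. weight_moment M T \<theta>) \<le> 1"
  proof -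
    interpret branching M T
      using assms(1,3,5) that(1) by (intro branching.intro branching_axioms.intro)
    show ?thesis using exists_nontrivial_fixed_point[OF assms(7) that(2)] by blast
  qed
  show ?thesis
    using necessary[of _ "\<lambda>_. 0"] necessary[of _ C] sufficient assms(2)
      fixed_point_nontrivial[OF assms(1-3)]
      sub[OF smoothing_sub_total_weight[OF assms(1-5)]]
    by (intro conjI impI iffI allI; fastforce)
qed

end
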